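(* The limit $J:=-\lim_{n\to\infty}\frac1n\log\mathbb{P}(Q_{2,n}>nb)$ exists and $$J=\inf_{f\in\overline{\mathcal S}}I(f)=\inf_{f\in\mathcal S}I(f),$$ where $\overline{\mathcal S}$ is the closure of $\mathcal S$ in $\Omega$.
   Context: Let $v:[0,\infty)\to[0,\infty)$ be continuous with $v(0)=0$ and $\lim_{t\to\infty}v(t)/t^{\alpha}=0$ for some $\alpha<2$. Let $A=(A(t))_{t\in\mathbb R}$ be a centered Gaussian process with continuous sample paths, $A(0)=0$, stationary increments and $\mathrm{Var}(A(t)-A(s))=v(|t-s|)$; write $A(s,t):=A(t)-A(s)$ and $\Gamma(s,t):=\mathrm{Cov}(A(s),A(t))=\tfrac12\big(v(|s|)+v(|t|)-v(|t-s|)\big)$ for $s,t\in\mathbb R$. Let $A_1,A_2,\dots$ be i.i.d. copies of $A$. Path space: $\Omega$ is the set of continuous $\omega:\mathbb R\to\mathbb R$ with $\omega(0)=0$ and $\omega(t)/(1+|t|)\to0$ as $t\to\pm\infty$, a separable Banach space under $\|\omega\|_\Omega:=\sup_{t\in\mathbb R}|\omega(t)|/(1+|t|)$; the $A_i$ are realized in $\Omega$. $R\subseteq\Omega$ is the reproducing kernel Hilbert space of $\Gamma$: the closure of the span of $\{\Gamma(s,\cdot):s\in\mathbb R\}$ under the inner product determined by $\langle\Gamma(s,\cdot),\Gamma(u,\cdot)\rangle_R=\Gamma(s,u)$. The rate function is $I(\omega):=\frac12\|\omega\|_R^2$ if $\omega\in R$ and $I(\omega):=\infty$ otherwise (by the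 generalized Schilder theorem, $\frac1n\sum_{i=1}^nA_i$ satisfies a large deviation principle in $\Omega$ with rate function $I$). Fix $b>0$, $c_1>c_2>0$, $t_0:=b/(c_1-c_2)$, and define $$Q_{2,n}:=\sup_{t>0}\Big(\sum_{i=1}^nA_i(-t,0)-nc_2t\Big)-\sup_{s>0}\Big(\sum_{i=1}^nA_i(-s,0)-nc_1s\Big),$$ $$\mathcal S:=\{f\in\Omega:\ \exists t>t_0\ \forall s\in(0,t):\ f(-s)-f(-t)>b+c_2t-c_1s\}.$$ *)

theory Defs
  imports "HOL-Probability.Probability"
begin

definition Gam :: "(real \<Rightarrow> real) \<Rightarrow> real \<Rightarrow> real \<Rightarrow> real" where
  "Gam v s t = (v \<bar>s\<bar> + v \<bar>t\<bar> - v \<bar>t - s\<bar>) / 2"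

definition OmegaSet :: "(real \<Rightarrow> real) set" where
  "OmegaSet = {w. continuous_on UNIV w \<and> w 0 = 0 \<and>
      ((\<lambda>t. w t / (1 + \<bar>t\<bar>)) \<longlongrightarrow> 0) at_top \<and>
      ((\<lambda>t. w t / (1 + \<bar>t\<bar>)) \<longlongrightarrow> 0) at_bot}"

definition omega_norm :: "(real \<Rightarrow> real) \<Rightarrow> real" where
  "omega_norm w = (SUP t. \<bar>w t\<bar> / (1 + \<bar>t\<bar>))"

definition omega_closure :: "(real \<Rightarrow> real) set \<Rightarrow> (real \<Rightarrow> real) set" where
  "omega_closure S = {f \<in> OmegaSet. \<forall>e>0. \<exists>g\<in>S. omega_norm (\<lambda>t. f t - g t) < e}"

definition kfun :: "(real \<Rightarrow> real \<Rightarrow> real) \<Rightarrow> (real \<times> real) list \<Rightarrow> real \<Rightarrow> real" where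
  "kfun K ps u = (\<Sum>(a, s)\<leftarrow>ps. a * K s u)"

definition kgram :: "(real \<Rightarrow> real \<Rightarrow> real) \<Rightarrow> (real \<times> real) list \<Rightarrow> real" where
  "kgram K ps = (\<Sum>(a, s)\<leftarrow>ps. \<Sum>(a', s')\<leftarrow>ps. a * a' * K s s')"

definition kdiff :: "(real \<times> real) list \<Rightarrow> (real \<times> real) list \<Rightarrow> (real \<times> real) list" where
  "kdiff ps qs = ps @ map (\<lambda>(a, s). (- a, s)) qs"

definition rkhs_approx :: "(real \<Rightarrow> real \<Rightarrow> real) \<Rightarrow> (real \<Rightarrow> real) \<Rightarrow> (nat \<Rightarrow> (real \<times> real) list) \<Rightarrow> bool" where
  "rkhs_approx K f P \<longleftrightarrow>
     (\<forall>u. (\<lambda>k. kfun K (P k) u) \<longlonglongrightarrow> f u) \<and>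
     (\<forall>e>0. \<exists>N. \<forall>k\<ge>N. \<forall>l\<ge>N. kgram K (kdiff (P k) (P l)) < e)"

text \<open>The RKHS R of K: closure of span {K(s,.)} w.r.t. the R inner product.\<close>
definition rkhs :: "(real \<Rightarrow> real \<Rightarrow> real) \<Rightarrow> (real \<Rightarrow> real) set" where
  "rkhs K = {f. \<exists>P. rkhs_approx K f P}"

definition rkhs_norm2 :: "(real \<Rightarrow> real \<Rightarrow> real) \<Rightarrow> (real \<Rightarrow> real) \<Rightarrow> real" where
  "rkhs_norm2 K f = (THE r. \<exists>P. rkhs_approx K f P \<and> (\<lambda>k. kgram K (P k)) \<longlonglongrightarrow> r)"

definition rate_fn :: "(real \<Rightarrow> real \<Rightarrow> real) \<Rightarrow> (real \<Rightarrow> real) \<Rightarrow> ereal" where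
  "rate_fn K f = (if f \<in> rkhs K then ereal (rkhs_norm2 K f / 2) else \<infinity>)"

definition centered_normal_law :: "real \<Rightarrow> real measure" where
  "centered_normal_law s = (if s = 0 then return borel 0
     else density lborel (\<lambda>x. ennreal (normal_density 0 (sqrt s) x)))"

definition centered_gaussian_process :: "'a measure \<Rightarrow> (real \<Rightarrow> real) \<Rightarrow> (real \<Rightarrow> 'a \<Rightarrow> real) \<Rightarrow> bool" where
  "centered_gaussian_process M v X \<longleftrightarrow>
     (\<forall>t. X t \<in> borel_measurable M) \<and>
     (\<forall>ps. distr M borel (\<lambda>\<omega>. \<Sum>(a, t)\<leftarrow>ps. a * X t \<omega>) = centered_normal_law (kgram (Gam v) ps))"

definition Q2 :: "(nat \<Rightarrow> real \<Rightarrow> 'a \<Rightarrow> real) \<Rightarrow> real \<Rightarrow> real \<Rightarrow> nat \<Rightarrow> 'a \<Rightarrow> real" where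
  "Q2 A c1 c2 n \<omega> =
     (SUP t\<in>{0<..}. (\<Sum>i<n. A i 0 \<omega> - A i (- t) \<omega>) - real n * c2 * t)
   - (SUP s\<in>{0<..}. (\<Sum>i<n. A i 0 \<omega> - A i (- s) \<omega>) - real n * c1 * s)"

definition Sset :: "real \<Rightarrow> real \<Rightarrow> real \<Rightarrow> (real \<Rightarrow> real) set" where
  "Sset b c1 c2 = {f \<in> OmegaSet. \<exists>t > b / (c1 - c2).
      \<forall>s\<in>{0<..<t}. f (- s) - f (- t) > b + c2 * t - c1 * s}"

definition neglog :: "real \<Rightarrow> ereal" where
  "neglog p = (if p \<le> 0 then \<infinity> else ereal (- ln p))"

end

theory Submission
  imports Defs
begin

text \<open>
  The sum of \<open>n\<close> copies divided by \<open>sqrt n\<close> has the law of a single copy \<open>A\<close>, so everything is an estimate for the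
  probability that \<open>A / sqrt n\<close> exceeds strictly: for some \<open>t\<close>, the path satisfies
  \<open>w (- s) - w (- t) \<ge> b + c2 * t - c1 * s + \<eta>\<close> on \<open>[0, t]\<close> with \<open>\<eta> > 0\<close>; weak exceedance allows \<open>\<eta> = 0\<close> and
  contains the closure of \<open>Sset\<close>.

  Upper bound: for fixed \<open>t\<close>, convex duality over finite nonnegative combinations of the constraints yields one Gaussian
  variable whose Chernoff bound has rate \<open>L\<close>, unless some function of energy at most \<open>L\<close> exceeds weakly at \<open>t\<close>.
  Fernique's inequality makes oscillations over short intervals and excursions at large times negligible at every
  exponential rate, so finitely many \<open>t\<close> suffice.

  Lower bound: the component of \<open>A\<close> along a kernel function \<open>f\<close> can be resampled independently without changing the
  law, which reduces the estimate near \<open>f\<close> to a one-dimensional Gaussian integral.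

  The two bounds match because a weak exceedance of finite energy can be turned into a strict one at arbitrarily small
  extra energy. If \<open>t = b / (c1 - c2)\<close>, scale and shift in time. Otherwise add a small multiple of kernel functions
  that are minimal at \<open>- t\<close>; this fails only if \<open>A\<close> has period \<open>t - s\<close> for an active constraint \<open>s\<close>, in which case \<open>s\<close>
  can replace \<open>t\<close> with room to spare.
\<close>

text \<open>No large deviation principle is quoted: both exponential estimates are proved for this
  one event. The energy enters only through its sublevel sets, since \<open>rate_fn_le_iff\<close>
  turns \<open>rate_fn K f \<le> x\<close> into a bound on \<open>leval f\<close> over finite
  combinations of point evaluations. Finite combinations are also what the probabilistic side
  provides: their laws are normal, and they determine the law of the whole process. The event
  involves a continuum of times and unbounded \<open>t\<close>, whereas a Chernoff bound sees a
  single combination. The passage between the two is paid for by path regularity at arbitrary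
  exponential rates, hence Fernique's inequality. The gap between closed and open conditions is a
  separate obstacle. At \<open>s = t\<close> the constraint does not involve the path at all, and if
  \<open>v\<close> vanishes at \<open>t - s\<close> then no path of finite energy can separate
  \<open>- s\<close> from \<open>- t\<close>. Every estimate is stated for an arbitrary real rate,
  so an infinite \<open>J\<close> is covered as well.\<close>

section \<open>The kernel Hilbert space as the dominated functions\<close>

text \<open>A list of pairs stands for a finite signed measure, repetitions allowed, and
  \<open>leval\<close> integrates against it. The index type is left open because the rotation
  argument uses pairs of a Boolean and a time as indices.\<close>

definition leval :: "('i \<Rightarrow> real) \<Rightarrow> (real \<times> 'i) list \<Rightarrow> real" where
  "leval f ps = (\<Sum>(a, s)\<leftarrow>ps. a * f s)"

definition scal :: "real \<Rightarrow> (real \<times> 'i) list \<Rightarrow> (real \<times> 'i) list" where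
  "scal c ps = map (\<lambda>(a, s). (c * a, s)) ps"

lemma leval_Nil [simp]: "leval f [] = 0"
  and leval_Cons [simp]: "leval f ((a, s) # ps) = a * f s + leval f ps"
  and leval_append [simp]: "leval f (ps @ qs) = leval f ps + leval f qs"
  by (simp_all add: leval_def)

lemma scal_Nil [simp]: "scal c [] = []"
  and scal_Cons [simp]: "scal c ((a, s) # ps) = (c * a, s) # scal c ps"
  and scal_append [simp]: "scal c (ps @ qs) = scal c ps @ scal c qs"
  by (simp_all add: scal_def)

lemma leval_scal [simp]: "leval f (scal c ps) = c * leval f ps"
  by (induction ps) (auto simp: algebra_simps)

lemma leval_add: "leval (\<lambda>s. f s + g s) ps = leval f ps + leval g ps"
  by (induction ps) (auto simp: algebra_simps)

lemma leval_diff: "leval (\<lambda>s. f s - g s) ps = leval f ps - leval g ps"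
  by (induction ps) (auto simp: algebra_simps)

lemma leval_cmult: "leval (\<lambda>s. c * f s) ps = c * leval f ps"
  by (induction ps) (auto simp: algebra_simps)

lemma leval_multc: "leval (\<lambda>s. f s * c) ps = leval f ps * c"
  by (induction ps) (auto simp: algebra_simps)

lemma leval_zero [simp]: "leval (\<lambda>s. 0) ps = 0"
  by (induction ps) auto

lemma leval_sum: "leval (\<lambda>s. \<Sum>i\<in>I. f i s) ps = (\<Sum>i\<in>I. leval (f i) ps)"
  by (induction ps) (auto simp: sum.distrib sum_distrib_left)

lemma leval_swap: "leval (\<lambda>s. leval (\<lambda>u. K s u) qs) ps = leval (\<lambda>u. leval (\<lambda>s. K s u) ps) qs"
  by (induction qs) (auto simp: leval_add leval_cmult)

lemma tendsto_leval [tendsto_intros]: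
  assumes "\<And>s. ((\<lambda>k. f k s) \<longlongrightarrow> g s) F"
  shows "((\<lambda>k. leval (f k) ps) \<longlongrightarrow> leval g ps) F"
  by (induction ps) (auto intro!: tendsto_intros assms)

lemma borel_measurable_leval [measurable (raw)]:
  assumes "\<And>s. (\<lambda>z. f z s) \<in> borel_measurable M"
  shows "(\<lambda>z. leval (f z) ps) \<in> borel_measurable M"
proof (induction ps)
  case (Cons p ps)
  then show ?case
    using assms by (cases p) auto
qed simp

lemma kfun_eq_leval: "kfun K ps u = leval (\<lambda>s. K s u) ps"
  by (simp add: kfun_def leval_def)

lemma sum_list_cmult: "(\<Sum>(a, s)\<leftarrow>ps. c * a * (f s::real)) = c * leval f ps"
  by (induction ps) (auto simp: algebra_simps)

text \<open>Polarization of \<open>kgram\<close>: the RKHS inner product of the kernel functions of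
  two lists.\<close>

definition kin :: "(real \<Rightarrow> real \<Rightarrow> real) \<Rightarrow> (real \<times> real) list \<Rightarrow> (real \<times> real) list \<Rightarrow> real" where
  "kin K ps qs = leval (\<lambda>s. leval (K s) qs) ps"

lemma kgram_eq_kin: "kgram K ps = kin K ps ps"
  unfolding kgram_def kin_def
  by (subst sum_list_cmult) (simp add: leval_def)

lemma kdiff_eq: "kdiff ps qs = ps @ scal (- 1) qs"
  by (simp add: kdiff_def scal_def)

lemma kin_append [simp]:
  "kin K (ps @ ps') qs = kin K ps qs + kin K ps' qs"
  "kin K ps (qs @ qs') = kin K ps qs + kin K ps qs'"
  by (simp_all add: kin_def leval_add)

lemma kin_scal [simp]:
  "kin K (scal c ps) qs = c * kin K ps qs"
  "kin K ps (scal c qs) = c * kin K ps qs"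
  by (simp_all add: kin_def leval_cmult)

lemma leval_kfun: "leval (kfun K ps) qs = kin K ps qs"
proof -
  have "kfun K ps = (\<lambda>u. leval (\<lambda>s. K s u) ps)"
    by (simp add: fun_eq_iff kfun_eq_leval)
  then show ?thesis
    unfolding kin_def using leval_swap[of K qs ps] by simp
qed

lemma kfun_eq_kin: "kfun K ps u = kin K ps [(1, u)]"
  by (simp add: kfun_eq_leval kin_def)

locale psd_kernel =
  fixes K :: "real \<Rightarrow> real \<Rightarrow> real"
  assumes K_sym: "K s u = K u s"
    and kgram_nonneg: "0 \<le> kgram K ps"
begin

lemma kin_sym: "kin K ps qs = kin K qs ps"
proof -
  have "kin K ps qs = leval (\<lambda>s. leval (\<lambda>u. K s u) qs) ps"
    by (simp add: kin_def)
  also have "\<dots> = leval (\<lambda>u. leval (\<lambda>s. K s u) ps) qs"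
    by (rule leval_swap)
  also have "\<dots> = kin K qs ps"
    unfolding kin_def by (simp add: K_sym)
  finally show ?thesis .
qed

lemma kgram_append: "kgram K (ps @ qs) = kgram K ps + 2 * kin K ps qs + kgram K qs"
  by (simp add: kgram_eq_kin kin_sym[of qs ps])

lemma kgram_scal: "kgram K (scal c ps) = c\<^sup>2 * kgram K ps"
  by (simp add: kgram_eq_kin power2_eq_square)

lemma kgram_kdiff: "kgram K (kdiff ps qs) = kgram K ps - 2 * kin K ps qs + kgram K qs"
  by (simp add: kdiff_eq kgram_append kgram_scal)

lemma kin_Cauchy_Schwarz: "(kin K ps qs)\<^sup>2 \<le> kgram K ps * kgram K qs"
proof -
  let ?p = "kgram K ps" and ?q = "kgram K qs" and ?k = "kin K ps qs"
  have *: "0 \<le> ?p + 2 * c * ?k + c\<^sup>2 * ?q" for c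
    using kgram_nonneg[of "ps @ scal c qs"] by (simp add: kgram_append kgram_scal)
  show ?thesis
  proof (cases "?q = 0")
    case True
    have "?k = 0"
    proof (rule ccontr)
      assume "?k \<noteq> 0"
      \<comment> \<open>At the chosen \<open>c\<close> the affine expression
        \<open>?p + 2 * c * ?k\<close> equals -1.\<close>
      then show False
        using *[of "- (?p + 1) / (2 * ?k)"] True by (simp add: field_simps)
    qed
    then show ?thesis
      using True by simp
  next
    case False
    then have q: "?q > 0"
      using kgram_nonneg[of qs] by simp
    \<comment> \<open>The value \<open>- ?k / ?q\<close> minimizes the quadratic polynomial in
      \<open>c\<close>.\<close>
    have "0 \<le> ?q * (?p + 2 * (- ?k / ?q) * ?k + (- ?k / ?q)\<^sup>2 * ?q)"
      using q *[of "- ?k / ?q"] by simp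
    also have "\<dots> = ?p * ?q - ?k\<^sup>2"
      using q by (simp add: field_simps power2_eq_square)
    finally show ?thesis
      by simp
  qed
qed

lemma abs_kin_le: "\<bar>kin K ps qs\<bar> \<le> sqrt (kgram K ps) * sqrt (kgram K qs)"
  using kin_Cauchy_Schwarz[of ps qs] by (metis real_sqrt_abs real_sqrt_le_iff real_sqrt_mult)

lemma sqrt_kgram_triangle: "sqrt (kgram K ps) \<le> sqrt (kgram K qs) + sqrt (kgram K (kdiff ps qs))"
proof (rule real_le_lsqrt)
  have "kgram K ps = kgram K qs + 2 * kin K qs (kdiff ps qs) + kgram K (kdiff ps qs)"
    by (simp add: kgram_kdiff) (simp add: kdiff_eq kgram_eq_kin kin_sym[of qs ps])
  also have "\<dots> \<le> (sqrt (kgram K qs) + sqrt (kgram K (kdiff ps qs)))\<^sup>2"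
    using abs_kin_le[of qs "kdiff ps qs"]
    by (simp add: power2_sum kgram_nonneg)
  finally show "kgram K ps \<le> (sqrt (kgram K qs) + sqrt (kgram K (kdiff ps qs)))\<^sup>2" .
qed (simp_all add: kgram_nonneg)

text \<open>Boundedness of the functional \<open>leval f\<close> for the seminorm
  \<open>sqrt (kgram K ps)\<close>, with squared norm at most \<open>c\<close>. By
  \<open>rkhs_dominated\<close> and \<open>dominated_rkhs\<close> this is the RKHS ball of radius
  \<open>sqrt c\<close>, expressed without limits.\<close>

definition dominated :: "(real \<Rightarrow> real) \<Rightarrow> real \<Rightarrow> bool" where
  "dominated f c \<longleftrightarrow> 0 \<le> c \<and> (\<forall>ps. (leval f ps)\<^sup>2 \<le> c * kgram K ps)"

lemma dominated_kfun: "dominated (kfun K ps) (kgram K ps)"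
  unfolding dominated_def leval_kfun by (simp add: kin_Cauchy_Schwarz kgram_nonneg)

lemma dominated_abs: "dominated f c \<Longrightarrow> \<bar>leval f ps\<bar> \<le> sqrt c * sqrt (kgram K ps)"
  unfolding dominated_def by (metis real_sqrt_abs real_sqrt_le_iff real_sqrt_mult)

lemma dominated_cmult: "dominated f c \<Longrightarrow> dominated (\<lambda>u. a * f u) (a\<^sup>2 * c)"
  unfolding dominated_def by (auto simp: leval_cmult power_mult_distrib mult.assoc intro!: mult_left_mono)

lemma dominated_add:
  assumes "dominated f c" "dominated g d"
  shows "dominated (\<lambda>u. f u + g u) ((sqrt c + sqrt d)\<^sup>2)"
  unfolding dominated_def
proof (intro conjI allI)
  fix ps
  have "\<bar>leval f ps + leval g ps\<bar> \<le> (sqrt c + sqrt d) * sqrt (kgram K ps)"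
    using dominated_abs[OF assms(1), of ps] dominated_abs[OF assms(2), of ps] by (simp add: algebra_simps)
  then have "\<bar>leval f ps + leval g ps\<bar>\<^sup>2 \<le> ((sqrt c + sqrt d) * sqrt (kgram K ps))\<^sup>2"
    by (intro power_mono) auto
  then show "(leval (\<lambda>u. f u + g u) ps)\<^sup>2 \<le> (sqrt c + sqrt d)\<^sup>2 * kgram K ps"
    by (simp add: leval_add power_mult_distrib kgram_nonneg)
qed simp

section \<open>Limits of kernel combinations and the RKHS norm\<close>

lemma rkhs_approx_kin:
  assumes "rkhs_approx K f P"
  shows "(\<lambda>k. kin K (P k) qs) \<longlonglongrightarrow> leval f qs"
proof -
  have "(\<lambda>k. leval (kfun K (P k)) qs) \<longlonglongrightarrow> leval f qs"
    using assms unfolding rkhs_approx_def by (intro tendsto_leval) auto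
  then show ?thesis
    by (simp add: leval_kfun)
qed

lemma rkhs_approx_CauchyD:
  assumes "rkhs_approx K f P" "0 < e"
  obtains N where "\<And>k l. N \<le> k \<Longrightarrow> N \<le> l \<Longrightarrow> sqrt (kgram K (kdiff (P k) (P l))) < e"
proof -
  from assms obtain N where "\<forall>k\<ge>N. \<forall>l\<ge>N. kgram K (kdiff (P k) (P l)) < e\<^sup>2"
    unfolding rkhs_approx_def by (meson zero_less_power)
  then have "sqrt (kgram K (kdiff (P k) (P l))) < e" if "N \<le> k" "N \<le> l" for k l
    using that assms(2) by (metis abs_of_pos real_sqrt_abs real_sqrt_less_iff)
  then show ?thesis
    using that by blast
qed

lemma rkhs_approx_convergent:
  assumes "rkhs_approx K f P"
  shows "\<exists>r\<ge>0. (\<lambda>k. kgram K (P k)) \<longlonglongrightarrow> r"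
proof -
  have "Cauchy (\<lambda>k. sqrt (kgram K (P k)))"
  proof (rule metric_CauchyI)
    fix e :: real assume "0 < e"
    then obtain N where N: "\<And>k l. N \<le> k \<Longrightarrow> N \<le> l \<Longrightarrow> sqrt (kgram K (kdiff (P k) (P l))) < e"
      using rkhs_approx_CauchyD[OF assms] by blast
    have "dist (sqrt (kgram K (P k))) (sqrt (kgram K (P l))) < e" if "N \<le> k" "N \<le> l" for k l
      using N[OF that] N[OF that(2,1)] sqrt_kgram_triangle[of "P k" "P l"] sqrt_kgram_triangle[of "P l" "P k"]
      by (auto simp: dist_real_def abs_less_iff)
    then show "\<exists>N. \<forall>k\<ge>N. \<forall>l\<ge>N. dist (sqrt (kgram K (P k))) (sqrt (kgram K (P l))) < e"
      by blast
  qed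
  then obtain q where q: "(\<lambda>k. sqrt (kgram K (P k))) \<longlonglongrightarrow> q"
    by (auto simp: Cauchy_convergent_iff convergent_def)
  then have "(\<lambda>k. (sqrt (kgram K (P k)))\<^sup>2) \<longlonglongrightarrow> q\<^sup>2"
    by (intro tendsto_intros)
  then show ?thesis
    by (intro exI[of _ "q\<^sup>2"]) (simp add: kgram_nonneg)
qed

lemma rkhs_approx_dominated:
  assumes "rkhs_approx K f P" "(\<lambda>k. kgram K (P k)) \<longlonglongrightarrow> r"
  shows "dominated f r"
  unfolding dominated_def
proof (intro conjI allI)
  show "0 \<le> r"
    by (rule LIMSEQ_le_const[OF assms(2)]) (simp add: kgram_nonneg)
  fix qs
  have "(\<lambda>k. (kin K (P k) qs)\<^sup>2) \<longlonglongrightarrow> (leval f qs)\<^sup>2"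
    by (intro tendsto_intros rkhs_approx_kin assms)
  moreover have "(\<lambda>k. kgram K (P k) * kgram K qs) \<longlonglongrightarrow> r * kgram K qs"
    by (intro tendsto_intros assms)
  ultimately show "(leval f qs)\<^sup>2 \<le> r * kgram K qs"
    by (rule LIMSEQ_le) (simp add: kin_Cauchy_Schwarz)
qed

text \<open>Norm convergence in dual form: Cauchy-Schwarz for the difference of \<open>P l\<close>
  and \<open>P k\<close> passes to the limit in \<open>l\<close>. The index \<open>N\<close> serves
  all \<open>qs\<close> at once, so \<open>qs\<close> may later be \<open>P k\<close>
  itself.\<close>

lemma rkhs_approx_kgram_kdiff_le:
  assumes "rkhs_approx K f P" "0 < e"
  shows "\<exists>N. \<forall>k\<ge>N. \<forall>qs. \<bar>leval f qs - kin K (P k) qs\<bar> \<le> e * sqrt (kgram K qs)"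
proof -
  obtain N where N: "\<And>k l. N \<le> k \<Longrightarrow> N \<le> l \<Longrightarrow> sqrt (kgram K (kdiff (P k) (P l))) < e"
    using rkhs_approx_CauchyD[OF assms] by blast
  have "\<bar>leval f qs - kin K (P k) qs\<bar> \<le> e * sqrt (kgram K qs)" if k: "N \<le> k" for k qs
  proof (rule LIMSEQ_le_const2)
    show "(\<lambda>l. \<bar>kin K (P l) qs - kin K (P k) qs\<bar>) \<longlonglongrightarrow> \<bar>leval f qs - kin K (P k) qs\<bar>"
      by (intro tendsto_intros rkhs_approx_kin assms)
    have "\<bar>kin K (P l) qs - kin K (P k) qs\<bar> \<le> e * sqrt (kgram K qs)" if l: "N \<le> l" for l
    proof -
      have "\<bar>kin K (P l) qs - kin K (P k) qs\<bar> = \<bar>kin K (kdiff (P l) (P k)) qs\<bar>"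
        by (simp add: kdiff_eq)
      also have "\<dots> \<le> sqrt (kgram K (kdiff (P l) (P k))) * sqrt (kgram K qs)"
        by (rule abs_kin_le)
      also have "\<dots> \<le> e * sqrt (kgram K qs)"
        using N[OF l k] by (intro mult_right_mono) (auto simp: kgram_nonneg)
      finally show ?thesis .
    qed
    then show "\<exists>N. \<forall>l\<ge>N. \<bar>kin K (P l) qs - kin K (P k) qs\<bar> \<le> e * sqrt (kgram K qs)"
      by blast
  qed
  then show ?thesis
    by blast
qed

text \<open>Testing \<open>f\<close> against \<open>P k\<close>: \<open>leval f (P k)\<close>
  differs from \<open>kgram K (P k)\<close> by at most \<open>e * sqrt (kgram K (P k))\<close>, so
  the limit satisfies \<open>r \<le> sqrt c * sqrt r\<close>. Together with
  \<open>rkhs_approx_dominated\<close>, \<open>r\<close> is the least dominating constant.\<close>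

lemma rkhs_approx_lim_le:
  assumes P: "rkhs_approx K f P" "(\<lambda>k. kgram K (P k)) \<longlonglongrightarrow> r" and "dominated f c"
  shows "r \<le> c"
proof -
  have r: "0 \<le> r"
    by (rule LIMSEQ_le_const[OF P(2)]) (simp add: kgram_nonneg)
  have c: "0 \<le> c"
    using assms(3) by (simp add: dominated_def)
  have "r - e * sqrt r \<le> sqrt c * sqrt r" if e: "0 < e" for e
  proof (rule LIMSEQ_le)
    show "(\<lambda>k. kgram K (P k) - e * sqrt (kgram K (P k))) \<longlonglongrightarrow> r - e * sqrt r"
      "(\<lambda>k. sqrt c * sqrt (kgram K (P k))) \<longlonglongrightarrow> sqrt c * sqrt r"
      by (intro tendsto_intros P)+
    obtain N where N: "\<And>k qs. N \<le> k \<Longrightarrow> \<bar>leval f qs - kin K (P k) qs\<bar> \<le> e * sqrt (kgram K qs)"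
      using rkhs_approx_kgram_kdiff_le[OF P(1) e] by blast
    have "kgram K (P k) - e * sqrt (kgram K (P k)) \<le> sqrt c * sqrt (kgram K (P k))" if "N \<le> k" for k
      using N[OF that, of "P k"] dominated_abs[OF assms(3), of "P k"] by (simp add: kgram_eq_kin)
    then show "\<exists>N. \<forall>k\<ge>N. kgram K (P k) - e * sqrt (kgram K (P k)) \<le> sqrt c * sqrt (kgram K (P k))"
      by blast
  qed
  then have "r \<le> sqrt c * sqrt r + e * sqrt r" if "0 < e" for e
    using that by (simp add: algebra_simps)
  then have "sqrt r * sqrt r \<le> (sqrt c + e) * sqrt r" if "0 < e" for e
    using that r by (simp add: algebra_simps)
  then have *: "r = 0 \<or> sqrt r \<le> sqrt c + e" if "0 < e" for e
    using that r by (metis mult_le_cancel_right less_eq_real_def real_sqrt_gt_0_iff)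
  show ?thesis
    using * c by (metis field_le_epsilon real_sqrt_le_iff)
qed

text \<open>The definite description in \<open>rkhs_norm2\<close> is legitimate: each limit is a
  dominating constant and lies below every dominating constant, so all limits agree.\<close>

lemma rkhs_norm2_exists:
  assumes "f \<in> rkhs K"
  shows "\<exists>P. rkhs_approx K f P \<and> (\<lambda>k. kgram K (P k)) \<longlonglongrightarrow> rkhs_norm2 K f"
proof -
  obtain P where P: "rkhs_approx K f P"
    using assms by (auto simp: rkhs_def)
  obtain r where r: "(\<lambda>k. kgram K (P k)) \<longlonglongrightarrow> r"
    using rkhs_approx_convergent[OF P] by blast
  have "\<exists>!r. \<exists>P. rkhs_approx K f P \<and> (\<lambda>k. kgram K (P k)) \<longlonglongrightarrow> r"
  proof (rule ex1I)
    show "\<exists>P. rkhs_approx K f P \<and> (\<lambda>k. kgram K (P k)) \<longlonglongrightarrow> r"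
      using P r by blast
    show "r' = r" if "\<exists>P. rkhs_approx K f P \<and> (\<lambda>k. kgram K (P k)) \<longlonglongrightarrow> r'" for r'
      using that P r by (auto intro!: antisym elim: rkhs_approx_lim_le intro: rkhs_approx_dominated)
  qed
  from theI'[OF this] show ?thesis
    unfolding rkhs_norm2_def .
qed

lemma rkhs_dominated: "f \<in> rkhs K \<Longrightarrow> dominated f (rkhs_norm2 K f)"
  using rkhs_norm2_exists rkhs_approx_dominated by blast

lemma rkhs_norm2_le: "f \<in> rkhs K \<Longrightarrow> dominated f c \<Longrightarrow> rkhs_norm2 K f \<le> c"
  using rkhs_norm2_exists rkhs_approx_lim_le by blast

text \<open>The functional \<open>leval \<gamma> - kgram / 2\<close> is strongly concave, so a maximizing sequence in the cone
  is Cauchy; first-order optimality makes its limit dominate \<open>\<gamma>\<close> on the cone.\<close>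

lemma cone_maximizer:
  assumes Nil: "[] \<in> C"
    and app: "\<And>ps qs. ps \<in> C \<Longrightarrow> qs \<in> C \<Longrightarrow> ps @ qs \<in> C"
    and sc: "\<And>c ps. 0 \<le> c \<Longrightarrow> ps \<in> C \<Longrightarrow> scal c ps \<in> C"
    and bound: "\<And>ps. ps \<in> C \<Longrightarrow> leval \<gamma> ps - kgram K ps / 2 \<le> d"
  shows "\<exists>f\<in>rkhs K. rkhs_norm2 K f \<le> 2 * d \<and> (\<forall>qs\<in>C. leval \<gamma> qs \<le> leval f qs)"
proof -
  define \<Phi> where "\<Phi> ps = leval \<gamma> ps - kgram K ps / 2" for ps
  define D where "D = (SUP ps\<in>C. \<Phi> ps)"
  have bdd: "bdd_above (\<Phi> ` C)"
    using bound by (auto simp: \<Phi>_def bdd_above_def)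
  have le_D: "\<Phi> ps \<le> D" if "ps \<in> C" for ps
    unfolding D_def by (rule cSUP_upper[OF that bdd])
  have D_le: "D \<le> d"
    unfolding D_def using Nil bound by (intro cSUP_least) (auto simp: \<Phi>_def)
  have "\<exists>ps\<in>C. D - 1 / real (Suc k) < \<Phi> ps" for k
    using less_cSUP_iff[of C \<Phi> "D - 1 / real (Suc k)"] Nil bdd by (auto simp: D_def)
  then obtain P where PC: "\<And>k. P k \<in> C" and PD: "\<And>k. D - 1 / real (Suc k) < \<Phi> (P k)"
    by metis
  have cau: "kgram K (kdiff (P k) (P l)) \<le> 4 * (1 / real (Suc k) + 1 / real (Suc l))" for k l
  proof -
    have "\<Phi> (scal (1/2) (P k @ P l)) \<le> D"
      by (intro le_D sc app PC) simp
    \<comment> \<open>Parallelogram identity: the midpoint gains an eighth of the squared distance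
      over the average, so near-maximizers are close to each other.\<close>
    moreover have "\<Phi> (scal (1/2) (P k @ P l)) = \<Phi> (P k) / 2 + \<Phi> (P l) / 2 + kgram K (kdiff (P k) (P l)) / 8"
      unfolding \<Phi>_def kgram_scal kgram_append kgram_kdiff leval_scal leval_append
      by (simp add: power2_eq_square algebra_simps add_divide_distrib diff_divide_distrib)
    ultimately show ?thesis
      using PD[of k] PD[of l] unfolding ring_distribs by linarith
  qed
  have small: "\<exists>N. \<forall>k\<ge>N. \<forall>l\<ge>N. kgram K (kdiff (P k) (P l)) < e" if e: "0 < e" for e
  proof -
    obtain N :: nat where N: "8 / e < real N"
      using reals_Archimedean2 by blast
    have "kgram K (kdiff (P k) (P l)) < e" if "N \<le> k" "N \<le> l" for k l
    proof -
      have "1 / real (Suc k) < e / 8" "1 / real (Suc l) < e / 8"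
        using N e that by (auto simp: field_simps intro: less_le_trans)
          (smt (verit, best) mult_left_mono of_nat_mono)+
      then show ?thesis
        using cau[of k l] by simp
    qed
    then show ?thesis
      by blast
  qed
  have "Cauchy (\<lambda>k. kfun K (P k) u)" for u
  proof (rule metric_CauchyI)
    fix e :: real assume e: "0 < e"
    define g where "g = kgram K [(1, u)]"
    have g: "0 \<le> g"
      by (simp add: g_def kgram_nonneg)
    obtain N where N: "\<And>k l. N \<le> k \<Longrightarrow> N \<le> l \<Longrightarrow> kgram K (kdiff (P k) (P l)) < e\<^sup>2 / (g + 1)"
      using small[of "e\<^sup>2 / (g + 1)"] e g by auto
    have "dist (kfun K (P k) u) (kfun K (P l) u) < e" if "N \<le> k" "N \<le> l" for k l
    proof -
      have "(kfun K (P k) u - kfun K (P l) u)\<^sup>2 = (kin K (kdiff (P k) (P l)) [(1, u)])\<^sup>2"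
        by (simp add: kfun_eq_kin kdiff_eq)
      also have "\<dots> \<le> kgram K (kdiff (P k) (P l)) * g"
        unfolding g_def by (rule kin_Cauchy_Schwarz)
      also have "\<dots> \<le> kgram K (kdiff (P k) (P l)) * (g + 1)"
        by (intro mult_left_mono) (auto simp: kgram_nonneg)
      also have "\<dots> < e\<^sup>2"
        using N[OF that] g by (simp add: field_simps)
      finally show ?thesis
        using e unfolding dist_real_def by (intro power2_less_imp_less[of "\<bar>_\<bar>"]) auto
    qed
    then show "\<exists>N. \<forall>k\<ge>N. \<forall>l\<ge>N. dist (kfun K (P k) u) (kfun K (P l) u) < e"
      by blast
  qed
  then have "\<exists>l. (\<lambda>k. kfun K (P k) u) \<longlonglongrightarrow> l" for u
    by (simp add: Cauchy_convergent_iff convergent_def)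
  then obtain f where "\<And>u. (\<lambda>k. kfun K (P k) u) \<longlonglongrightarrow> f u"
    by metis
  then have P: "rkhs_approx K f P"
    unfolding rkhs_approx_def using small by blast
  then have f: "f \<in> rkhs K"
    by (auto simp: rkhs_def)
  obtain r where r: "(\<lambda>k. kgram K (P k)) \<longlonglongrightarrow> r"
    using rkhs_approx_convergent[OF P] by blast
  have \<Phi>_lim: "(\<lambda>k. \<Phi> (P k)) \<longlonglongrightarrow> D"
  proof (rule tendsto_sandwich)
    show "(\<lambda>k. D - 1 / real (Suc k)) \<longlonglongrightarrow> D"
      using tendsto_diff[OF tendsto_const LIMSEQ_inverse_real_of_nat, of D] by (simp add: inverse_eq_divide)
    show "\<forall>\<^sub>F k in sequentially. D - 1 / real (Suc k) \<le> \<Phi> (P k)"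
      using PD by (intro always_eventually allI less_imp_le)
    show "\<forall>\<^sub>F k in sequentially. \<Phi> (P k) \<le> D"
      by (intro always_eventually allI le_D PC)
  qed simp
  \<comment> \<open>The energy bound comes from the ray through \<open>P k\<close>: its values tend
    to \<open>c * (D + r / 2) - c\<^sup>2 * r / 2\<close>, which is at most \<open>D\<close>. At
    \<open>c = 1\<close> this says nothing, but for \<open>c < 1\<close> division by
    \<open>1 - c\<close> leaves the inequality, and \<open>c\<close> tends to 1 afterwards.\<close>
  have r_le: "c * (r / 2) \<le> D" if c: "0 < c" "c < 1" for c
  proof -
    have "c * (D + r / 2) - c\<^sup>2 * r / 2 \<le> D"
    proof (rule LIMSEQ_le_const2)
      show "(\<lambda>k. c * (\<Phi> (P k) + kgram K (P k) / 2) - c\<^sup>2 * kgram K (P k) / 2) \<longlonglongrightarrow> c * (D + r / 2) - c\<^sup>2 * r / 2"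
        by (intro tendsto_intros \<Phi>_lim r) auto
      have "c * (\<Phi> (P k) + kgram K (P k) / 2) - c\<^sup>2 * kgram K (P k) / 2 = \<Phi> (scal c (P k))" for k
        by (simp add: \<Phi>_def kgram_scal)
      then show "\<exists>N. \<forall>k\<ge>N. c * (\<Phi> (P k) + kgram K (P k) / 2) - c\<^sup>2 * kgram K (P k) / 2 \<le> D"
        using le_D[OF sc[OF less_imp_le[OF c(1)] PC]] by auto
    qed
    then have "(1 - c) * (c * (r / 2)) \<le> (1 - c) * D"
      by (simp add: algebra_simps power2_eq_square diff_divide_distrib)
    then show ?thesis
      using c by simp
  qed
  have "r / 2 \<le> D"
  proof (rule tendsto_upperbound)
    show "((\<lambda>c. c * (r / 2)) \<longlongrightarrow> r / 2) (at_left 1)"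
      by (rule tendsto_eq_intros refl | simp)+
    show "\<forall>\<^sub>F c in at_left 1. c * (r / 2) \<le> D"
      unfolding eventually_at_left_field using r_le by (intro exI[of _ 0]) (auto simp del: times_divide_eq_right)
  qed simp
  moreover have "rkhs_norm2 K f \<le> r"
    by (rule rkhs_norm2_le[OF f rkhs_approx_dominated[OF P r]])
  moreover have "leval \<gamma> qs \<le> leval f qs" if qs: "qs \<in> C" for qs
  proof -
    \<comment> \<open>First-order optimality: \<open>P k @ scal \<tau> qs\<close> stays in the cone,
      so its value is at most \<open>D\<close>. The inequality is divided by \<tau>, which then
      tends to 0.\<close>
    have *: "leval \<gamma> qs - leval f qs \<le> \<tau> * kgram K qs / 2" if \<tau>: "0 < \<tau>" for \<tau>
    proof -
      have "D + \<tau> * leval \<gamma> qs - \<tau> * leval f qs - \<tau>\<^sup>2 * kgram K qs / 2 \<le> D"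
      proof (rule LIMSEQ_le_const2)
        show "(\<lambda>k. \<Phi> (P k) + \<tau> * leval \<gamma> qs - \<tau> * kin K (P k) qs - \<tau>\<^sup>2 * kgram K qs / 2)
            \<longlonglongrightarrow> D + \<tau> * leval \<gamma> qs - \<tau> * leval f qs - \<tau>\<^sup>2 * kgram K qs / 2"
          by (intro tendsto_intros \<Phi>_lim rkhs_approx_kin P)
        have "\<Phi> (P k) + \<tau> * leval \<gamma> qs - \<tau> * kin K (P k) qs - \<tau>\<^sup>2 * kgram K qs / 2 = \<Phi> (P k @ scal \<tau> qs)" for k
          by (simp add: \<Phi>_def kgram_scal kgram_append add_divide_distrib)
        then show "\<exists>N. \<forall>k\<ge>N. \<Phi> (P k) + \<tau> * leval \<gamma> qs - \<tau> * kin K (P k) qs - \<tau>\<^sup>2 * kgram K qs / 2 \<le> D"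
          using le_D[OF app[OF PC sc[OF less_imp_le[OF \<tau>] qs]]] by auto
      qed
      then have "\<tau> * (leval \<gamma> qs - leval f qs) \<le> \<tau> * (\<tau> * kgram K qs / 2)"
        by (simp add: algebra_simps power2_eq_square)
      then show ?thesis
        using \<tau> by simp
    qed
    have "leval \<gamma> qs - leval f qs \<le> 0"
    proof (rule tendsto_lowerbound)
      show "((\<lambda>\<tau>. \<tau> * kgram K qs / 2) \<longlongrightarrow> 0) (at_right 0)"
        by (rule tendsto_eq_intros refl | simp)+
      show "\<forall>\<^sub>F \<tau> in at_right 0. leval \<gamma> qs - leval f qs \<le> \<tau> * kgram K qs / 2"
        unfolding eventually_at_right_field by (rule exI[of _ 1]) (auto simp: *[simplified])
    qed simp
    then show ?thesis
      by simp
  qed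
  ultimately show ?thesis
    using f D_le by (intro bexI[of _ f]) auto
qed

text \<open>Riesz representation, obtained from \<open>cone_maximizer\<close> for the cone of all
  lists. The maximizer lies above \<open>f\<close> on both \<open>[(1, u)]\<close> and
  \<open>[(- 1, u)]\<close>, hence agrees with it at \<open>u\<close>.\<close>

lemma dominated_rkhs:
  assumes "dominated f c"
  shows "f \<in> rkhs K" and "rkhs_norm2 K f \<le> c"
proof -
  have c: "0 \<le> c"
    using assms by (simp add: dominated_def)
  have "leval f ps - kgram K ps / 2 \<le> c / 2" for ps
  proof -
    have "0 \<le> (sqrt c - sqrt (kgram K ps))\<^sup>2"
      by simp
    then have "sqrt c * sqrt (kgram K ps) \<le> c / 2 + kgram K ps / 2"
      using c by (simp add: power2_diff kgram_nonneg)
    then show ?thesis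
      using dominated_abs[OF assms, of ps] by simp
  qed
  from cone_maximizer[of UNIV f, OF _ _ _ this]
  obtain g where g: "g \<in> rkhs K" "\<And>qs. leval f qs \<le> leval g qs"
    by auto
  have "f = g"
  proof
    show "f u = g u" for u
      using g(2)[of "[(1, u)]"] g(2)[of "[(- 1, u)]"] by simp
  qed
  then show "f \<in> rkhs K"
    using g by simp
  then show "rkhs_norm2 K f \<le> c"
    using assms by (rule rkhs_norm2_le)
qed

lemma rate_fn_le_iff: "rate_fn K f \<le> ereal x \<longleftrightarrow> (\<exists>c. dominated f c \<and> c \<le> 2 * x)"
proof
  assume "rate_fn K f \<le> ereal x"
  then have "f \<in> rkhs K" "rkhs_norm2 K f / 2 \<le> x"
    by (auto simp: rate_fn_def split: if_splits)
  then show "\<exists>c. dominated f c \<and> c \<le> 2 * x"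
    using rkhs_dominated by (intro exI[of _ "rkhs_norm2 K f"]) auto
next
  assume "\<exists>c. dominated f c \<and> c \<le> 2 * x"
  then obtain c where "dominated f c" "c \<le> 2 * x"
    by blast
  then show "rate_fn K f \<le> ereal x"
    using dominated_rkhs[of f c] by (auto simp: rate_fn_def)
qed

text \<open>Lets the lower bound work with one finite combination: the energy rises by at most
  \<open>e\<close>, and the error is uniform wherever \<open>K u u\<close> is bounded.\<close>

lemma rkhs_kfun_approx:
  assumes f: "dominated f c" and e: "0 < e"
  shows "\<exists>ps. kgram K ps \<le> c + e \<and> (\<forall>u. \<bar>f u - kfun K ps u\<bar> \<le> e * sqrt (K u u))"
proof -
  obtain P where P: "rkhs_approx K f P" "(\<lambda>k. kgram K (P k)) \<longlonglongrightarrow> rkhs_norm2 K f"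
    using rkhs_norm2_exists dominated_rkhs[OF f] by blast
  obtain N where N: "\<And>k qs. N \<le> k \<Longrightarrow> \<bar>leval f qs - kin K (P k) qs\<bar> \<le> e * sqrt (kgram K qs)"
    using rkhs_approx_kgram_kdiff_le[OF P(1) e] by blast
  have "\<forall>\<^sub>F k in sequentially. kgram K (P k) < c + e"
    using dominated_rkhs[OF f] e by (intro order_tendstoD(2)[OF P(2)]) auto
  then obtain k where k: "N \<le> k" "kgram K (P k) < c + e"
    using eventually_conj[OF _ eventually_ge_at_top[of N]] eventually_happens' sequentially_bot by blast
  have "\<bar>f u - kfun K (P k) u\<bar> \<le> e * sqrt (K u u)" for u
    using N[OF k(1), of "[(1, u)]"] by (simp add: kfun_eq_kin kgram_def)
  then show ?thesis
    using k by (intro exI[of _ "P k"]) auto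
qed

end

section \<open>Perturbing weak exceedances into strict ones\<close>

text \<open>The margin on the closed interval survives small uniform errors of the path. Membership
  in \<open>Sset\<close> alone does not give one: its slack may tend to 0 as \<open>s\<close> tends
  to 0.\<close>

definition strict_exceed :: "real \<Rightarrow> real \<Rightarrow> real \<Rightarrow> (real \<Rightarrow> real) \<Rightarrow> bool" where
  "strict_exceed b c1 c2 w \<longleftrightarrow>
     (\<exists>t>0. \<exists>\<eta>>0. \<forall>s\<in>{0..t}. b + c2 * t - c1 * s + \<eta> \<le> w (- s) - w (- t))"

text \<open>Stable under joint limits of the path and of \<open>t\<close>, hence the condition
  satisfied on the closure of \<open>Sset\<close> and by the maximizers that duality
  produces.\<close>

definition weak_exceed :: "real \<Rightarrow> real \<Rightarrow> real \<Rightarrow> (real \<Rightarrow> real) \<Rightarrow> bool" where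
  "weak_exceed b c1 c2 w \<longleftrightarrow> (\<exists>t\<ge>0. \<forall>s\<in>{0..t}. b + c2 * t - c1 * s \<le> w (- s) - w (- t))"

locale variance_function =
  fixes v :: "real \<Rightarrow> real"
  assumes v_cont: "continuous_on {0..} v"
    and v_nonneg: "\<And>t. 0 \<le> t \<Longrightarrow> 0 \<le> v t"
    and v_0 [simp]: "v 0 = 0"
    and v_growth: "\<exists>\<alpha><2. ((\<lambda>t. v t / t powr \<alpha>) \<longlongrightarrow> 0) at_top"
    and Gam_psd: "\<And>ps. 0 \<le> kgram (Gam v) ps"
begin

sublocale psd_kernel "Gam v"
  by standard (auto simp: Gam_def abs_minus_commute Gam_psd)

lemma Gam_diag: "Gam v u u = v \<bar>u\<bar>"
  by (simp add: Gam_def)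

lemma kgram_pair: "kgram (Gam v) [(1, x), (- 1, y)] = v \<bar>x - y\<bar>"
  by (simp add: kgram_def Gam_def abs_minus_commute[of y x] field_simps)

lemma continuous_v_abs: "continuous_on UNIV (\<lambda>x. v \<bar>x\<bar>)"
  by (rule continuous_on_compose2[OF v_cont]) (auto intro!: continuous_intros)

lemma v_quadratic_growth: "((\<lambda>t. v t / t\<^sup>2) \<longlongrightarrow> 0) at_top"
proof -
  obtain \<alpha> where \<alpha>: "\<alpha> < 2" "((\<lambda>t. v t / t powr \<alpha>) \<longlongrightarrow> 0) at_top"
    using v_growth by blast
  show ?thesis
  proof (rule tendsto_sandwich[OF _ _ tendsto_const \<alpha>(2)])
    show "\<forall>\<^sub>F t in at_top. 0 \<le> v t / t\<^sup>2"
      using eventually_ge_at_top[of 0] by eventually_elim (simp add: v_nonneg)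
    show "\<forall>\<^sub>F t in at_top. v t / t\<^sup>2 \<le> v t / t powr \<alpha>"
      using eventually_ge_at_top[of 1]
    proof eventually_elim
      case (elim t)
      have "t powr \<alpha> \<le> t powr 2"
        using elim \<alpha> by (intro powr_mono) auto
      then have "t powr \<alpha> \<le> t\<^sup>2"
        using elim by (simp add: powr_numeral)
      then show ?case
        using elim by (intro divide_left_mono) (auto simp: v_nonneg)
    qed
  qed
qed

lemma dominated_increment:
  assumes "dominated f c"
  shows "\<bar>f x - f y\<bar> \<le> sqrt c * sqrt (v \<bar>x - y\<bar>)"
  using dominated_abs[OF assms, of "[(1, x), (- 1, y)]"] by (simp only: kgram_pair) simp

lemma dominated_zero:
  assumes "dominated f c"
  shows "f 0 = 0"
  using dominated_abs[OF assms, of "[(1, 0)]"] by (simp add: kgram_def Gam_def)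

lemma dominated_continuous:
  assumes "dominated f c"
  shows "continuous_on UNIV f"
  unfolding continuous_on_def
proof
  fix x :: real
  have "((\<lambda>y. sqrt c * sqrt (v \<bar>y - x\<bar>)) \<longlongrightarrow> sqrt c * sqrt (v \<bar>x - x\<bar>)) (at x)"
  proof (intro tendsto_intros)
    have "continuous_on UNIV (\<lambda>y. v \<bar>y - x\<bar>)"
      by (rule continuous_on_compose2[OF continuous_v_abs]) (auto intro!: continuous_intros)
    then show "((\<lambda>y. v \<bar>y - x\<bar>) \<longlongrightarrow> v \<bar>x - x\<bar>) (at x)"
      unfolding continuous_on_def by blast
  qed
  then have "((\<lambda>y. f y - f x) \<longlongrightarrow> 0) (at x)"
    by (intro Lim_null_comparison[where f = "\<lambda>y. f y - f x" and g = "\<lambda>y. sqrt c * sqrt (v \<bar>y - x\<bar>)"])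
      (auto intro!: always_eventually dominated_increment[OF assms])
  then show "(f \<longlongrightarrow> f x) (at x within UNIV)"
    by (simp add: Lim_null[of f])
qed

lemma dominated_OmegaSet:
  assumes "dominated f c"
  shows "f \<in> OmegaSet"
proof -
  have bound: "\<bar>f t / (1 + \<bar>t\<bar>)\<bar> \<le> sqrt c * sqrt (v \<bar>t\<bar> / \<bar>t\<bar>\<^sup>2)" if "t \<noteq> 0" for t
  proof -
    have "0 \<le> c"
      using assms by (simp add: dominated_def)
    have "\<bar>f t / (1 + \<bar>t\<bar>)\<bar> \<le> \<bar>f t\<bar> / \<bar>t\<bar>"
      using that by (auto simp: abs_divide intro!: divide_left_mono)
    also have "\<dots> \<le> (sqrt c * sqrt (v \<bar>t\<bar>)) / \<bar>t\<bar>"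
      using dominated_increment[OF assms, of t 0] dominated_zero[OF assms]
      by (intro divide_right_mono) auto
    also have "\<dots> = sqrt c * sqrt (v \<bar>t\<bar> / \<bar>t\<bar>\<^sup>2)"
      by (simp add: real_sqrt_divide)
    finally show ?thesis .
  qed
  have lim: "((\<lambda>t. sqrt c * sqrt (v t / t\<^sup>2)) \<longlongrightarrow> 0) at_top"
    using tendsto_mult[OF tendsto_const tendsto_real_sqrt[OF v_quadratic_growth], of "sqrt c"] by simp
  have "((\<lambda>t. f t / (1 + \<bar>t\<bar>)) \<longlongrightarrow> 0) at_top"
  proof (rule Lim_null_comparison[OF _ lim])
    show "\<forall>\<^sub>F t in at_top. norm (f t / (1 + \<bar>t\<bar>)) \<le> sqrt c * sqrt (v t / t\<^sup>2)"
      using eventually_gt_at_top[of 0]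
    proof eventually_elim
      case (elim t)
      then show ?case
        using bound[of t] by simp
    qed
  qed
  moreover have "((\<lambda>t. f t / (1 + \<bar>t\<bar>)) \<longlongrightarrow> 0) at_bot"
    unfolding filterlim_at_bot_mirror
  proof (rule Lim_null_comparison[OF _ lim])
    show "\<forall>\<^sub>F t in at_top. norm (f (- t) / (1 + \<bar>- t\<bar>)) \<le> sqrt c * sqrt (v t / t\<^sup>2)"
      using eventually_gt_at_top[of 0]
    proof eventually_elim
      case (elim t)
      then show ?case
        using bound[of "- t"] by simp
    qed
  qed
  ultimately show ?thesis
    unfolding OmegaSet_def
    using dominated_continuous[OF assms] dominated_zero[OF assms] by simp
qed

section \<open>Time shifts and second differences of the kernel\<close>

lemma leval_shift:
  "\<exists>qs. kgram (Gam v) qs = kgram (Gam v) ps \<and> leval (\<lambda>u. f (u + a) - f a) ps = leval f qs"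
proof -
  define qs where "qs = concat (map (\<lambda>(m, s). [(m, s + a), (- m, a)]) ps)"
  have ev: "leval g qs = leval (\<lambda>u. g (u + a) - g a) ps" for g
    unfolding qs_def by (induction ps) (auto simp: algebra_simps)
  \<comment> \<open>Stationary increments: shifting time by \<open>a\<close> and recentring there
    leaves the kernel unchanged.\<close>
  have G: "Gam v (s + a) (u + a) - Gam v (s + a) a - (Gam v a (u + a) - Gam v a a) = Gam v s u" for s u
    by (simp add: Gam_def field_simps)
  have "kgram (Gam v) qs = leval (\<lambda>s. leval (Gam v (s + a)) qs - leval (Gam v a) qs) ps"
    unfolding kgram_eq_kin kin_def by (rule ev)
  also have "\<dots> = kgram (Gam v) ps"
    unfolding ev leval_diff[symmetric] G kgram_eq_kin kin_def ..
  finally show ?thesis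
    using ev[of f] by (intro exI[of _ qs]) simp
qed

lemma dominated_shift:
  assumes "dominated f c"
  shows "dominated (\<lambda>u. f (u + a) - f a) c"
  unfolding dominated_def
proof (intro conjI allI)
  show "0 \<le> c"
    using assms by (simp add: dominated_def)
  fix ps
  show "(leval (\<lambda>u. f (u + a) - f a) ps)\<^sup>2 \<le> c * kgram (Gam v) ps"
    using leval_shift[of ps f a] assms unfolding dominated_def by metis
qed

text \<open>Second difference around \<open>- t\<close> with step \<open>x\<close>. By
  \<open>hump_increment\<close> and \<open>hump_nonneg\<close> its kernel function has its minimum
  at \<open>- t\<close>.\<close>

definition hump :: "real \<Rightarrow> real \<Rightarrow> (real \<times> real) list" where
  "hump t x = [(- 2, - t), (1, - t + x), (1, - t - x)]"

lemma hump_increment: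
  "kfun (Gam v) (hump t x) (- s) - kfun (Gam v) (hump t x) (- t)
     = v \<bar>t - s\<bar> + v \<bar>x\<bar> - (v \<bar>t - s - x\<bar> + v \<bar>t - s + x\<bar>) / 2"
  by (simp add: kfun_def hump_def Gam_def field_simps abs_minus_commute)

text \<open>The increment of a hump is half the variance of the second-order increment
  \<open>A(w + x) - A(w) - A(x)\<close>, where \<open>w = t - s\<close>.\<close>

lemma hump_nonneg: "0 \<le> v \<bar>w\<bar> + v \<bar>x\<bar> - (v \<bar>w - x\<bar> + v \<bar>w + x\<bar>) / 2"
proof -
  have "kgram (Gam v) [(1, w + x), (- 1, w), (- 1, x)]
      = 2 * (v \<bar>w\<bar> + v \<bar>x\<bar> - (v \<bar>w - x\<bar> + v \<bar>w + x\<bar>) / 2)"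
    by (simp add: kgram_def Gam_def field_simps abs_minus_commute)
  then show ?thesis
    using Gam_psd[of "[(1, w + x), (- 1, w), (- 1, x)]"] by simp
qed

text \<open>If the increment vanished for every \<open>x\<close>, then \<open>v\<close> would obey
  the parallelogram law \<open>v(w + x) + v(w - x) = 2 v(w) + 2 v(x)\<close>, up to absolute values.
  Along multiples of \<open>w\<close> this forces \<open>v(k w) = k^2 v(w)\<close>, against the
  subquadratic growth of \<open>v\<close>.\<close>

lemma hump_positive:
  assumes w: "0 < w" and "v w \<noteq> 0"
  shows "\<exists>x. 0 < v \<bar>w\<bar> + v \<bar>x\<bar> - (v \<bar>w - x\<bar> + v \<bar>w + x\<bar>) / 2"
proof (rule ccontr)
  assume "\<not> ?thesis"
  then have eq: "v w + v \<bar>x\<bar> = (v \<bar>w - x\<bar> + v \<bar>w + x\<bar>) / 2" for x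
    using hump_nonneg[of w x] w by (auto simp: not_less dest!: spec[of _ x])
  have sq: "v (real k * w) = (real k)\<^sup>2 * v w \<and> v (real (Suc k) * w) = (real (Suc k))\<^sup>2 * v w" for k
  proof (induction k)
    case (Suc k)
    have "\<bar>w - real (Suc k) * w\<bar> = real k * w" "\<bar>w + real (Suc k) * w\<bar> = real (Suc (Suc k)) * w"
      using w abs_of_nonneg[of "real k * w"] abs_of_nonneg[of "real (Suc (Suc k)) * w"]
      by (simp_all add: algebra_simps)
    then have "v w + v (real (Suc k) * w) = (v (real k * w) + v (real (Suc (Suc k)) * w)) / 2"
      using eq[of "real (Suc k) * w"] w by (simp add: abs_mult)
    then have "v (real (Suc (Suc k)) * w) = 2 * v w + 2 * v (real (Suc k) * w) - v (real k * w)"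
      by (simp add: field_simps)
    also have "\<dots> = (real (Suc (Suc k)))\<^sup>2 * v w"
      unfolding conjunct1[OF Suc.IH] conjunct2[OF Suc.IH] by (simp add: power2_eq_square algebra_simps)
    finally show ?case
      using Suc.IH by blast
  qed simp
  have "filterlim (\<lambda>k. real k * w) at_top sequentially"
    using w by (intro filterlim_at_top_mult_tendsto_pos[OF tendsto_const] filterlim_real_sequentially)
      (auto simp: mult.commute)
  then have "(\<lambda>k. v (real k * w) / (real k * w)\<^sup>2) \<longlonglongrightarrow> 0"
    by (rule filterlim_compose[OF v_quadratic_growth])
  moreover have "\<forall>\<^sub>F k in sequentially. v (real k * w) / (real k * w)\<^sup>2 = v w / w\<^sup>2"
    using eventually_gt_at_top[of 0] by eventually_elim (use sq in \<open>simp add: power_mult_distrib\<close>)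
  ultimately have "(\<lambda>k::nat. v w / w\<^sup>2) \<longlonglongrightarrow> 0"
    by (simp cong: filterlim_cong)
  then show False
    using assms by (simp add: LIMSEQ_const_iff)
qed

lemma weak_imp_strict_exceed:
  assumes f: "dominated f c" and weak: "weak_exceed b c1 c2 f"
    and b: "0 < b" and c12: "c2 < c1" and c2: "0 < c2" and c': "c < c'"
  shows "\<exists>g d. dominated g d \<and> d < c' \<and> strict_exceed b c1 c2 g"
proof -
  have c: "0 \<le> c"
    using f by (simp add: dominated_def)
  obtain t where t: "0 \<le> t" and ft: "\<And>s. 0 \<le> s \<Longrightarrow> s \<le> t \<Longrightarrow> b + c2 * t - c1 * s \<le> f (- s) - f (- t)"
    using weak unfolding weak_exceed_def by auto
  have f0: "f 0 = 0"
    by (rule dominated_zero[OF f])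
  have fcont: "continuous_on UNIV f"
    by (rule dominated_continuous[OF f])
  have D: "b + c2 * t \<le> c1 * t"
    using ft[of t] t by simp
  have tpos: "0 < t"
    using D t b by (cases "t = 0") auto
  show ?thesis
  proof (cases "b + c2 * t = c1 * t")
    case True
    \<comment> \<open>Equality at \<open>s = t\<close> leaves no margin for any path, so the time
      itself must grow, to \<open>t + a\<close>. Shifting the path by \<open>a\<close> costs no
      energy and scaling by \<open>1 + e\<close> costs little.\<close>
    have "((\<lambda>e. (1 + e)\<^sup>2 * c) \<longlongrightarrow> c) (at_right 0)"
      by (rule tendsto_eq_intros refl | simp)+
    then have "\<forall>\<^sub>F e in at_right 0. (1 + e)\<^sup>2 * c < c'"
      using c' by (rule order_tendstoD)
    then obtain e0 where e0: "0 < e0" "\<And>e. 0 < e \<Longrightarrow> e < e0 \<Longrightarrow> (1 + e)\<^sup>2 * c < c'"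
      unfolding eventually_at_right_field by auto
    define e where "e = e0 / 2"
    have e: "0 < e" "(1 + e)\<^sup>2 * c < c'"
      using e0 by (auto simp: e_def)
    \<comment> \<open>For \<open>s < a\<close> the shifted path sees \<open>f\<close> at times in
      \<open>(0, a]\<close>, where only continuity at 0 helps. Scaling gains
      \<open>e * c1 * t\<close> there: \<rho> may spend one half, and
      \<open>a \<le> e * t / 2\<close> keeps the added demand \<open>c1 * a\<close> within the
      other.\<close>
    define \<rho> where "\<rho> = e * c1 * t / (2 * (1 + e))"
    have \<rho>: "0 < \<rho>" "(1 + e) * \<rho> = e * c1 * t / 2"
      using e tpos c12 c2 by (auto simp: \<rho>_def field_simps)
    have "(f \<longlongrightarrow> f 0) (at 0)"
      using fcont by (simp add: continuous_on_def)
    then have "\<forall>\<^sub>F u in at 0. - \<rho> < f u"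
      using \<rho> f0 by (intro order_tendstoD) auto
    then obtain a0 where a0: "0 < a0" "\<And>u. u \<noteq> 0 \<Longrightarrow> \<bar>u\<bar> < a0 \<Longrightarrow> - \<rho> < f u"
      unfolding eventually_at by (auto simp: dist_real_def)
    define a where "a = min (a0 / 2) (e * t / 2)"
    have a: "0 < a" "a < a0" "a \<le> e * t / 2"
      using a0(1) e tpos by (auto simp: a_def)
    have fa: "- \<rho> \<le> f u" if "0 \<le> u" "u \<le> a" for u
      using a0(2)[of u] that a \<rho> f0 by (cases "u = 0") auto
    define g where "g = (\<lambda>u. (1 + e) * (f (u + a) - f a))"
    have g: "dominated g ((1 + e)\<^sup>2 * c)"
      unfolding g_def by (intro dominated_cmult dominated_shift f)
    have "b + c2 * (t + a) - c1 * s + (c1 - c2) * a \<le> g (- s) - g (- (t + a))" if s: "0 \<le> s" "s \<le> t + a" for s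
    proof -
      have gs: "g (- s) - g (- (t + a)) = (1 + e) * (f (- (s - a)) - f (- t))"
        by (simp add: g_def algebra_simps)
      have lhs: "b + c2 * (t + a) - c1 * s + (c1 - c2) * a = c1 * (t + a - s)"
        using True by (simp add: algebra_simps)
      show ?thesis
      proof (cases "a \<le> s")
        case a_le: True
        have "c1 * (t + a - s) \<le> f (- (s - a)) - f (- t)"
          using ft[of "s - a"] s a_le True by (simp add: algebra_simps)
        also have "\<dots> \<le> (1 + e) * (f (- (s - a)) - f (- t))"
        proof -
          have "0 \<le> c1 * (t + a - s)"
            using s c12 c2 by simp
          with calculation have "0 \<le> f (- (s - a)) - f (- t)"
            by linarith
          then show ?thesis
            using e mult_right_mono[of 1 "1 + e" "f (- (s - a)) - f (- t)"] by simp
        qed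
        finally show ?thesis
          using gs lhs by simp
      next
        case False
        have "- \<rho> \<le> f (- (s - a))"
          using fa[of "- (s - a)"] s False by auto
        moreover have "c1 * t \<le> - f (- t)"
          using ft[of 0] t f0 True by simp
        ultimately have "(1 + e) * (c1 * t - \<rho>) \<le> (1 + e) * (f (- (s - a)) - f (- t))"
          using e by (intro mult_left_mono) auto
        moreover have "(1 + e) * (c1 * t - \<rho>) = c1 * t + e * c1 * t / 2"
          using \<rho> by (simp add: algebra_simps)
        moreover have "c1 * a \<le> c1 * (e * t / 2)"
          using a c12 c2 by (intro mult_left_mono) auto
        moreover have "0 \<le> c1 * s"
          using s c12 c2 by simp
        ultimately show ?thesis
          using gs lhs by (simp add: algebra_simps)
      qed
    qed
    moreover have "0 < (c1 - c2) * a" "0 < t + a"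
      using a c12 tpos by auto
    ultimately have "strict_exceed b c1 c2 g"
      unfolding strict_exceed_def by (intro exI[of _ "t + a"] conjI exI[of _ "(c1 - c2) * a"]) auto
    then show ?thesis
      using g e by blast
  next
    case False
    then have D: "b + c2 * t < c1 * t"
      using D by simp
    define G where "G s = f (- s) - f (- t) - (b + c2 * t - c1 * s)" for s
    have G: "0 \<le> G s" if "0 \<le> s" "s \<le> t" for s
      using ft[OF that] by (simp add: G_def)
    have Gcont: "continuous_on UNIV G"
      unfolding G_def by (intro continuous_intros continuous_on_compose2[OF fcont]) auto
    show ?thesis
    proof (cases "\<exists>s\<ge>0. s < t \<and> G s = 0 \<and> v (t - s) = 0")
      case True
      \<comment> \<open>Zero variance ties \<open>f (- s)\<close> to \<open>f (- t)\<close> for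
        every \<open>f\<close> of finite energy, so no perturbation helps at this \<open>s\<close>.
        Using \<open>s\<close> as the time instead lowers the demand by
        \<open>c2 * (t - s)\<close>.\<close>
      then obtain s where s: "0 \<le> s" "s < t" "G s = 0" "v (t - s) = 0"
        by blast
      have eq: "f (- s) = f (- t)"
        using dominated_increment[OF f, of "- s" "- t"] s by simp
      then have "c1 * s = b + c2 * t"
        using s by (simp add: G_def)
      then have "0 < s"
        using s b mult_pos_pos[OF c2 tpos] by (cases "s = 0") auto
      moreover have "b + c2 * s - c1 * s' + c2 * (t - s) \<le> f (- s') - f (- s)" if "0 \<le> s'" "s' \<le> s" for s'
        using ft[of s'] that s eq by (simp add: algebra_simps)
      moreover have "0 < c2 * (t - s)"
        using c2 s by simp
      ultimately have "strict_exceed b c1 c2 f"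
        unfolding strict_exceed_def by (intro exI[of _ s] conjI exI[of _ "c2 * (t - s)"]) auto
      then show ?thesis
        using f c' by blast
    next
      case False
      define H where "H x s = v \<bar>t - s\<bar> + v \<bar>x\<bar> - (v \<bar>t - s - x\<bar> + v \<bar>t - s + x\<bar>) / 2" for x s
      have Hnn: "0 \<le> H x s" for x s
        unfolding H_def by (rule hump_nonneg)
      have Hcont: "continuous_on UNIV (H x)" for x
        unfolding H_def by (intro continuous_intros continuous_on_compose2[OF continuous_v_abs]) auto
      \<comment> \<open>The constraint at \<open>s = t\<close> is slack in this case, and every
        other active \<open>s\<close> has \<open>v (t - s)\<close> nonzero, so some hump is positive
        there. Compactness then selects finitely many humps.\<close>
      have "\<exists>x. 0 < G s + H x s" if s: "s \<in> {0..t}" for s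
      proof (cases "G s = 0")
        case True
        moreover have "G t \<noteq> 0"
          using D by (simp add: G_def)
        ultimately have "s < t" "v (t - s) \<noteq> 0"
          using s False by (auto simp: less_le)
        then obtain x where "0 < H x s"
          using hump_positive[of "t - s"] by (auto simp: H_def)
        then show ?thesis
          using G[of s] s by (intro exI[of _ x]) (auto simp: add_nonneg_pos)
      next
        case False
        then show ?thesis
          using G[of s] s Hnn[of 0 s] by (intro exI[of _ 0]) (auto simp: add_pos_nonneg)
      qed
      then have cover: "{0..t} \<subseteq> (\<Union>x. {s. 0 < G s + H x s})"
        by blast
      have op: "open {s. 0 < G s + H x s}" for x
        by (intro open_Collect_less continuous_intros Gcont Hcont)
      obtain F where F: "finite F" "{0..t} \<subseteq> (\<Union>x\<in>F. {s. 0 < G s + H x s})"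
        by (rule compactE_image[OF compact_Icc[of 0 t] op cover])
      obtain xs where xs: "set xs = F"
        using finite_list[OF F(1)] by blast
      define ps where "ps = concat (map (hump t) xs)"
      define \<phi> where "\<phi> s = kfun (Gam v) ps (- s) - kfun (Gam v) ps (- t)" for s
      have ps: "\<phi> s = (\<Sum>x\<leftarrow>xs. H x s)" for s
      proof -
        have "kfun (Gam v) (concat (map (hump t) xs)) (- s) - kfun (Gam v) (concat (map (hump t) xs)) (- t)
            = (\<Sum>x\<leftarrow>xs. H x s)" for xs
        proof (induction xs)
          case (Cons x xs)
          then show ?case
            using hump_increment[of t x s] by (simp add: kfun_eq_leval H_def)
        qed (simp add: kfun_def)
        then show ?thesis
          by (simp add: ps_def \<phi>_def)
      qed
      have \<phi>H: "H x s \<le> \<phi> s" if "x \<in> F" for x s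
      proof -
        have "H x s \<in> set (map (\<lambda>x. H x s) xs)"
          using that xs by auto
        then show ?thesis
          unfolding ps using Hnn by (intro member_le_sum_list) auto
      qed
      have pos: "0 < G s + \<phi> s" if s: "s \<in> {0..t}" for s
      proof -
        obtain x where "x \<in> F" "0 < G s + H x s"
          using F(2) s by auto
        then show ?thesis
          using \<phi>H[of x s] by linarith
      qed
      have "continuous_on UNIV \<phi>"
        unfolding \<phi>_def
        by (intro continuous_intros continuous_on_compose2[OF dominated_continuous[OF dominated_kfun]]) auto
      then have "continuous_on {0..t} (\<lambda>s. G s + \<phi> s)"
        using Gcont by (intro continuous_intros) (auto intro: continuous_on_subset)
      then obtain s0 where s0: "s0 \<in> {0..t}" "\<And>s. s \<in> {0..t} \<Longrightarrow> G s0 + \<phi> s0 \<le> G s + \<phi> s"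
        using continuous_attains_inf[of "{0..t}" "\<lambda>s. G s + \<phi> s"] t by auto
      define \<kappa> where "\<kappa> = G s0 + \<phi> s0"
      have \<kappa>: "0 < \<kappa>"
        using pos[OF s0(1)] by (simp add: \<kappa>_def)
      define q where "q = kgram (Gam v) ps"
      have "((\<lambda>e. (sqrt c + sqrt (e\<^sup>2 * q))\<^sup>2) \<longlongrightarrow> c) (at_right 0)"
      proof -
        have "((\<lambda>e. (sqrt c + sqrt (e\<^sup>2 * q))\<^sup>2) \<longlongrightarrow> (sqrt c + sqrt (0\<^sup>2 * q))\<^sup>2) (at_right 0)"
          by (intro tendsto_intros)
        then show ?thesis
          using c by simp
      qed
      then have "\<forall>\<^sub>F e in at_right 0. (sqrt c + sqrt (e\<^sup>2 * q))\<^sup>2 < c'"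
        using c' by (rule order_tendstoD)
      then obtain e0 where e0: "0 < e0" "\<And>e. 0 < e \<Longrightarrow> e < e0 \<Longrightarrow> (sqrt c + sqrt (e\<^sup>2 * q))\<^sup>2 < c'"
        unfolding eventually_at_right_field by auto
      \<comment> \<open>The bound \<open>e \<le> 1\<close> keeps \<open>G s + e * \<phi> s\<close>
        above \<open>e * (G s + \<phi> s)\<close>; the bound by \<open>e0\<close> keeps the energy
        below \<open>c'\<close>.\<close>
      define e where "e = min 1 (e0 / 2)"
      have e: "0 < e" "e \<le> 1" "(sqrt c + sqrt (e\<^sup>2 * q))\<^sup>2 < c'"
        using e0 by (auto simp: e_def min_def)
      define g where "g = (\<lambda>u. f u + e * kfun (Gam v) ps u)"
      have g: "dominated g ((sqrt c + sqrt (e\<^sup>2 * q))\<^sup>2)"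
        unfolding g_def q_def by (intro dominated_add f dominated_cmult dominated_kfun)
      have "b + c2 * t - c1 * s + e * \<kappa> \<le> g (- s) - g (- t)" if s: "s \<in> {0..t}" for s
      proof -
        have "e * \<kappa> \<le> e * (G s + \<phi> s)"
          using e s0(2)[OF s] by (simp add: \<kappa>_def)
        also have "\<dots> \<le> G s + e * \<phi> s"
          using e G[of s] s mult_right_mono[of e 1 "G s"] by (simp add: distrib_left)
        also have "\<dots> = g (- s) - g (- t) - (b + c2 * t - c1 * s)"
          by (simp add: G_def \<phi>_def g_def algebra_simps)
        finally show ?thesis
          by simp
      qed
      then have "strict_exceed b c1 c2 g"
        unfolding strict_exceed_def using tpos e \<kappa> by (intro exI[of _ t] conjI exI[of _ "e * \<kappa>"]) auto
      then show ?thesis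
        using g e by blast
    qed
  qed
qed

end

section \<open>Linear functionals determine the law of a process\<close>

abbreviation product_borel :: "('i \<Rightarrow> real) measure" where
  "product_borel \<equiv> PiM UNIV (\<lambda>_. borel)"

lemma prob_space_integrable_bounded:
  fixes f :: "'a \<Rightarrow> real"
  assumes "prob_space M" "f \<in> borel_measurable M" "\<And>x. \<bar>f x\<bar> \<le> B"
  shows "integrable M f"
proof -
  interpret prob_space M by fact
  show ?thesis
    by (rule integrable_const_bound[of f B]) (use assms in auto)
qed

text \<open>Levy's uniqueness theorem is applied to the law of \<open>U\<close> under the probability density
  \<open>1 + (h - e) / 2\<close>, where \<open>e\<close> is the mean of \<open>h\<close>.\<close>

lemma weighted_law_unique:
  fixes U h :: "'a \<Rightarrow> real" and V k :: "'b \<Rightarrow> real"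
  assumes M: "prob_space M" and N: "prob_space N"
    and [measurable]: "U \<in> borel_measurable M" "h \<in> borel_measurable M"
      "V \<in> borel_measurable N" "k \<in> borel_measurable N"
    and h: "\<And>z. \<bar>h z\<bar> \<le> 1" and k: "\<And>z. \<bar>k z\<bar> \<le> 1"
    and law: "distr M borel U = distr N borel V"
    and trig: "\<And>t \<theta>. (\<integral>z. cos (t * U z + \<theta>) * h z \<partial>M) = (\<integral>z. cos (t * V z + \<theta>) * k z \<partial>N)"
    and B: "B \<in> sets borel"
  shows "(\<integral>z. indicator B (U z) * h z \<partial>M) = (\<integral>z. indicator B (V z) * k z \<partial>N)"
proof -
  define e where "e = (\<integral>z. h z \<partial>M)"
  have e_N: "e = (\<integral>z. k z \<partial>N)"
    using trig[of 0 0] by (simp add: e_def)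
  interpret M: prob_space M by fact
  interpret N: prob_space N by fact
  \<comment> \<open>Stated for an arbitrary space in order to be used for both \<open>M\<close> and
    \<open>N\<close>. The density is nonnegative because \<open>g\<close> and its mean
    \<open>e\<close> have absolute value at most 1.\<close>
  have weight: "real_distribution (distr (density L (\<lambda>z. ennreal (1 + (g z - e) / 2))) borel W) \<and>
      (\<forall>\<phi>\<in>borel_measurable borel. (\<forall>x::real. \<bar>\<phi> x\<bar> \<le> 1) \<longrightarrow>
        (\<integral>x. \<phi> x \<partial>distr (density L (\<lambda>z. ennreal (1 + (g z - e) / 2))) borel W)
          = (1 - e / 2) * (\<integral>x. \<phi> x \<partial>distr L borel W) + (\<integral>z. \<phi> (W z) * g z \<partial>L) / 2)"
    if L: "prob_space L" and [measurable]: "W \<in> borel_measurable L" "g \<in> borel_measurable L"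
      and g: "\<And>z. \<bar>g z\<bar> \<le> 1" and e: "e = (\<integral>z. g z \<partial>L)"
    for L :: "'c measure" and W g :: "'c \<Rightarrow> real"
  proof -
    interpret L: prob_space L by fact
    have gi: "integrable L g"
      by (rule prob_space_integrable_bounded[OF L, where B = 1]) (simp_all add: g)
    have "\<bar>e\<bar> \<le> 1"
    proof -
      have "\<bar>e\<bar> \<le> (\<integral>z. \<bar>g z\<bar> \<partial>L)"
        unfolding e by (rule integral_abs_bound)
      also have "\<dots> \<le> (\<integral>z. 1 \<partial>L)"
        using gi g by (intro integral_mono) auto
      finally show ?thesis
        by (simp add: L.prob_space)
    qed
    then have p: "0 \<le> 1 + (g z - e) / 2" for z
      using g[of z] by (auto simp: abs_le_iff field_simps)
    define D where "D = density L (\<lambda>z. ennreal (1 + (g z - e) / 2))"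
    have "emeasure D (space D) = (\<integral>\<^sup>+z. ennreal (1 + (g z - e) / 2) \<partial>L)"
      unfolding D_def by (subst emeasure_density) (auto intro!: nn_integral_cong)
    also have "\<dots> = ennreal (\<integral>z. 1 + (g z - e) / 2 \<partial>L)"
      using gi p by (intro nn_integral_eq_integral) auto
    also have "(\<integral>z. 1 + (g z - e) / 2 \<partial>L) = 1"
      using gi by (simp add: e L.prob_space)
    finally have D: "prob_space D"
      by (intro prob_spaceI) simp
    have "(\<integral>x. \<phi> x \<partial>distr D borel W)
          = (1 - e / 2) * (\<integral>x. \<phi> x \<partial>distr L borel W) + (\<integral>z. \<phi> (W z) * g z \<partial>L) / 2"
      if [measurable]: "\<phi> \<in> borel_measurable borel" and \<phi>: "\<And>x::real. \<bar>\<phi> x\<bar> \<le> 1" for \<phi>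
    proof -
      have i1: "integrable L (\<lambda>z. \<phi> (W z))"
        by (rule prob_space_integrable_bounded[OF L, where B = 1]) (simp_all add: \<phi>)
      have i2: "integrable L (\<lambda>z. \<phi> (W z) * g z)"
      proof (rule prob_space_integrable_bounded[OF L, where B = 1])
        show "\<bar>\<phi> (W z) * g z\<bar> \<le> 1" for z
          unfolding abs_mult using \<phi>[of "W z"] g[of z] by (intro mult_le_one) auto
      qed measurable
      have "(\<integral>x. \<phi> x \<partial>distr D borel W) = (\<integral>z. \<phi> (W z) \<partial>D)"
        by (rule integral_distr) (auto simp: D_def)
      also have "\<dots> = (\<integral>z. (1 + (g z - e) / 2) * \<phi> (W z) \<partial>L)"
        unfolding D_def using p by (subst integral_real_density) auto
      also have "\<dots> = (\<integral>z. (1 - e / 2) * \<phi> (W z) + \<phi> (W z) * g z / 2 \<partial>L)"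
        by (intro Bochner_Integration.integral_cong) (auto simp: field_simps)
      also have "\<dots> = (1 - e / 2) * (\<integral>z. \<phi> (W z) \<partial>L) + (\<integral>z. \<phi> (W z) * g z \<partial>L) / 2"
        using i1 i2 by simp
      also have "(\<integral>z. \<phi> (W z) \<partial>L) = (\<integral>x. \<phi> x \<partial>distr L borel W)"
        by (rule integral_distr[symmetric]) auto
      finally show ?thesis .
    qed
    moreover have "real_distribution (distr D borel W)"
      using D by (intro prob_space.real_distribution_distr) (auto simp: D_def)
    ultimately show ?thesis
      unfolding D_def by blast
  qed
  define \<nu> where "\<nu> = distr (density M (\<lambda>z. ennreal (1 + (h z - e) / 2))) borel U"
  define \<mu> where "\<mu> = distr (density N (\<lambda>z. ennreal (1 + (k z - e) / 2))) borel V"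
  have \<nu>: "real_distribution \<nu>" and \<mu>: "real_distribution \<mu>"
    using weight[OF M _ _ h e_def, of U] weight[OF N _ _ k e_N, of V] by (auto simp: \<nu>_def \<mu>_def)
  have \<nu>i: "(\<integral>x. \<phi> x \<partial>\<nu>) = (1 - e / 2) * (\<integral>x. \<phi> x \<partial>distr M borel U) + (\<integral>z. \<phi> (U z) * h z \<partial>M) / 2"
    and \<mu>i: "(\<integral>x. \<phi> x \<partial>\<mu>) = (1 - e / 2) * (\<integral>x. \<phi> x \<partial>distr M borel U) + (\<integral>z. \<phi> (V z) * k z \<partial>N) / 2"
    if "\<phi> \<in> borel_measurable borel" "\<And>x::real. \<bar>\<phi> x\<bar> \<le> 1" for \<phi>
    using weight[OF M _ _ h e_def, of U] weight[OF N _ _ k e_N, of V] that law by (auto simp: \<nu>_def \<mu>_def)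
  interpret \<nu>: real_distribution \<nu> by fact
  interpret \<mu>: real_distribution \<mu> by fact
  \<comment> \<open>The phases 0 and \<open>- pi / 2\<close> in \<open>trig\<close> yield the real
    and imaginary parts of the characteristic functions.\<close>
  have cs: "(\<integral>x. cos (t * x) \<partial>\<nu>) = (\<integral>x. cos (t * x) \<partial>\<mu>)" for t
    using \<nu>i[of "\<lambda>x. cos (t * x)"] \<mu>i[of "\<lambda>x. cos (t * x)"] trig[of t 0] by simp
  have sn: "(\<integral>x. sin (t * x) \<partial>\<nu>) = (\<integral>x. sin (t * x) \<partial>\<mu>)" for t
  proof -
    have "sin x = cos (x + - pi / 2)" for x :: real
      by (simp add: cos_diff)
    then have "(\<integral>z. sin (t * U z) * h z \<partial>M) = (\<integral>z. sin (t * V z) * k z \<partial>N)"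
      using trig[of t "- pi / 2"] by simp
    then show ?thesis
      using \<nu>i[of "\<lambda>x. sin (t * x)"] \<mu>i[of "\<lambda>x. sin (t * x)"] by simp
  qed
  have "char \<nu> = char \<mu>"
  proof
    fix t
    have iexp: "Re (iexp x) = cos x" "Im (iexp x) = sin x" for x
      by (simp_all add: Re_exp Im_exp)
    have int: "integrable \<nu> (\<lambda>x. iexp (t * x))" "integrable \<mu> (\<lambda>x. iexp (t * x))"
      by (intro \<nu>.integrable_iexp \<mu>.integrable_iexp; simp)+
    show "char \<nu> t = char \<mu> t"
    proof (rule complex_eqI)
      show "Re (char \<nu> t) = Re (char \<mu> t)"
        unfolding char_def integral_Re[OF int(1), symmetric] integral_Re[OF int(2), symmetric] iexp by (rule cs)
      show "Im (char \<nu> t) = Im (char \<mu> t)"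
        unfolding char_def integral_Im[OF int(1), symmetric] integral_Im[OF int(2), symmetric] iexp by (rule sn)
    qed
  qed
  then have "\<nu> = \<mu>"
    by (rule Levy_uniqueness[OF \<nu> \<mu>])
  then show ?thesis
    using \<nu>i[of "indicator B"] \<mu>i[of "indicator B"] B by (simp add: indicator_def)
qed

text \<open>Indicators are inserted one coordinate at a time. The cosine factor must keep an
  arbitrary list and phase throughout the induction, because the product-to-sum formula moves the
  new coordinate \<open>j\<close> into the list. The empty list with phase 0 finally gives
  probabilities of boxes.\<close>

lemma linear_laws_determine_trig:
  fixes X :: "'i \<Rightarrow> 'a \<Rightarrow> real" and Y :: "'i \<Rightarrow> 'b \<Rightarrow> real"
  assumes M: "prob_space M" and N: "prob_space N"
    and X [measurable]: "\<And>i. X i \<in> borel_measurable M" and Y [measurable]: "\<And>i. Y i \<in> borel_measurable N"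
    and law: "\<And>ps. distr M borel (\<lambda>z. leval (\<lambda>i. X i z) ps) = distr N borel (\<lambda>z. leval (\<lambda>i. Y i z) ps)"
    and "finite J" "\<And>i. i \<in> J \<Longrightarrow> B i \<in> sets borel"
  shows "(\<integral>z. (\<Prod>i\<in>J. indicator (B i) (X i z)) * cos (leval (\<lambda>i. X i z) ps + \<theta>) \<partial>M)
       = (\<integral>z. (\<Prod>i\<in>J. indicator (B i) (Y i z)) * cos (leval (\<lambda>i. Y i z) ps + \<theta>) \<partial>N)"
  using assms(6-)
proof (induction J arbitrary: ps \<theta> rule: finite_induct)
  case empty
  have "(\<integral>z. cos (leval (\<lambda>i. X i z) ps + \<theta>) \<partial>M) = (\<integral>x. cos (x + \<theta>) \<partial>distr M borel (\<lambda>z. leval (\<lambda>i. X i z) ps))"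
    by (rule integral_distr[symmetric]) auto
  also have "\<dots> = (\<integral>x. cos (x + \<theta>) \<partial>distr N borel (\<lambda>z. leval (\<lambda>i. Y i z) ps))"
    by (simp add: law)
  also have "\<dots> = (\<integral>z. cos (leval (\<lambda>i. Y i z) ps + \<theta>) \<partial>N)"
    by (rule integral_distr) auto
  finally show ?case
    by simp
next
  case (insert j J)
  have [measurable]: "B i \<in> sets borel" if "i \<in> J" for i
    using insert.prems that by simp
  define g where "g = (\<lambda>z. \<Prod>i\<in>J. indicator (B i) (X i z) :: real)"
  define k where "k = (\<lambda>z. \<Prod>i\<in>J. indicator (B i) (Y i z) :: real)"
  have [measurable]: "g \<in> borel_measurable M" "k \<in> borel_measurable N"
    unfolding g_def k_def by measurable
  have gk: "\<bar>g z\<bar> \<le> 1" "\<bar>k z'\<bar> \<le> 1" for z z'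
    unfolding g_def k_def by (auto simp: abs_prod indicator_def intro!: prod_le_1)
  have gc: "\<bar>g z * cos x\<bar> \<le> 1" "\<bar>k z' * cos x\<bar> \<le> 1" for z z' x
    unfolding abs_mult using gk(1)[of z] gk(2)[of z'] by (auto intro!: mult_le_one)
  have IH: "(\<integral>z. g z * cos (leval (\<lambda>i. X i z) ps + \<theta>) \<partial>M) = (\<integral>z. k z * cos (leval (\<lambda>i. Y i z) ps + \<theta>) \<partial>N)" for ps \<theta>
    unfolding g_def k_def using insert.IH insert.prems by simp
  have iM: "integrable M (\<lambda>z. g z * cos (leval (\<lambda>i. X i z) ps + \<theta>))" for ps \<theta>
    by (rule prob_space_integrable_bounded[OF M, where B = 1]) (simp_all only: gc, measurable)
  have iN: "integrable N (\<lambda>z. k z * cos (leval (\<lambda>i. Y i z) ps + \<theta>))" for ps \<theta>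
    by (rule prob_space_integrable_bounded[OF N, where B = 1]) (simp_all only: gc, measurable)
  have split: "cos (t * x + \<theta>') * (y * cos (w + \<theta>))
      = (y * cos (t * x + w + (\<theta>' + \<theta>)) + y * cos (t * x + - 1 * w + (\<theta>' - \<theta>))) / 2" for t x y w \<theta>' :: real
  proof -
    have "cos (t * x + \<theta>') * cos (w + \<theta>) = (cos (t * x + \<theta>' - (w + \<theta>)) + cos (t * x + \<theta>' + (w + \<theta>))) / 2"
      by (rule cos_times_cos)
    then show ?thesis
      by (simp add: algebra_simps add_divide_distrib)
  qed
  have trig: "(\<integral>z. cos (t * X j z + \<theta>') * (g z * cos (leval (\<lambda>i. X i z) ps + \<theta>)) \<partial>M)
      = (\<integral>z. cos (t * Y j z + \<theta>') * (k z * cos (leval (\<lambda>i. Y i z) ps + \<theta>)) \<partial>N)" for t \<theta>'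
    unfolding split
    using IH[of "(t, j) # ps" "\<theta>' + \<theta>"] IH[of "(t, j) # scal (- 1) ps" "\<theta>' - \<theta>"]
      iM[of "(t, j) # ps" "\<theta>' + \<theta>"] iM[of "(t, j) # scal (- 1) ps" "\<theta>' - \<theta>"]
      iN[of "(t, j) # ps" "\<theta>' + \<theta>"] iN[of "(t, j) # scal (- 1) ps" "\<theta>' - \<theta>"]
    by simp
  have "distr M borel (X j) = distr N borel (Y j)"
    using law[of "[(1, j)]"] by simp
  then have "(\<integral>z. indicator (B j) (X j z) * (g z * cos (leval (\<lambda>i. X i z) ps + \<theta>)) \<partial>M)
      = (\<integral>z. indicator (B j) (Y j z) * (k z * cos (leval (\<lambda>i. Y i z) ps + \<theta>)) \<partial>N)"
    using insert.prems by (intro weighted_law_unique[OF M N] trig gc) auto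
  then show ?case
    using insert.hyps by (simp add: g_def k_def mult.assoc)
qed

text \<open>Cramer-Wold for an arbitrary index set: boxes over finite sets of indices determine a
  finite measure on the product.\<close>

theorem linear_laws_determine_law:
  fixes X :: "'i \<Rightarrow> 'a \<Rightarrow> real" and Y :: "'i \<Rightarrow> 'b \<Rightarrow> real"
  assumes M: "prob_space M" and N: "prob_space N"
    and X [measurable]: "\<And>i. X i \<in> borel_measurable M" and Y [measurable]: "\<And>i. Y i \<in> borel_measurable N"
    and law: "\<And>ps. distr M borel (\<lambda>z. leval (\<lambda>i. X i z) ps) = distr N borel (\<lambda>z. leval (\<lambda>i. Y i z) ps)"
  shows "distr M product_borel (\<lambda>z i. X i z) = distr N product_borel (\<lambda>z i. Y i z)"
proof (rule measure_eqI_PiM_infinite[where I = UNIV and M = "\<lambda>_. borel"])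
  have Xm [measurable]: "(\<lambda>z i. X i z) \<in> measurable M product_borel"
    by (rule measurable_PiM_single') auto
  have Ym [measurable]: "(\<lambda>z i. Y i z) \<in> measurable N product_borel"
    by (rule measurable_PiM_single') auto
  show "finite_measure (distr M product_borel (\<lambda>z i. X i z))"
    using prob_space.prob_space_distr[OF M Xm] by (simp add: prob_space_def)
  fix A :: "'i \<Rightarrow> real set" and J :: "'i set"
  assume J: "finite J" and A: "\<And>i. i \<in> J \<Longrightarrow> A i \<in> sets borel"
  define E where "E = prod_emb UNIV (\<lambda>_. borel :: real measure) J (Pi\<^sub>E J A)"
  have E: "E \<in> sets product_borel"
    unfolding E_def using J A by (intro sets_PiM_I) auto
  have box: "emeasure (distr L product_borel (\<lambda>z i. Z i z)) E = ennreal (\<integral>z. (\<Prod>i\<in>J. indicator (A i) (Z i z) :: real) \<partial>L)"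
    if L: "prob_space L" and Z [measurable]: "\<And>i. Z i \<in> borel_measurable L"
      "(\<lambda>z i. Z i z) \<in> measurable L product_borel"
    for L :: "'c measure" and Z :: "'i \<Rightarrow> 'c \<Rightarrow> real"
  proof -
    interpret L: prob_space L by fact
    have "emeasure (distr L product_borel (\<lambda>z i. Z i z)) E = emeasure L ((\<lambda>z i. Z i z) -` E \<inter> space L)"
      by (rule emeasure_distr[OF Z(2) E])
    also have "\<dots> = ennreal (\<integral>z. indicator ((\<lambda>z i. Z i z) -` E \<inter> space L) z \<partial>L)"
      using measurable_sets[OF Z(2) E] by (simp add: L.emeasure_eq_measure)
    also have "(\<integral>z. indicator ((\<lambda>z i. Z i z) -` E \<inter> space L) z \<partial>L) = (\<integral>z. (\<Prod>i\<in>J. indicator (A i) (Z i z) :: real) \<partial>L)"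
    proof (rule Bochner_Integration.integral_cong[OF refl])
      show "indicator ((\<lambda>z i. Z i z) -` E \<inter> space L) z = (\<Prod>i\<in>J. indicator (A i) (Z i z) :: real)"
        if z: "z \<in> space L" for z
      proof -
        have E_iff: "(\<lambda>i. Z i z) \<in> E \<longleftrightarrow> (\<forall>i\<in>J. Z i z \<in> A i)"
          by (auto simp: E_def prod_emb_def PiE_iff space_PiM)
        show ?thesis
          using J z by (cases "\<forall>i\<in>J. Z i z \<in> A i") (auto simp: E_iff indicator_def prod_zero_iff)
      qed
    qed
    finally show ?thesis .
  qed
  show "emeasure (distr M product_borel (\<lambda>z i. X i z)) (prod_emb UNIV (\<lambda>_. borel) J (Pi\<^sub>E J A))
      = emeasure (distr N product_borel (\<lambda>z i. Y i z)) (prod_emb UNIV (\<lambda>_. borel) J (Pi\<^sub>E J A))"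
    unfolding E_def[symmetric] box[OF M X Xm] box[OF N Y Ym]
    using linear_laws_determine_trig[OF M N X Y law J, of A "[]" 0] A by simp
qed simp_all

section \<open>Gaussian laws\<close>

text \<open>Scaling a standard normal variable also covers variance 0, so moments and characteristic
  functions can be computed without a case distinction.\<close>

lemma centered_normal_law_eq_distr:
  assumes "0 \<le> s"
  shows "centered_normal_law s = distr std_normal_distribution borel (\<lambda>x. sqrt s * x)"
proof (cases "s = 0")
  case True
  interpret std: prob_space std_normal_distribution
    by (rule prob_space_normal_density) simp
  show ?thesis
    using True by (simp add: centered_normal_law_def)
next
  case False
  then have s: "0 < s"
    using assms by simp
  interpret std: prob_space std_normal_distribution
    by (rule prob_space_normal_density) simp
  have "distributed std_normal_distribution lborel (\<lambda>x. x) (\<lambda>x. ennreal (std_normal_density x))"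
    by (auto simp: distributed_def distr_id2)
  then have "distributed std_normal_distribution lborel (\<lambda>x. 0 + sqrt s * x) (\<lambda>x. ennreal (normal_density (0 + sqrt s * 0) (\<bar>sqrt s\<bar> * 1) x))"
    using s by (intro std.normal_density_affine) auto
  then have "distr std_normal_distribution lborel (\<lambda>x. sqrt s * x) = density lborel (\<lambda>x. ennreal (normal_density 0 (sqrt s) x))"
    using s by (simp add: distributed_def)
  moreover have "distr std_normal_distribution borel (\<lambda>x. sqrt s * x) = distr std_normal_distribution lborel (\<lambda>x. sqrt s * x)"
    by (rule distr_cong) simp_all
  ultimately show ?thesis
    using False by (simp add: centered_normal_law_def)
qed

lemma real_distribution_centered_normal_law:
  assumes "0 \<le> s"
  shows "real_distribution (centered_normal_law s)"
  unfolding centered_normal_law_eq_distr[OF assms]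
  by (intro prob_space.real_distribution_distr prob_space_normal_density) simp_all

lemma char_centered_normal_law:
  assumes "0 \<le> s"
  shows "char (centered_normal_law s) t = complex_of_real (exp (- (s * t\<^sup>2) / 2))"
proof -
  have "char (centered_normal_law s) t = char std_normal_distribution (t * sqrt s)"
    unfolding centered_normal_law_eq_distr[OF assms] char_def
    by (subst integral_distr) (simp_all add: mult.assoc)
  then show ?thesis
    using assms by (simp add: char_std_normal_distribution power_mult_distrib mult.commute)
qed

lemma centered_normal_law_moment2:
  assumes "0 \<le> s"
  shows "integrable (centered_normal_law s) (\<lambda>x. x\<^sup>2)" "(\<integral>x. x\<^sup>2 \<partial>centered_normal_law s) = s"
proof -
  have std: "integrable std_normal_distribution (\<lambda>x::real. x\<^sup>2)" "(\<integral>x. x\<^sup>2 \<partial>std_normal_distribution) = 1"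
    using integrable_std_normal_distribution_moment[of 2] std_normal_distribution_even_moments(1)[of 1]
    by simp_all
  show "integrable (centered_normal_law s) (\<lambda>x. x\<^sup>2)"
    unfolding centered_normal_law_eq_distr[OF assms]
    by (subst integrable_distr_eq) (use std in \<open>auto simp: power_mult_distrib\<close>)
  show "(\<integral>x. x\<^sup>2 \<partial>centered_normal_law s) = s"
    unfolding centered_normal_law_eq_distr[OF assms]
    by (subst integral_distr) (use std assms in \<open>auto simp: power_mult_distrib\<close>)
qed

text \<open>Chernoff's bound with exponential parameter 1; other parameters arise by scaling the
  variable. The factor \<open>exp (x - a)\<close> bounds the indicator and tilts the density to mean
  \<open>s\<close>.\<close>

lemma centered_normal_law_upper_tail:
  assumes "0 \<le> s"
  shows "measure (centered_normal_law s) {a..} \<le> exp (s / 2 - a)"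
proof (cases "s = 0")
  case True
  then show ?thesis
    by (auto simp: centered_normal_law_def measure_return indicator_def)
next
  case False
  then have s: "0 < s"
    using assms by simp
  interpret real_distribution "centered_normal_law s"
    by (rule real_distribution_centered_normal_law[OF assms])
  have eq: "exp (x - a) * normal_density 0 (sqrt s) x = exp (s / 2 - a) * normal_density s (sqrt s) x" for x
  proof -
    have "x - a + - (x\<^sup>2) / (2 * s) = s / 2 - a + - ((x - s)\<^sup>2) / (2 * s)"
      using s by (simp add: field_simps power2_eq_square)
    then have "exp (x - a) * exp (- (x\<^sup>2) / (2 * s)) = exp (s / 2 - a) * exp (- ((x - s)\<^sup>2) / (2 * s))"
      by (simp only: exp_add[symmetric])
    then show ?thesis
      using s by (simp add: normal_density_def)
  qed
  have "emeasure (centered_normal_law s) {a..} = (\<integral>\<^sup>+x. ennreal (normal_density 0 (sqrt s) x) * indicator {a..} x \<partial>lborel)"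
    using False by (simp add: centered_normal_law_def emeasure_density)
  also have "\<dots> \<le> (\<integral>\<^sup>+x. ennreal (exp (s / 2 - a)) * ennreal (normal_density s (sqrt s) x) \<partial>lborel)"
  proof (intro nn_integral_mono)
    fix x
    have "normal_density 0 (sqrt s) x * indicator {a..} x \<le> exp (x - a) * normal_density 0 (sqrt s) x"
      using mult_right_mono[of 1 "exp (x - a)" "normal_density 0 (sqrt s) x"] by (auto simp: indicator_def)
    then have "ennreal (normal_density 0 (sqrt s) x * indicator {a..} x) \<le> ennreal (exp (s / 2 - a) * normal_density s (sqrt s) x)"
      unfolding eq by (rule ennreal_leI)
    then show "ennreal (normal_density 0 (sqrt s) x) * indicator {a..} x \<le> ennreal (exp (s / 2 - a)) * ennreal (normal_density s (sqrt s) x)"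
      by (simp add: ennreal_mult ennreal_indicator)
  qed
  also have "\<dots> = ennreal (exp (s / 2 - a)) * (\<integral>\<^sup>+x. ennreal (normal_density s (sqrt s) x) \<partial>lborel)"
    by (rule nn_integral_cmult) simp
  also have "(\<integral>\<^sup>+x. ennreal (normal_density s (sqrt s) x) \<partial>lborel) = 1"
    using s by (subst nn_integral_eq_integral) auto
  finally show ?thesis
    by (simp add: emeasure_eq_measure)
qed

text \<open>On an interval to the right of 0 the density is smallest at the right endpoint.\<close>

lemma centered_normal_law_Icc_ge:
  assumes s: "0 < s" and ab: "0 \<le> a" "a \<le> b"
  shows "(b - a) * (exp (- (b\<^sup>2) / (2 * s)) / sqrt (2 * pi * s)) \<le> measure (centered_normal_law s) {a..b}"
proof -
  interpret real_distribution "centered_normal_law s"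
    using s by (intro real_distribution_centered_normal_law) simp
  define d where "d = exp (- (b\<^sup>2) / (2 * s)) / sqrt (2 * pi * s)"
  have d: "0 \<le> d"
    using s by (simp add: d_def)
  have "ennreal ((b - a) * d) = (\<integral>\<^sup>+x. ennreal d * indicator {a..b} x \<partial>lborel)"
    using ab d by (simp add: nn_integral_cmult_indicator ennreal_mult'' mult.commute)
  also have "\<dots> \<le> (\<integral>\<^sup>+x. ennreal (normal_density 0 (sqrt s) x) * indicator {a..b} x \<partial>lborel)"
  proof (intro nn_integral_mono)
    fix x
    have "d \<le> normal_density 0 (sqrt s) x" if "a \<le> x" "x \<le> b"
    proof -
      have "x\<^sup>2 \<le> b\<^sup>2"
        using that ab by (intro power_mono) auto
      then have "exp (- (b\<^sup>2) / (2 * s)) \<le> exp (- (x\<^sup>2) / (2 * s))"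
        using s by (simp add: divide_right_mono)
      then show ?thesis
        using s by (simp add: d_def normal_density_def divide_right_mono)
    qed
    then show "ennreal d * indicator {a..b} x \<le> ennreal (normal_density 0 (sqrt s) x) * indicator {a..b} x"
      by (auto simp: indicator_def intro!: ennreal_leI)
  qed
  also have "\<dots> = emeasure (centered_normal_law s) {a..b}"
    using s by (simp add: centered_normal_law_def emeasure_density)
  finally have "ennreal ((b - a) * d) \<le> ennreal (measure (centered_normal_law s) {a..b})"
    by (simp add: emeasure_eq_measure)
  then show ?thesis
    by (simp add: d_def)
qed

lemma (in prob_space) centered_normal_law_cmult:
  assumes "random_variable borel U" "distr M borel U = centered_normal_law s" "0 \<le> s"
  shows "distr M borel (\<lambda>z. c * U z) = centered_normal_law (c\<^sup>2 * s)"
proof (rule Levy_uniqueness)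
  have [measurable]: "U \<in> borel_measurable M"
    using assms by simp
  show "real_distribution (distr M borel (\<lambda>z. c * U z))"
    by (intro real_distribution_distr) simp
  show "real_distribution (centered_normal_law (c\<^sup>2 * s))"
    using assms by (intro real_distribution_centered_normal_law) simp
  show "char (distr M borel (\<lambda>z. c * U z)) = char (centered_normal_law (c\<^sup>2 * s))"
  proof
    fix t
    have "char (distr M borel (\<lambda>z. c * U z)) t = char (distr M borel U) (t * c)"
      unfolding char_def by (subst (1 2) integral_distr) (simp_all add: mult.assoc)
    then show "char (distr M borel (\<lambda>z. c * U z)) t = char (centered_normal_law (c\<^sup>2 * s)) t"
      using assms by (simp add: char_centered_normal_law power_mult_distrib mult_ac)
  qed
qed

lemma (in prob_space) centered_normal_law_add:
  assumes ind: "indep_var borel U borel V"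
    and "distr M borel U = centered_normal_law s" "0 \<le> s"
    and "distr M borel V = centered_normal_law r" "0 \<le> r"
  shows "distr M borel (\<lambda>z. U z + V z) = centered_normal_law (s + r)"
proof (rule Levy_uniqueness)
  have [measurable]: "U \<in> borel_measurable M" "V \<in> borel_measurable M"
    using indep_var_rv1[OF ind] indep_var_rv2[OF ind] by simp_all
  show "real_distribution (distr M borel (\<lambda>z. U z + V z))"
    by (intro real_distribution_distr) simp
  show "real_distribution (centered_normal_law (s + r))"
    using assms by (intro real_distribution_centered_normal_law) simp
  show "char (distr M borel (\<lambda>z. U z + V z)) = char (centered_normal_law (s + r))"
  proof
    fix t
    have "- ((s + r) * t\<^sup>2) / 2 = - (s * t\<^sup>2) / 2 + - (r * t\<^sup>2) / 2"
      by (simp add: field_simps)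
    then show "char (distr M borel (\<lambda>z. U z + V z)) t = char (centered_normal_law (s + r)) t"
      using assms by (simp add: char_distr_add[OF ind] char_centered_normal_law exp_add[symmetric] of_real_mult[symmetric]
          del: of_real_mult)
  qed
qed

lemma (in prob_space) centered_normal_law_sum:
  assumes ind: "indep_vars (\<lambda>_. borel) U {..<n::nat}"
    and law: "\<And>i. i < n \<Longrightarrow> distr M borel (U i) = centered_normal_law s" and s: "0 \<le> s"
  shows "distr M borel (\<lambda>z. \<Sum>i<n. U i z) = centered_normal_law (real n * s)"
proof (rule Levy_uniqueness)
  have [measurable]: "U i \<in> borel_measurable M" if "i < n" for i
    using ind that by (auto simp: indep_vars_def)
  show "real_distribution (distr M borel (\<lambda>z. \<Sum>i<n. U i z))"
    by (intro real_distribution_distr) simp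
  show "real_distribution (centered_normal_law (real n * s))"
    using s by (intro real_distribution_centered_normal_law) simp
  show "char (distr M borel (\<lambda>z. \<Sum>i<n. U i z)) = char (centered_normal_law (real n * s))"
  proof
    fix t
    have "char (distr M borel (\<lambda>z. \<Sum>i<n. U i z)) t = complex_of_real (exp (- (s * t\<^sup>2) / 2)) ^ n"
      using law s by (simp add: char_distr_sum[OF ind] char_centered_normal_law)
    also have "\<dots> = complex_of_real (exp (real n * (- (s * t\<^sup>2) / 2)))"
      by (simp only: of_real_power[symmetric] exp_of_nat_mult)
    finally show "char (distr M borel (\<lambda>z. \<Sum>i<n. U i z)) t = char (centered_normal_law (real n * s)) t"
      using s by (simp add: char_centered_normal_law mult.assoc)
  qed
qed

section \<open>Covariance and law of Gaussian processes\<close>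

lemma centered_gaussian_process_leval:
  "centered_gaussian_process M v X \<longleftrightarrow>
     (\<forall>t. X t \<in> borel_measurable M) \<and>
     (\<forall>ps. distr M borel (\<lambda>z. leval (\<lambda>t. X t z) ps) = centered_normal_law (kgram (Gam v) ps))"
  by (simp add: centered_gaussian_process_def leval_def)

lemma integral_leval:
  assumes "\<And>s. integrable M (f s)"
  shows "integrable M (\<lambda>z. leval (\<lambda>s. f s z) ps) \<and> (\<integral>z. leval (\<lambda>s. f s z) ps \<partial>M) = leval (\<lambda>s. \<integral>z. f s z \<partial>M) ps"
  by (induction ps) (auto simp: assms)

text \<open>The sign of \<open>kgram\<close> cannot be read off the law of a combination:
  \<open>sqrt (- s) = - sqrt s\<close>, and only the square of the deviation enters the density, so
  \<open>centered_normal_law\<close> takes the same value at \<open>s\<close> and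
  \<open>- s\<close>. Only the variances of single values and of increments are known to be
  nonnegative, from \<open>v\<close>. Polarization turns them into covariances, and
  \<open>kgram\<close> becomes a second moment.\<close>

lemma centered_gaussian_process_psd:
  assumes M: "prob_space M" and X: "centered_gaussian_process M v X"
    and v: "\<And>t. 0 \<le> t \<Longrightarrow> 0 \<le> v t" "v 0 = 0"
  shows "0 \<le> kgram (Gam v) ps"
proof -
  have [measurable]: "X t \<in> borel_measurable M" for t
    using X by (simp add: centered_gaussian_process_def)
  have law: "distr M borel (\<lambda>z. leval (\<lambda>t. X t z) ps) = centered_normal_law (kgram (Gam v) ps)" for ps
    using X by (simp add: centered_gaussian_process_leval)
  have mom: "integrable M (\<lambda>z. (U z)\<^sup>2) \<and> (\<integral>z. (U z)\<^sup>2 \<partial>M) = s"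
    if U: "distr M borel U = centered_normal_law s" "0 \<le> s" and [measurable]: "U \<in> borel_measurable M" for U s
    using centered_normal_law_moment2[OF U(2)] unfolding U(1)[symmetric]
    by (simp add: integral_distr integrable_distr_eq)
  have single: "integrable M (\<lambda>z. (X s z)\<^sup>2) \<and> (\<integral>z. (X s z)\<^sup>2 \<partial>M) = v \<bar>s\<bar>" for s
    using law[of "[(1, s)]"] v by (intro mom) (simp_all add: kgram_def Gam_def)
  have pair: "integrable M (\<lambda>z. (X s z - X t z)\<^sup>2) \<and> (\<integral>z. (X s z - X t z)\<^sup>2 \<partial>M) = v \<bar>t - s\<bar>" for s t
  proof (intro mom)
    have "kgram (Gam v) [(1, s), (- 1, t)] = v \<bar>t - s\<bar>"
      using v by (simp add: kgram_def Gam_def abs_minus_commute[of s t] field_simps)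
    then show "distr M borel (\<lambda>z. X s z - X t z) = centered_normal_law (v \<bar>t - s\<bar>)"
      using law[of "[(1, s), (- 1, t)]"] by simp
  qed (use v in auto)
  have prod: "X s z * X t z = ((X s z)\<^sup>2 + (X t z)\<^sup>2 - (X s z - X t z)\<^sup>2) / 2" for s t z
    by (simp add: power2_eq_square algebra_simps)
  have cov: "integrable M (\<lambda>z. X s z * X t z) \<and> (\<integral>z. X s z * X t z \<partial>M) = Gam v s t" for s t
    unfolding prod using single[of s] single[of t] pair[of s t] by (simp add: Gam_def)
  have "kgram (Gam v) ps = leval (\<lambda>s. \<integral>z. leval (\<lambda>t. X s z * X t z) ps \<partial>M) ps"
    using integral_leval[of M "\<lambda>t z. X _ z * X t z" ps] cov by (simp add: kgram_eq_kin kin_def)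
  also have "\<dots> = (\<integral>z. leval (\<lambda>s. leval (\<lambda>t. X s z * X t z) ps) ps \<partial>M)"
    using integral_leval[of M "\<lambda>t z. X _ z * X t z" ps] cov
      integral_leval[of M "\<lambda>s z. leval (\<lambda>t. X s z * X t z) ps" ps] by simp
  also have "\<dots> = (\<integral>z. (leval (\<lambda>t. X t z) ps)\<^sup>2 \<partial>M)"
    by (simp add: leval_cmult leval_multc power2_eq_square)
  finally show ?thesis
    by simp
qed

lemma PiM_UNIV_leval_measurable [measurable]:
  "(\<lambda>w. leval w ps) \<in> borel_measurable product_borel"
  by (rule borel_measurable_leval) simp

lemma process_measurable_PiM:
  fixes X :: "'i \<Rightarrow> 'a \<Rightarrow> real"
  assumes "\<And>t. X t \<in> borel_measurable M"
  shows "(\<lambda>z t. X t z) \<in> measurable M product_borel"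
  using assms by (intro measurable_PiM_single') auto

lemma measure_eq_of_distr_eq:
  fixes X :: "'i \<Rightarrow> 'a \<Rightarrow> real" and Y :: "'i \<Rightarrow> 'b \<Rightarrow> real"
  assumes "distr M product_borel (\<lambda>z i. X i z) = distr N product_borel (\<lambda>z i. Y i z)"
    and "\<And>i. X i \<in> borel_measurable M" "\<And>i. Y i \<in> borel_measurable N"
    and P: "{w. P w} \<in> sets product_borel"
  shows "measure M {z \<in> space M. P (\<lambda>i. X i z)} = measure N {z \<in> space N. P (\<lambda>i. Y i z)}"
proof -
  have "measure M ((\<lambda>z i. X i z) -` {w. P w} \<inter> space M) = measure N ((\<lambda>z i. Y i z) -` {w. P w} \<inter> space N)"
    using assms by (metis measure_distr process_measurable_PiM)
  then show ?thesis
    by (simp add: vimage_def Int_def conj_commute)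
qed

text \<open>Allows one version of the process to be exchanged for another: the normalized sum for a
  single copy, and the resampled process for the original.\<close>

lemma gaussian_transfer:
  assumes M: "prob_space M" and N: "prob_space N"
    and X: "centered_gaussian_process M v X" and Y: "centered_gaussian_process N v Y"
    and P: "{w. P w} \<in> sets product_borel"
  shows "measure M {z \<in> space M. P (\<lambda>t. X t z)} = measure N {z \<in> space N. P (\<lambda>t. Y t z)}"
  using X Y P unfolding centered_gaussian_process_leval
  by (intro measure_eq_of_distr_eq linear_laws_determine_law M N) auto

section \<open>Fernique's inequality\<close>

text \<open>Says that the seminorm given by the supremum of \<open>\<bar>leval w ps\<bar>\<close>
  over \<open>I\<close> is larger than \<open>r\<close>, without naming a supremum that may be
  infinite.\<close>

definition exceeds :: "(real \<times> real) list set \<Rightarrow> real \<Rightarrow> (real \<Rightarrow> real) \<Rightarrow> bool" where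
  "exceeds I r w \<longleftrightarrow> (\<exists>ps\<in>I. r < \<bar>leval w ps\<bar>)"

lemma exceeds_measurable:
  assumes "countable I"
  shows "{w. exceeds I r w} \<in> sets product_borel"
proof -
  have "{w \<in> space product_borel. r < \<bar>leval w ps\<bar>} \<in> sets product_borel" for ps :: "(real \<times> real) list"
    by measurable
  then have "(\<Union>ps\<in>I. {w. r < \<bar>leval w ps\<bar>}) \<in> sets product_borel"
    using assms by (intro sets.countable_UN') (auto simp: space_PiM)
  moreover have "(\<Union>ps\<in>I. {w. r < \<bar>leval w ps\<bar>}) = {w. exceeds I r w}"
    by (auto simp: exceeds_def)
  ultimately show ?thesis
    by simp
qed

text \<open>With \<open>r_k = 4 * \<tau> * sqrt 2 ^ k - 3 * \<tau>\<close>, the numbers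
  \<open>u_k = F(r_k) / (9/10)\<close> satisfy \<open>u_0 \<le> 1/9\<close>, and the step with
  \<open>s = \<tau>\<close> gives \<open>u_(k+1) \<le> u_k^2\<close>, as \<open>1 - F \<tau>\<close>
  is at least 9/10. The offset \<open>3 * \<tau>\<close> ensures
  \<open>(r_(k+1) - \<tau>) / sqrt 2 \<ge> r_k\<close>, because
  \<open>4 / sqrt 2 \<le> 3\<close>.\<close>

lemma fernique_iteration:
  fixes F :: "real \<Rightarrow> real"
  assumes mono: "\<And>r s. r \<le> s \<Longrightarrow> F s \<le> F r" and nonneg: "\<And>r. 0 \<le> F r"
    and step: "\<And>r s. F r * (1 - F s) \<le> (F ((r - s) / sqrt 2))\<^sup>2"
    and \<tau>: "0 < \<tau>" "F \<tau> \<le> 1 / 10" and r: "4 * \<tau> \<le> r"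
  shows "F r \<le> exp (- (r\<^sup>2 / (16 * \<tau>\<^sup>2)))"
proof -
  have F: "F (4 * \<tau> * sqrt 2 ^ k - 3 * \<tau>) \<le> 9 / 10 * (1 / 9) ^ (2 ^ k)" for k
  proof (induction k)
    case 0
    then show ?case
      using \<tau> by simp
  next
    case (Suc k)
    define q where "q = 4 * \<tau> * sqrt 2 ^ Suc k - 3 * \<tau>"
    have "(q - \<tau>) / sqrt 2 = 4 * \<tau> * sqrt 2 ^ k - 4 * \<tau> / sqrt 2"
      by (simp add: q_def field_simps)
    moreover have "4 * \<tau> / sqrt 2 \<le> 3 * \<tau>"
    proof -
      have "4 / 3 \<le> sqrt 2"
        by (rule real_le_rsqrt) (simp add: power2_eq_square)
      then show ?thesis
        using \<tau> by (simp add: field_simps)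
    qed
    ultimately have "F ((q - \<tau>) / sqrt 2) \<le> F (4 * \<tau> * sqrt 2 ^ k - 3 * \<tau>)"
      by (intro mono) simp
    also have "\<dots> \<le> 9 / 10 * (1 / 9) ^ (2 ^ k)"
      by (rule Suc.IH)
    finally have "(F ((q - \<tau>) / sqrt 2))\<^sup>2 \<le> (9 / 10 * (1 / 9) ^ (2 ^ k))\<^sup>2"
      using nonneg by (intro power_mono) auto
    moreover have "F q * (9 / 10) \<le> F q * (1 - F \<tau>)"
      using \<tau> nonneg[of q] by (intro mult_left_mono) auto
    ultimately have "F q * (9 / 10) \<le> (9 / 10 * (1 / 9) ^ (2 ^ k))\<^sup>2"
      using step[of q \<tau>] by linarith
    also have "\<dots> = 9 / 10 * (1 / 9) ^ (2 ^ Suc k) * (9 / 10)"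
      by (simp add: power_mult_distrib power_even_eq power2_eq_square mult_ac flip: power_mult power_add)
    finally show ?case
      by (simp add: q_def)
  qed
  define x where "x = (r / (4 * \<tau>))\<^sup>2"
  have r1: "1 \<le> r / (4 * \<tau>)"
    using r \<tau> by simp
  then have x1: "1 \<le> x"
    unfolding x_def by (rule one_le_power)
  obtain k :: nat where k: "2 ^ k \<le> x" "x < 2 ^ Suc k"
  proof -
    define n where "n = nat \<lfloor>x\<rfloor>"
    have "1 \<le> n"
      using x1 by (simp add: n_def le_nat_iff)
    then obtain k where "2 ^ k \<le> n" "n < 2 ^ Suc k"
      using ex_power_ivl1[of 2 n] by auto
    then have "(2::nat) ^ k \<le> n" "n + 1 \<le> (2::nat) ^ Suc k"
      by simp_all
    then have *: "2 ^ k \<le> real n" "real n + 1 \<le> 2 ^ Suc k"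
      using of_nat_mono[where 'a = real, of "2 ^ k" n] of_nat_mono[where 'a = real, of "n + 1" "2 ^ Suc k"] by simp_all
    have n: "real n \<le> x" "x < real n + 1"
      using x1 by (simp_all add: n_def)
    show ?thesis
    proof (rule that)
      show "2 ^ k \<le> x"
        using *(1) n(1) by (rule order_trans)
      show "x < 2 ^ Suc k"
        using n(2) *(2) by (rule less_le_trans)
    qed
  qed
  have "(sqrt 2 ^ k)\<^sup>2 \<le> (r / (4 * \<tau>))\<^sup>2"
    using k(1) by (simp add: x_def power_mult[symmetric] mult.commute[of k]) (simp add: power_mult)
  then have "sqrt 2 ^ k \<le> r / (4 * \<tau>)"
    by (rule power2_le_imp_le) (use r1 in simp)
  then have "4 * \<tau> * sqrt 2 ^ k - 3 * \<tau> \<le> r"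
    using \<tau> by (simp add: field_simps)
  then have "F r \<le> 9 / 10 * (1 / 9) ^ (2 ^ k)"
    using F[of k] mono[of "4 * \<tau> * sqrt 2 ^ k - 3 * \<tau>" r] by linarith
  also have "\<dots> \<le> (1 / 9) ^ (2 ^ k)"
    by simp
  \<comment> \<open>The 2 in the exponent pays for rounding \<open>x\<close> down to the power
    \<open>2 ^ k\<close>.\<close>
  also have "\<dots> \<le> exp (- 2) ^ (2 ^ k)"
  proof (rule power_mono)
    have "exp (2::real) \<le> 9"
    proof -
      have "exp (2::real) = (exp 1)\<^sup>2"
        using exp_add[of 1 "1::real"] by (simp add: power2_eq_square)
      also have "\<dots> \<le> 3\<^sup>2"
        using exp_le by (intro power_mono) auto
      finally show ?thesis
        by simp
    qed
    then show "1 / 9 \<le> exp (- 2 :: real)"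
      by (simp add: exp_minus field_simps)
  qed simp
  also have "\<dots> = exp (- (2 ^ Suc k))"
    by (simp flip: exp_of_nat_mult)
  also have "\<dots> \<le> exp (- x)"
    using k(2) by simp
  also have "x = r\<^sup>2 / (16 * \<tau>\<^sup>2)"
    by (simp add: x_def power_divide power_mult_distrib)
  finally show ?thesis
    by simp
qed

text \<open>The independent second copy serves twice: in the rotation behind Fernique's inequality
  and in the resampling for the lower bound.\<close>

locale gaussian_pair = prob_space M + variance_function v
  for M :: "'a measure" and v :: "real \<Rightarrow> real" +
  fixes X Y :: "real \<Rightarrow> 'a \<Rightarrow> real"
  assumes X: "centered_gaussian_process M v X" and Y: "centered_gaussian_process M v Y"
    and indep_XY: "indep_var product_borel (\<lambda>z t. X t z) product_borel (\<lambda>z t. Y t z)"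
begin

lemma X_measurable [measurable]: "X t \<in> borel_measurable M"
  using X by (simp add: centered_gaussian_process_def)

lemma Y_measurable [measurable]: "Y t \<in> borel_measurable M"
  using Y by (simp add: centered_gaussian_process_def)

lemma process_event:
  fixes Z :: "real \<Rightarrow> 'a \<Rightarrow> real"
  assumes "\<And>t. Z t \<in> borel_measurable M" "{w. P w} \<in> sets product_borel"
  shows "{z \<in> space M. P (\<lambda>t. Z t z)} \<in> events"
  using measurable_sets[OF process_measurable_PiM[of Z M] assms(2)] assms(1)
  by (simp add: vimage_def Int_def conj_commute)

lemma law_sum:
  "distr M borel (\<lambda>z. leval (\<lambda>t. X t z) ps + leval (\<lambda>t. Y t z) qs)
     = centered_normal_law (kgram (Gam v) ps + kgram (Gam v) qs)"
proof (rule centered_normal_law_add)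
  show "indep_var borel (\<lambda>z. leval (\<lambda>t. X t z) ps) borel (\<lambda>z. leval (\<lambda>t. Y t z) qs)"
    using indep_var_compose[OF indep_XY PiM_UNIV_leval_measurable[of ps] PiM_UNIV_leval_measurable[of qs]]
    by (simp add: comp_def)
qed (use X Y in \<open>auto simp: centered_gaussian_process_leval kgram_nonneg\<close>)

lemma prob_indep:
  assumes P: "{w. P w} \<in> sets product_borel" and Q: "{w. Q w} \<in> sets product_borel"
  shows "prob {z \<in> space M. P (\<lambda>t. X t z) \<and> Q (\<lambda>t. Y t z)}
       = prob {z \<in> space M. P (\<lambda>t. X t z)} * prob {z \<in> space M. Q (\<lambda>t. Y t z)}"
proof -
  have "(\<lambda>z. (\<lambda>t. X t z, \<lambda>t. Y t z)) -` ({w. P w} \<times> {w. Q w}) \<inter> space M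
      = {z \<in> space M. P (\<lambda>t. X t z) \<and> Q (\<lambda>t. Y t z)}"
    "(\<lambda>z t. X t z) -` {w. P w} \<inter> space M = {z \<in> space M. P (\<lambda>t. X t z)}"
    "(\<lambda>z t. Y t z) -` {w. Q w} \<inter> space M = {z \<in> space M. Q (\<lambda>t. Y t z)}"
    by auto
  then show ?thesis
    using indep_varD[OF indep_XY P Q] by simp
qed

text \<open>The Boolean index makes one process out of the pair, so that the laws of linear
  functionals determine the joint law. A rotation preserves the sum of the two \<open>kgram\<close>
  values by the parallelogram law.\<close>

lemma rotation_invariant:
  "distr M product_borel (\<lambda>z (j, t). if j then (X t z + Y t z) / sqrt 2 else (X t z - Y t z) / sqrt 2)
     = distr M product_borel (\<lambda>z (j, t). if j then Y t z else X t z)"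
proof -
  define Z where "Z = (\<lambda>(j, t) z. if j then Y t z else X t z)"
  define Z' where "Z' = (\<lambda>(j, t) z. if j then (X t z + Y t z) / sqrt 2 else (X t z - Y t z) / sqrt 2)"
  have [measurable]: "Z i \<in> borel_measurable M" "Z' i \<in> borel_measurable M" for i
    by (cases i; cases "fst i"; simp add: Z_def Z'_def)+
  have "distr M product_borel (\<lambda>z i. Z' i z) = distr M product_borel (\<lambda>z i. Z i z)"
  proof (rule linear_laws_determine_law)
    fix ps :: "(real \<times> bool \<times> real) list"
    define px where "px = map (\<lambda>(a, j, t). (if j then 0 else a, t)) ps"
    define py where "py = map (\<lambda>(a, j, t). (if j then a else 0, t)) ps"
    define qx where "qx = scal (1 / sqrt 2) (px @ py)"
    define qy where "qy = scal (1 / sqrt 2) (scal (- 1) px @ py)"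
    have "leval (\<lambda>i. Z i z) ps = leval (\<lambda>t. X t z) px + leval (\<lambda>t. Y t z) py" for z
      unfolding px_def py_def by (induction ps) (auto simp: Z_def)
    then have 1: "distr M borel (\<lambda>z. leval (\<lambda>i. Z i z) ps) = centered_normal_law (kgram (Gam v) px + kgram (Gam v) py)"
      by (simp add: law_sum)
    have "leval (\<lambda>i. Z' i z) ps = leval (\<lambda>t. X t z) qx + leval (\<lambda>t. Y t z) qy" for z
    proof -
      have "leval (\<lambda>i. Z' i z) ps = (1 / sqrt 2) * (leval (\<lambda>t. X t z) px + leval (\<lambda>t. X t z) py)
          + (1 / sqrt 2) * (leval (\<lambda>t. Y t z) py - leval (\<lambda>t. Y t z) px)"
        unfolding px_def py_def by (induction ps) (auto simp: Z'_def field_simps)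
      then show ?thesis
        by (simp add: qx_def qy_def add_divide_distrib diff_divide_distrib)
    qed
    then have 2: "distr M borel (\<lambda>z. leval (\<lambda>i. Z' i z) ps) = centered_normal_law (kgram (Gam v) qx + kgram (Gam v) qy)"
      by (simp add: law_sum)
    have "kgram (Gam v) qx + kgram (Gam v) qy = kgram (Gam v) px + kgram (Gam v) py"
      unfolding qx_def qy_def by (simp add: kgram_scal kgram_append power_divide field_simps)
    then show "distr M borel (\<lambda>z. leval (\<lambda>i. Z' i z) ps) = distr M borel (\<lambda>z. leval (\<lambda>i. Z i z) ps)"
      using 1 2 by simp
  qed (auto intro: prob_space_axioms)
  moreover have "(\<lambda>z i. Z i z) = (\<lambda>z (j, t). if j then Y t z else X t z)"
    "(\<lambda>z i. Z' i z) = (\<lambda>z (j, t). if j then (X t z + Y t z) / sqrt 2 else (X t z - Y t z) / sqrt 2)"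
    by (auto simp: Z_def Z'_def fun_eq_iff)
  ultimately show ?thesis
    by simp
qed

lemma prob_rotated:
  assumes P: "{w. P w} \<in> sets product_borel" and Q: "{w. Q w} \<in> sets product_borel"
  shows "prob {z \<in> space M. P (\<lambda>t. (X t z - Y t z) / sqrt 2) \<and> Q (\<lambda>t. (X t z + Y t z) / sqrt 2)}
       = prob {z \<in> space M. P (\<lambda>t. X t z)} * prob {z \<in> space M. Q (\<lambda>t. Y t z)}"
proof -
  define R where "R w \<longleftrightarrow> P (\<lambda>t. w (False, t)) \<and> Q (\<lambda>t. w (True, t))" for w :: "bool \<times> real \<Rightarrow> real"
  have slice: "{w. S (\<lambda>t. w (j, t))} \<in> sets product_borel"
    if S: "{w. S w} \<in> sets product_borel" for S :: "(real \<Rightarrow> real) \<Rightarrow> bool" and j :: bool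
  proof -
    have "(\<lambda>w t. w (j, t)) \<in> measurable product_borel product_borel"
      by (rule measurable_PiM_single') auto
    from measurable_sets[OF this S] show ?thesis
      by (simp add: vimage_def space_PiM)
  qed
  have "{w. R w} = {w. P (\<lambda>t. w (False, t))} \<inter> {w. Q (\<lambda>t. w (True, t))}"
    by (auto simp: R_def)
  also have "\<dots> \<in> sets product_borel"
    by (intro sets.Int slice P Q)
  finally have R: "{w. R w} \<in> sets product_borel" .
  define Z where "Z = (\<lambda>(j, t) z. if j then Y t z else X t z)"
  define Z' where "Z' = (\<lambda>(j, t) z. if j then (X t z + Y t z) / sqrt 2 else (X t z - Y t z) / sqrt 2)"
  have [measurable]: "Z i \<in> borel_measurable M" "Z' i \<in> borel_measurable M" for i
    by (cases i; cases "fst i"; simp add: Z_def Z'_def)+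
  have "(\<lambda>z i. Z i z) = (\<lambda>z (j, t). if j then Y t z else X t z)"
    "(\<lambda>z i. Z' i z) = (\<lambda>z (j, t). if j then (X t z + Y t z) / sqrt 2 else (X t z - Y t z) / sqrt 2)"
    by (auto simp: Z_def Z'_def fun_eq_iff)
  then have "prob {z \<in> space M. R (\<lambda>i. Z' i z)} = prob {z \<in> space M. R (\<lambda>i. Z i z)}"
    using rotation_invariant by (intro measure_eq_of_distr_eq R) auto
  then show ?thesis
    using prob_indep[OF P Q] by (simp add: R_def Z_def Z'_def)
qed

text \<open>Suppose no functional in \<open>I\<close> of the rotated difference exceeds
  \<open>s\<close> while some \<open>ps\<close> of the rotated sum exceeds \<open>r\<close>. Then
  \<open>ps\<close> exceeds \<open>(r - s) / sqrt 2\<close> on both \<open>X\<close> and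
  \<open>Y\<close>. Independence before and after the rotation turns this inclusion into the
  recursion of \<open>fernique_iteration\<close>.\<close>

lemma fernique:
  assumes I: "countable I" and \<tau>: "0 < \<tau>" "prob {z \<in> space M. exceeds I \<tau> (\<lambda>t. X t z)} \<le> 1 / 10"
    and r: "4 * \<tau> \<le> r"
  shows "prob {z \<in> space M. exceeds I r (\<lambda>t. X t z)} \<le> exp (- (r\<^sup>2 / (16 * \<tau>\<^sup>2)))"
proof -
  define F where "F r = prob {z \<in> space M. exceeds I r (\<lambda>t. X t z)}" for r
  have ev: "{z \<in> space M. exceeds I r (\<lambda>t. X t z)} \<in> events"
    "{z \<in> space M. exceeds I r (\<lambda>t. Y t z)} \<in> events" for r
    by (intro process_event exceeds_measurable I; simp)+
  have FY: "F r = prob {z \<in> space M. exceeds I r (\<lambda>t. Y t z)}" for r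
    unfolding F_def by (rule gaussian_transfer[OF prob_space_axioms prob_space_axioms X Y exceeds_measurable[OF I]])
  have "F r \<le> exp (- (r\<^sup>2 / (16 * \<tau>\<^sup>2)))"
  proof (rule fernique_iteration)
    show "F s \<le> F r" if "r \<le> s" for r s
      unfolding F_def using that by (intro finite_measure_mono ev) (auto simp: exceeds_def intro: le_less_trans)
    show "0 \<le> F r" for r
      by (simp add: F_def)
    show "F r * (1 - F s) \<le> (F ((r - s) / sqrt 2))\<^sup>2" for r s
    proof -
      define q where "q = (r - s) / sqrt 2"
      have co: "{w. \<not> exceeds I s w} \<in> sets product_borel"
      proof -
        have "{w. \<not> exceeds I s w} = space product_borel - {w. exceeds I s w}"
          by (auto simp: space_PiM)
        then show ?thesis
          using sets.compl_sets[OF exceeds_measurable[OF I, of s]] by simp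
      qed
      have "1 - F s = prob {z \<in> space M. \<not> exceeds I s (\<lambda>t. X t z)}"
      proof -
        have "{z \<in> space M. \<not> exceeds I s (\<lambda>t. X t z)} = space M - {z \<in> space M. exceeds I s (\<lambda>t. X t z)}"
          by auto
        then show ?thesis
          using prob_compl[OF ev(1)[of s]] by (simp add: F_def)
      qed
      then have "F r * (1 - F s) = prob {z \<in> space M. \<not> exceeds I s (\<lambda>t. (X t z - Y t z) / sqrt 2) \<and>
          exceeds I r (\<lambda>t. (X t z + Y t z) / sqrt 2)}"
        using prob_rotated[OF co exceeds_measurable[OF I, of r]] FY by simp
      also have "\<dots> \<le> prob {z \<in> space M. exceeds I q (\<lambda>t. X t z) \<and> exceeds I q (\<lambda>t. Y t z)}"
      proof (intro finite_measure_mono)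
        have "{z \<in> space M. exceeds I q (\<lambda>t. X t z) \<and> exceeds I q (\<lambda>t. Y t z)}
            = {z \<in> space M. exceeds I q (\<lambda>t. X t z)} \<inter> {z \<in> space M. exceeds I q (\<lambda>t. Y t z)}"
          by auto
        then show "{z \<in> space M. exceeds I q (\<lambda>t. X t z) \<and> exceeds I q (\<lambda>t. Y t z)} \<in> events"
          using ev by auto
        show "{z \<in> space M. \<not> exceeds I s (\<lambda>t. (X t z - Y t z) / sqrt 2) \<and> exceeds I r (\<lambda>t. (X t z + Y t z) / sqrt 2)}
          \<subseteq> {z \<in> space M. exceeds I q (\<lambda>t. X t z) \<and> exceeds I q (\<lambda>t. Y t z)}"
        proof safe
          fix z
          assume n: "\<not> exceeds I s (\<lambda>t. (X t z - Y t z) / sqrt 2)" and "exceeds I r (\<lambda>t. (X t z + Y t z) / sqrt 2)"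
          then obtain ps where ps: "ps \<in> I" "r < \<bar>leval (\<lambda>t. (X t z + Y t z) / sqrt 2) ps\<bar>"
            by (auto simp: exceeds_def)
          define x where "x = leval (\<lambda>t. X t z) ps"
          define y where "y = leval (\<lambda>t. Y t z) ps"
          have "\<bar>leval (\<lambda>t. (X t z - Y t z) / sqrt 2) ps\<bar> \<le> s"
            using n ps(1) by (auto simp: exceeds_def not_less)
          then have 1: "\<bar>x - y\<bar> \<le> s * sqrt 2"
            by (simp add: divide_inverse leval_multc leval_diff x_def y_def abs_mult) (simp add: field_simps)
          have 2: "r * sqrt 2 < \<bar>x + y\<bar>"
            using ps(2) by (simp add: divide_inverse leval_multc leval_add x_def y_def abs_mult) (simp add: field_simps)
          have "(r - s) * sqrt 2 < 2 * \<bar>x\<bar>" "(r - s) * sqrt 2 < 2 * \<bar>y\<bar>"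
            using 1 2 unfolding left_diff_distrib by linarith+
          moreover have "(r - s) * sqrt 2 = 2 * q"
            by (simp add: q_def field_simps)
          ultimately have "q < \<bar>x\<bar>" "q < \<bar>y\<bar>"
            by simp_all
          then show "exceeds I q (\<lambda>t. X t z)" "exceeds I q (\<lambda>t. Y t z)"
            using ps(1) by (auto simp: exceeds_def x_def y_def)
        qed
      qed
      also have "\<dots> = F q * F q"
        using prob_indep[OF exceeds_measurable[OF I, of q] exceeds_measurable[OF I, of q]] FY[of q] by (simp add: F_def)
      finally show ?thesis
        by (simp add: q_def power2_eq_square)
    qed
  qed (use \<tau> r in \<open>auto simp: F_def\<close>)
  then show ?thesis
    by (simp add: F_def)
qed

end

section \<open>Paths\<close>

lemma OmegaSet_zero: "w \<in> OmegaSet \<Longrightarrow> w 0 = 0"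
  and OmegaSet_continuous: "w \<in> OmegaSet \<Longrightarrow> continuous_on UNIV w"
  by (simp_all add: OmegaSet_def)

lemma OmegaSet_cmult: "w \<in> OmegaSet \<Longrightarrow> (\<lambda>t. c * w t) \<in> OmegaSet"
  unfolding OmegaSet_def by (auto intro!: continuous_intros tendsto_mult_right_zero simp flip: times_divide_eq_right)

lemma OmegaSet_add: "w \<in> OmegaSet \<Longrightarrow> w' \<in> OmegaSet \<Longrightarrow> (\<lambda>t. w t + w' t) \<in> OmegaSet"
  unfolding OmegaSet_def by (auto intro!: continuous_intros tendsto_add_zero simp: add_divide_distrib)

lemma OmegaSet_sum: "(\<And>i. i \<in> I \<Longrightarrow> w i \<in> OmegaSet) \<Longrightarrow> (\<lambda>t. \<Sum>i\<in>I. w i t) \<in> OmegaSet"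
proof (induction I rule: infinite_finite_induct)
  case (insert i I)
  then show ?case
    using OmegaSet_add[of "w i" "\<lambda>t. \<Sum>i\<in>I. w i t"] by simp
qed (auto simp: OmegaSet_def)

lemma OmegaSet_past_small:
  assumes "w \<in> OmegaSet" "0 < e"
  obtains T where "0 \<le> T" "\<And>t. T \<le> t \<Longrightarrow> \<bar>w (- t)\<bar> \<le> e * (1 + t)"
proof -
  have "((\<lambda>t. w t / (1 + \<bar>t\<bar>)) \<longlongrightarrow> 0) at_bot"
    using assms by (simp add: OmegaSet_def)
  then have "((\<lambda>t. w (- t) / (1 + \<bar>- t\<bar>)) \<longlongrightarrow> 0) at_top"
    by (simp add: filterlim_at_bot_mirror)
  then have "\<forall>\<^sub>F t in at_top. dist (w (- t) / (1 + \<bar>- t\<bar>)) 0 < e"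
    using assms(2) by (rule tendstoD)
  then obtain T where T: "\<And>t. T \<le> t \<Longrightarrow> dist (w (- t) / (1 + \<bar>- t\<bar>)) 0 < e"
    by (auto simp: eventually_at_top_linorder)
  show ?thesis
  proof (rule that[of "max T 0"])
    fix t assume "max T 0 \<le> t"
    then show "\<bar>w (- t)\<bar> \<le> e * (1 + t)"
      using T[of t] by (auto simp: field_simps abs_divide)
  qed simp
qed

lemma OmegaSet_drift_attains_max:
  assumes w: "w \<in> OmegaSet" and c: "0 < c" and a: "0 \<le> a"
  obtains s where "a \<le> s" "\<And>u. a \<le> u \<Longrightarrow> - w (- u) - c * u \<le> - w (- s) - c * s"
proof -
  define V where "V = (\<lambda>u. - w (- u) - c * u)"
  obtain T where T: "0 \<le> T" "\<And>t. T \<le> t \<Longrightarrow> \<bar>w (- t)\<bar> \<le> c / 2 * (1 + t)"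
    using OmegaSet_past_small[OF w, of "c / 2"] c by auto
  define R where "R = max (max a T) (1 - 2 * V a / c)"
  have far: "V u \<le> V a" if "R \<le> u" for u
  proof -
    have "1 - 2 * V a / c \<le> u" "T \<le> u"
      using that by (auto simp: R_def)
    then have "c - 2 * V a \<le> c * u"
      using c by (simp add: field_simps)
    moreover have "V u \<le> c / 2 * (1 + u) - c * u"
      using T(2)[OF \<open>T \<le> u\<close>] by (auto simp: V_def)
    ultimately show ?thesis
      by (simp add: field_simps)
  qed
  have "continuous_on {a..R} V"
    unfolding V_def
    by (intro continuous_intros continuous_on_compose2[OF OmegaSet_continuous[OF w]]) auto
  moreover have "a \<le> R"
    by (simp add: R_def)
  ultimately obtain s where s: "s \<in> {a..R}" "\<And>u. u \<in> {a..R} \<Longrightarrow> V u \<le> V s"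
    using continuous_attains_sup[of "{a..R}" V] by auto
  have "V u \<le> V s" if "a \<le> u" for u
    using s(2)[of u] s(2)[of a] far[of u] that \<open>a \<le> R\<close> by (cases "u \<le> R") auto
  then show ?thesis
    using that[of s] s(1) by (auto simp: V_def)
qed

text \<open>If the supremum over \<open>s > t\<close> exceeds the one over \<open>(0, t]\<close>, then its maximizer can replace \<open>t\<close>,
  because \<open>(c1 - c2) * s \<ge> (c1 - c2) * t > b\<close>.\<close>

lemma sup_diff_iff_strict_exceed:
  assumes w: "w \<in> OmegaSet" and c: "0 < c2" "c2 < c1"
  shows "b < (SUP t\<in>{0<..}. w 0 - w (- t) - c2 * t) - (SUP s\<in>{0<..}. w 0 - w (- s) - c1 * s)
     \<longleftrightarrow> strict_exceed b c1 c2 w"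
proof -
  define U where "U = (\<lambda>t. - w (- t) - c2 * t)"
  define V where "V = (\<lambda>t. - w (- t) - c1 * t)"
  have w0: "w 0 = 0"
    by (rule OmegaSet_zero[OF w])
  have eq: "(\<lambda>t. w 0 - w (- t) - c2 * t) = U" "(\<lambda>s. w 0 - w (- s) - c1 * s) = V"
    by (simp_all add: U_def V_def w0)
  have bdd: "bdd_above (U ` {0<..})" "bdd_above (V ` {0<..})"
  proof -
    obtain s1 where "\<And>u. 0 \<le> u \<Longrightarrow> U u \<le> U s1"
      using OmegaSet_drift_attains_max[OF w c(1), of 0] unfolding U_def by auto
    then show "bdd_above (U ` {0<..})"
      by (auto simp: bdd_above_def intro!: exI[of _ "U s1"])
    obtain s2 where "\<And>u. 0 \<le> u \<Longrightarrow> V u \<le> V s2"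
      using OmegaSet_drift_attains_max[OF w less_trans[OF c], of 0] unfolding V_def by auto
    then show "bdd_above (V ` {0<..})"
      by (auto simp: bdd_above_def intro!: exI[of _ "V s2"])
  qed
  have U_le: "U t \<le> Sup (U ` {0<..})" and V_le: "V t \<le> Sup (V ` {0<..})" if "0 < t" for t
    using that bdd by (auto intro!: cSUP_upper)
  \<comment> \<open>The supremum runs over \<open>s > 0\<close>, but \<open>V\<close> tends to 0 at
    0; this recovers the constraint at \<open>s = 0\<close>.\<close>
  have V0: "0 \<le> Sup (V ` {0<..})"
  proof (rule tendsto_upperbound)
    have "continuous_on UNIV V"
      unfolding V_def by (intro continuous_intros continuous_on_compose2[OF OmegaSet_continuous[OF w]]) auto
    then have "(V \<longlongrightarrow> V 0) (at 0)"
      by (simp add: continuous_on_def)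
    then show "(V \<longlongrightarrow> 0) (at_right 0)"
      by (simp add: V_def w0 filterlim_at_split)
    show "\<forall>\<^sub>F t in at_right 0. V t \<le> Sup (V ` {0<..})"
      using V_le by (auto simp: eventually_at_filter)
  qed simp
  show ?thesis
    unfolding eq
  proof
    assume "b < Sup (U ` {0<..}) - Sup (V ` {0<..})"
    then have "b + Sup (V ` {0<..}) < Sup (U ` {0<..})"
      by simp
    then obtain t where t: "0 < t" "b + Sup (V ` {0<..}) < U t"
      using less_cSUP_iff[OF _ bdd(1)] by auto
    define \<eta> where "\<eta> = U t - b - Sup (V ` {0<..})"
    have "b + c2 * t - c1 * s + \<eta> \<le> w (- s) - w (- t)" if "s \<in> {0..t}" for s
      using that V_le[of s] V0 by (cases "s = 0") (auto simp: \<eta>_def U_def V_def w0)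
    then show "strict_exceed b c1 c2 w"
      unfolding strict_exceed_def using t by (intro exI[of _ t] conjI exI[of _ \<eta>]) (auto simp: \<eta>_def)
  next
    assume "strict_exceed b c1 c2 w"
    then obtain t \<eta> where t: "0 < t" "0 < \<eta>"
      and tw: "\<And>s. s \<in> {0..t} \<Longrightarrow> b + c2 * t - c1 * s + \<eta> \<le> w (- s) - w (- t)"
      unfolding strict_exceed_def by auto
    obtain s where s: "t \<le> s" "\<And>u. t \<le> u \<Longrightarrow> V u \<le> V s"
      using OmegaSet_drift_attains_max[OF w less_trans[OF c], of t] t unfolding V_def by auto
    have D: "b + \<eta> \<le> (c1 - c2) * t"
      using tw[of t] t by (simp add: algebra_simps)
    have "(c1 - c2) * t \<le> (c1 - c2) * s"
      using s c by (intro mult_left_mono) auto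
    then have Us: "V s + b + \<eta> \<le> U s"
      using D by (simp add: U_def V_def algebra_simps)
    have "V u \<le> Sup (U ` {0<..}) - b - \<eta>" if u: "0 < u" for u
    proof (cases "u \<le> t")
      case True
      then have "V u \<le> U t - b - \<eta>"
        using tw[of u] u by (simp add: U_def V_def)
      then show ?thesis
        using U_le[OF t(1)] by simp
    next
      case False
      then show ?thesis
        using s(2)[of u] Us U_le[of s] s(1) t(1) by simp
    qed
    then have "Sup (V ` {0<..}) \<le> Sup (U ` {0<..}) - b - \<eta>"
      by (intro cSUP_least) auto
    then show "b < Sup (U ` {0<..}) - Sup (V ` {0<..})"
      using t(2) by simp
  qed
qed

lemma strict_exceed_scale:
  assumes k: "0 < k"
  shows "strict_exceed (k * b) (k * c1) (k * c2) (\<lambda>t. k * w t) \<longleftrightarrow> strict_exceed b c1 c2 w"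
proof
  assume "strict_exceed (k * b) (k * c1) (k * c2) (\<lambda>t. k * w t)"
  then obtain t \<eta> where t: "0 < t" "0 < \<eta>"
    and tw: "\<And>s. s \<in> {0..t} \<Longrightarrow> k * b + k * c2 * t - k * c1 * s + \<eta> \<le> k * w (- s) - k * w (- t)"
    unfolding strict_exceed_def by auto
  have "b + c2 * t - c1 * s + \<eta> / k \<le> w (- s) - w (- t)" if "s \<in> {0..t}" for s
  proof -
    have "k * (b + c2 * t - c1 * s + \<eta> / k) \<le> k * (w (- s) - w (- t))"
      using tw[OF that] k by (simp add: algebra_simps)
    then show ?thesis
      using k by simp
  qed
  then show "strict_exceed b c1 c2 w"
    unfolding strict_exceed_def using t k by (intro exI[of _ t] conjI exI[of _ "\<eta> / k"]) auto
next
  assume "strict_exceed b c1 c2 w"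
  then obtain t \<eta> where t: "0 < t" "0 < \<eta>"
    and tw: "\<And>s. s \<in> {0..t} \<Longrightarrow> b + c2 * t - c1 * s + \<eta> \<le> w (- s) - w (- t)"
    unfolding strict_exceed_def by auto
  have "k * b + k * c2 * t - k * c1 * s + k * \<eta> \<le> k * w (- s) - k * w (- t)" if "s \<in> {0..t}" for s
    using mult_left_mono[OF tw[OF that], of k] k by (simp add: algebra_simps)
  then show "strict_exceed (k * b) (k * c1) (k * c2) (\<lambda>t. k * w t)"
    unfolding strict_exceed_def using t k by (intro exI[of _ t] conjI exI[of _ "k * \<eta>"]) auto
qed

text \<open>Countably many conditions on path values, hence a set in the product sigma-algebra,
  where \<open>strict_exceed\<close> itself cannot be handled. For continuous paths the endpoints of
  the time interval follow from its interior.\<close>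

definition rat_exceed :: "real \<Rightarrow> real \<Rightarrow> real \<Rightarrow> (real \<Rightarrow> real) \<Rightarrow> bool" where
  "rat_exceed b c1 c2 w \<longleftrightarrow>
     (\<exists>t\<in>\<rat> \<inter> {0<..}. \<exists>k::nat. \<forall>s\<in>\<rat> \<inter> {0<..<t}. b + c2 * t - c1 * s + 1 / real (Suc k) \<le> w (- s) - w (- t))"

lemma rat_exceed_measurable: "{w. rat_exceed b c1 c2 w} \<in> sets product_borel"
proof -
  have ct: "countable (\<rat> \<inter> S)" for S :: "real set"
    using countable_rat by (rule countable_subset[rotated]) auto
  have [measurable]: "(\<lambda>w. w u) \<in> borel_measurable product_borel" for u :: real
    by (rule measurable_component_singleton) simp
  have "{w \<in> space product_borel. rat_exceed b c1 c2 w} \<in> sets product_borel"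
    unfolding rat_exceed_def
    by (intro sets.sets_Collect_countable_Ex' sets.sets_Collect_countable_Ex sets.sets_Collect_countable_All' ct) measurable
  then show ?thesis
    by (simp add: space_PiM)
qed

lemma rat_in_open:
  fixes A :: "real set"
  assumes "open A" "x \<in> A"
  shows "\<exists>q\<in>\<rat>. q \<in> A"
proof -
  obtain e where e: "0 < e" "ball x e \<subseteq> A"
    using assms by (auto simp: open_contains_ball)
  obtain q where "q \<in> \<rat>" "x < q" "q < x + e"
    using Rats_dense_in_real[of x "x + e"] e(1) by auto
  then show ?thesis
    using e(2) by (intro bexI[of _ q]) (auto simp: dist_real_def subset_iff)
qed

lemma continuous_ge_on_rat:
  fixes G :: "real \<Rightarrow> real"
  assumes cont: "continuous_on UNIV G" and A: "open A" and G: "\<And>q. q \<in> \<rat> \<Longrightarrow> q \<in> A \<Longrightarrow> r \<le> G q" and x: "x \<in> A"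
  shows "r \<le> G x"
proof (rule ccontr)
  assume "\<not> r \<le> G x"
  then have "x \<in> A \<inter> {y. G y < r}"
    using x by simp
  moreover have "open (A \<inter> {y. G y < r})"
    using A cont by (intro open_Int open_Collect_less) auto
  ultimately obtain q where "q \<in> \<rat>" "q \<in> A \<inter> {y. G y < r}"
    using rat_in_open by blast
  then show False
    using G[of q] by auto
qed

lemma strict_exceed_iff_rat_exceed:
  assumes w: "continuous_on UNIV w" and c: "0 < c1" "0 < c2"
  shows "strict_exceed b c1 c2 w \<longleftrightarrow> rat_exceed b c1 c2 w"
proof
  assume "rat_exceed b c1 c2 w"
  then obtain t k where t: "0 < t"
    and tw: "\<And>s. s \<in> \<rat> \<Longrightarrow> s \<in> {0<..<t} \<Longrightarrow> b + c2 * t - c1 * s + 1 / real (Suc k) \<le> w (- s) - w (- t)"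
    unfolding rat_exceed_def by blast
  define G where "G s = w (- s) - w (- t) - (b + c2 * t - c1 * s + 1 / real (Suc k))" for s
  have G: "continuous_on UNIV G"
    unfolding G_def by (intro continuous_intros continuous_on_compose2[OF w]) auto
  have "0 \<le> G s" if "s \<in> {0<..<t}" for s
    by (rule continuous_ge_on_rat[OF G, of "{0<..<t}"]) (use tw that in \<open>auto simp: G_def\<close>)
  moreover have "continuous_on (closure {0<..<t}) G"
    using G by (rule continuous_on_subset) simp
  ultimately have "0 \<le> G s" if "s \<in> {0..t}" for s
    using continuous_ge_on_closure[of "{0<..<t}" G s 0] t that by simp
  then show "strict_exceed b c1 c2 w"
    unfolding strict_exceed_def using t
    by (intro exI[of _ t] conjI exI[of _ "1 / real (Suc k)"]) (auto simp: G_def)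
next
  assume "strict_exceed b c1 c2 w"
  then obtain t \<eta> where t: "0 < t" "0 < \<eta>"
    and tw: "\<And>s. 0 \<le> s \<Longrightarrow> s \<le> t \<Longrightarrow> b + c2 * t - c1 * s + \<eta> \<le> w (- s) - w (- t)"
    unfolding strict_exceed_def by auto
  have "uniformly_continuous_on {- (t + 1)..0} w"
    by (intro compact_uniformly_continuous continuous_on_subset[OF w]) auto
  then obtain d where d: "0 < d" "\<And>x y. x \<in> {- (t + 1)..0} \<Longrightarrow> y \<in> {- (t + 1)..0} \<Longrightarrow> dist y x < d \<Longrightarrow> dist (w y) (w x) < \<eta> / 8"
    unfolding uniformly_continuous_on_def using t by (metis zero_less_divide_iff zero_less_numeral)
  \<comment> \<open>The margin \<eta> is shared out: an eighth for each of two oscillations of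
    \<open>w\<close>, a quarter for \<open>c2 * (t' - t)\<close>, and a half for
    \<open>1 / real (Suc k)\<close>.\<close>
  define e where "e = min (min d 1) (\<eta> / (4 * c2))"
  have e: "0 < e" "e \<le> d" "e \<le> 1" and "e \<le> \<eta> / (4 * c2)"
    using d(1) t c by (auto simp: e_def)
  then have e4: "c2 * e \<le> \<eta> / 4"
    using c by (simp add: field_simps)
  obtain t' where t': "t' \<in> \<rat>" "t < t'" "t' < t + e"
    using Rats_dense_in_real[of t "t + e"] e by auto
  obtain k :: nat where k: "1 / real (Suc k) < \<eta> / 2"
    using nat_approx_posE[of "\<eta> / 2"] t by auto
  have "b + c2 * t' - c1 * s + 1 / real (Suc k) \<le> w (- s) - w (- t')" if s: "0 < s" "s < t'" for s
  proof -
    have 1: "dist (w (- s)) (w (- min s t)) < \<eta> / 8" "dist (w (- t')) (w (- t)) < \<eta> / 8"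
      using s t' e t by (intro d(2); auto simp: dist_real_def)+
    have "b + c2 * t - c1 * min s t + \<eta> \<le> w (- min s t) - w (- t)"
      using tw[of "min s t"] s t by auto
    moreover have "c1 * min s t \<le> c1 * s"
      using c by (intro mult_left_mono) auto
    moreover have "c2 * (t' - t) \<le> c2 * e"
      using t' c by (intro mult_left_mono) auto
    then have "c2 * t' - c2 * t \<le> \<eta> / 4"
      using e4 by (simp add: algebra_simps)
    ultimately show ?thesis
      using 1 k unfolding dist_real_def by linarith
  qed
  then show "rat_exceed b c1 c2 w"
    unfolding rat_exceed_def using t t' by (intro bexI[of _ t'] exI[of _ k]) auto
qed

section \<open>Exceedance, \<open>Sset\<close> and its closure\<close>

lemma strict_exceed_imp_Sset:
  assumes "w \<in> OmegaSet" "strict_exceed b c1 c2 w" "c2 < c1"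
  shows "w \<in> Sset b c1 c2"
proof -
  obtain t \<eta> where t: "0 < t" "0 < \<eta>"
    and tw: "\<And>s. s \<in> {0..t} \<Longrightarrow> b + c2 * t - c1 * s + \<eta> \<le> w (- s) - w (- t)"
    using assms(2) unfolding strict_exceed_def by auto
  have "b / (c1 - c2) < t"
    using tw[of t] t assms(3) by (simp add: field_simps)
  moreover have "b + c2 * t - c1 * s < w (- s) - w (- t)" if "s \<in> {0<..<t}" for s
    using tw[of s] that t by auto
  ultimately show ?thesis
    using assms(1) unfolding Sset_def by auto
qed

lemma Sset_subset_omega_closure: "Sset b c1 c2 \<subseteq> omega_closure (Sset b c1 c2)"
  unfolding omega_closure_def by (auto simp: Sset_def omega_norm_def intro!: bexI)

lemma OmegaSet_bounded:
  assumes w: "w \<in> OmegaSet"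
  shows "bdd_above (range (\<lambda>t. \<bar>w t\<bar> / (1 + \<bar>t\<bar>)))"
proof -
  have lim: "((\<lambda>t. w t / (1 + \<bar>t\<bar>)) \<longlongrightarrow> 0) at_top" "((\<lambda>t. w t / (1 + \<bar>t\<bar>)) \<longlongrightarrow> 0) at_bot"
    using w by (auto simp: OmegaSet_def)
  obtain T1 where T1: "\<And>t. T1 \<le> t \<Longrightarrow> dist (w t / (1 + \<bar>t\<bar>)) 0 < 1"
    using tendstoD[OF lim(1), of 1] by (auto simp: eventually_at_top_linorder)
  obtain T2 where T2: "\<And>t. t \<le> T2 \<Longrightarrow> dist (w t / (1 + \<bar>t\<bar>)) 0 < 1"
    using tendstoD[OF lim(2), of 1] by (auto simp: eventually_at_bot_linorder)
  have "continuous_on {T2..T1} (\<lambda>t. \<bar>w t\<bar> / (1 + \<bar>t\<bar>))"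
    by (intro continuous_intros continuous_on_subset[OF OmegaSet_continuous[OF w]]) auto
  then have "bounded ((\<lambda>t. \<bar>w t\<bar> / (1 + \<bar>t\<bar>)) ` {T2..T1})"
    by (intro compact_imp_bounded compact_continuous_image) auto
  then obtain B where "\<forall>x\<in>(\<lambda>t. \<bar>w t\<bar> / (1 + \<bar>t\<bar>)) ` {T2..T1}. norm x \<le> B"
    unfolding bounded_iff by blast
  then have B: "\<bar>w t\<bar> / (1 + \<bar>t\<bar>) \<le> B" if "t \<in> {T2..T1}" for t
    using that by fastforce
  have "\<bar>w t\<bar> / (1 + \<bar>t\<bar>) \<le> max 1 B" for t
    using T1[of t] T2[of t] B[of t] by (cases "T1 \<le> t"; cases "t \<le> T2") (auto simp: abs_divide le_max_iff_disj)
  then show ?thesis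
    by (auto simp: bdd_above_def)
qed

text \<open>The times of the approximating paths cannot escape to infinity, since the demand
  \<open>b + c2 * t\<close> grows linearly and \<open>f\<close> sublinearly. At a limit point of
  these times the constraints survive without strictness.\<close>

lemma omega_closure_Sset_weak_exceed:
  assumes f: "f \<in> omega_closure (Sset b c1 c2)" and b: "0 < b" and c: "0 < c2" "c2 < c1"
  shows "weak_exceed b c1 c2 f"
proof -
  have fO: "f \<in> OmegaSet"
    using f by (simp add: omega_closure_def)
  have "\<exists>g\<in>Sset b c1 c2. omega_norm (\<lambda>t. f t - g t) < 1 / real (Suc k)" for k
    using f by (auto simp: omega_closure_def)
  then obtain g where g: "\<And>k. g k \<in> Sset b c1 c2" "\<And>k. omega_norm (\<lambda>t. f t - g k t) < 1 / real (Suc k)"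
    by metis
  have close: "\<bar>f u - g k u\<bar> \<le> (1 + \<bar>u\<bar>) * (1 / real (Suc k))" for k u
  proof -
    have "(\<lambda>t. f t - g k t) \<in> OmegaSet"
      using OmegaSet_add[OF fO OmegaSet_cmult[of "g k" "- 1"]] g(1)[of k] by (simp add: Sset_def)
    from OmegaSet_bounded[OF this] have "\<bar>f u - g k u\<bar> / (1 + \<bar>u\<bar>) \<le> omega_norm (\<lambda>t. f t - g k t)"
      unfolding omega_norm_def by (intro cSUP_upper) auto
    then have "\<bar>f u - g k u\<bar> / (1 + \<bar>u\<bar>) \<le> 1 / real (Suc k)"
      using g(2)[of k] by simp
    then show ?thesis
      by (simp add: field_simps)
  qed
  have "\<exists>t. b / (c1 - c2) < t \<and> (\<forall>s\<in>{0..t}. b + c2 * t - c1 * s \<le> g k (- s) - g k (- t))" for k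
  proof -
    obtain t where t: "b / (c1 - c2) < t" "\<And>s. s \<in> {0<..<t} \<Longrightarrow> b + c2 * t - c1 * s < g k (- s) - g k (- t)"
      and gO: "g k \<in> OmegaSet"
      using g(1)[of k] by (auto simp: Sset_def)
    have t0: "0 < t"
      using t(1) b c by (meson diff_gt_0_iff_gt divide_pos_pos less_trans)
    define G where "G s = g k (- s) - g k (- t) - (b + c2 * t - c1 * s)" for s
    have "continuous_on (closure {0<..<t}) G"
      unfolding G_def
      by (intro continuous_intros continuous_on_compose2[OF OmegaSet_continuous[OF gO]]) auto
    then have "0 \<le> G s" if "s \<in> {0..t}" for s
      using continuous_ge_on_closure[of "{0<..<t}" G s 0] t(2) t0 that by (auto simp: G_def intro: less_imp_le)
    then show ?thesis
      using t(1) by (intro exI[of _ t]) (auto simp: G_def)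
  qed
  then obtain t where t: "\<And>k. b / (c1 - c2) < t k"
    and tg: "\<And>k s. s \<in> {0..t k} \<Longrightarrow> b + c2 * t k - c1 * s \<le> g k (- s) - g k (- t k)"
    by metis
  have tpos: "0 < t k" for k
    using t[of k] b c by (meson diff_gt_0_iff_gt divide_pos_pos less_trans)
  have tf: "b + c2 * t k - c1 * s - 2 * (1 + t k) * (1 / real (Suc k)) \<le> f (- s) - f (- t k)" if "s \<in> {0..t k}" for k s
  proof -
    define q where "q = (1 + t k) * (1 / real (Suc k))"
    have "(1 + \<bar>- s\<bar>) * (1 / real (Suc k)) \<le> q"
      unfolding q_def using that by (intro mult_right_mono) auto
    then have "\<bar>f (- s) - g k (- s)\<bar> \<le> q"
      using close[of "- s" k] by (rule order_trans[rotated])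
    moreover have "\<bar>f (- t k) - g k (- t k)\<bar> \<le> q"
      using close[of "- t k" k] tpos[of k] by (simp add: q_def)
    moreover have "2 * (1 + t k) * (1 / real (Suc k)) = 2 * q"
      by (simp only: q_def mult.assoc)
    ultimately show ?thesis
      using tg[OF that] by linarith
  qed
  \<comment> \<open>With \<open>m = min b c2\<close> the demand is at least
    \<open>m * (1 + t)\<close>. Half of this bounds \<open>f\<close> beyond \<open>T\<close>, and
    the other half will bound the approximation error once \<open>k \<ge> N\<close>.\<close>
  obtain T where T: "0 \<le> T" "\<And>u. T \<le> u \<Longrightarrow> \<bar>f (- u)\<bar> \<le> min b c2 / 2 * (1 + u)"
    using OmegaSet_past_small[OF fO, of "min b c2 / 2"] b c by auto
  obtain N :: nat where N: "4 / min b c2 < real N"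
    using reals_Archimedean2 by blast
  have bounded: "t k \<le> T" if "N \<le> k" for k
  proof (rule ccontr)
    assume "\<not> t k \<le> T"
    define m where "m = min b c2"
    have m: "0 < m" "m \<le> b" "m \<le> c2"
      using b c by (auto simp: m_def)
    have "b + c2 * t k - 2 * (1 + t k) * (1 / real (Suc k)) \<le> \<bar>f (- t k)\<bar>"
      using tf[of 0 k] tpos[of k] OmegaSet_zero[OF fO] by simp
    also have "\<dots> \<le> m / 2 * (1 + t k)"
      using T(2)[of "t k"] \<open>\<not> t k \<le> T\<close> by (simp add: m_def)
    finally have 1: "b + c2 * t k - 2 * (1 + t k) * (1 / real (Suc k)) \<le> m / 2 * (1 + t k)" .
    have "4 / m < real (Suc k)"
      using N that by (simp add: m_def)
    then have "1 / real (Suc k) < m / 4"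
      using m by (simp add: field_simps)
    then have "2 * (1 + t k) * (1 / real (Suc k)) < 2 * (1 + t k) * (m / 4)"
      using tpos[of k] by (intro mult_strict_left_mono) auto
    moreover have "m * t k \<le> c2 * t k"
      using m tpos[of k] by (intro mult_right_mono) auto
    moreover have "2 * (1 + t k) * (m / 4) = m / 2 + m * t k / 2" "m / 2 * (1 + t k) = m / 2 + m * t k / 2"
      by (simp_all add: field_simps)
    ultimately show False
      using 1 m by linarith
  qed
  have "bounded (range (\<lambda>k. t (k + N)))"
    using bounded tpos T(1) by (auto simp: bounded_iff abs_of_pos intro!: exI[of _ T])
  then obtain l \<sigma> where \<sigma>: "strict_mono \<sigma>" "((\<lambda>k. t (k + N)) \<circ> \<sigma>) \<longlonglongrightarrow> l"
    using bounded_imp_convergent_subsequence by blast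
  define \<tau> where "\<tau> = (\<lambda>k. t (\<sigma> k + N))"
  define \<epsilon> where "\<epsilon> = (\<lambda>k. 2 * (1 + \<tau> k) * (1 / real (Suc (\<sigma> k + N))))"
  have \<tau>: "\<tau> \<longlonglongrightarrow> l"
    using \<sigma>(2) by (simp add: \<tau>_def comp_def)
  have "(\<lambda>k. 1 / real (Suc k)) \<longlonglongrightarrow> 0"
    using LIMSEQ_inverse_real_of_nat by (simp add: inverse_eq_divide)
  moreover have "strict_mono (\<lambda>k. \<sigma> k + N)"
    using \<sigma>(1) by (auto simp: strict_mono_def)
  ultimately have "(\<lambda>k. 1 / real (Suc (\<sigma> k + N))) \<longlonglongrightarrow> 0"
    using LIMSEQ_subseq_LIMSEQ[of "\<lambda>k. 1 / real (Suc k)" 0 "\<lambda>k. \<sigma> k + N"] by (simp add: comp_def)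
  then have "\<epsilon> \<longlonglongrightarrow> 2 * (1 + l) * 0"
    unfolding \<epsilon>_def by (intro tendsto_intros \<tau>)
  then have \<epsilon>: "\<epsilon> \<longlonglongrightarrow> 0"
    by simp
  have l: "b / (c1 - c2) \<le> l"
    using t by (intro LIMSEQ_le_const[OF \<tau>]) (auto simp: \<tau>_def intro: less_imp_le)
  have lpos: "0 < l"
    using l b c by (meson diff_gt_0_iff_gt divide_pos_pos less_le_trans)
  have fl: "(\<lambda>k. f (- \<tau> k)) \<longlonglongrightarrow> f (- l)"
    using OmegaSet_continuous[OF fO] by (intro continuous_on_tendsto_compose[of UNIV f] tendsto_intros \<tau>) auto
  \<comment> \<open>Taking \<open>s < l\<close> guarantees that \<open>s\<close> lies below the
    approximating times eventually. The endpoint \<open>s = l\<close> follows from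
    \<open>b / (c1 - c2) \<le> l\<close>.\<close>
  have inner: "b + c2 * l - c1 * s \<le> f (- s) - f (- l)" if s: "0 \<le> s" "s < l" for s
  proof (rule LIMSEQ_le)
    show "(\<lambda>k. b + c2 * \<tau> k - c1 * s - \<epsilon> k) \<longlonglongrightarrow> b + c2 * l - c1 * s"
    proof -
      have "(\<lambda>k. b + c2 * \<tau> k - c1 * s - \<epsilon> k) \<longlonglongrightarrow> b + c2 * l - c1 * s - 0"
        by (intro tendsto_intros \<tau> \<epsilon>)
      then show ?thesis
        by simp
    qed
    show "(\<lambda>k. f (- s) - f (- \<tau> k)) \<longlonglongrightarrow> f (- s) - f (- l)"
      by (intro tendsto_intros fl)
    have "\<forall>\<^sub>F k in sequentially. s < \<tau> k"
      by (rule order_tendstoD(1)[OF \<tau> s(2)])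
    then have "\<forall>\<^sub>F k in sequentially. b + c2 * \<tau> k - c1 * s - \<epsilon> k \<le> f (- s) - f (- \<tau> k)"
    proof eventually_elim
      case (elim k)
      then show ?case
        unfolding \<tau>_def \<epsilon>_def using s by (intro tf) auto
    qed
    then show "\<exists>N. \<forall>k\<ge>N. b + c2 * \<tau> k - c1 * s - \<epsilon> k \<le> f (- s) - f (- \<tau> k)"
      by (simp add: eventually_sequentially)
  qed
  have "b + c2 * l \<le> c1 * l"
    using l c by (simp add: field_simps)
  then have "b + c2 * l - c1 * s \<le> f (- s) - f (- l)" if "s \<in> {0..l}" for s
    using inner[of s] that by (cases "s = l") auto
  then show ?thesis
    unfolding weak_exceed_def using lpos by (intro exI[of _ l]) auto
qed

section \<open>Upper bound\<close>

text \<open>Finite nonnegative combinations of the constraint functionals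
  \<open>w (- s) - w (- t)\<close>. The case \<open>s = t\<close> is left out: its functional
  vanishes, and its demand is a condition on \<open>t\<close> alone.\<close>

inductive_set past_cone :: "real \<Rightarrow> (real \<times> real) list set" for t :: real where
  Nil: "[] \<in> past_cone t"
| Cons: "0 \<le> m \<Longrightarrow> 0 \<le> s \<Longrightarrow> s < t \<Longrightarrow> ps \<in> past_cone t \<Longrightarrow> (m, - s) # (- m, - t) # ps \<in> past_cone t"

lemma past_cone_append: "ps \<in> past_cone t \<Longrightarrow> qs \<in> past_cone t \<Longrightarrow> ps @ qs \<in> past_cone t"
  by (induction rule: past_cone.induct) (auto intro: past_cone.intros)

lemma past_cone_scal:
  assumes "0 \<le> c" "ps \<in> past_cone t"
  shows "scal c ps \<in> past_cone t"
  using assms(2)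
proof induction
  case (Cons m s ps)
  then show ?case
    using past_cone.Cons[of "c * m" s t "scal c ps"] assms(1) by simp
qed (auto intro: past_cone.intros)

text \<open>\<open>B\<close> is the total mass of the coefficients. It is fixed before
  \<open>w\<close> and \<open>e\<close>, so the tolerance in the constraints can be chosen after the
  combination.\<close>

lemma past_cone_mass:
  assumes "ps \<in> past_cone t"
  shows "\<exists>B\<ge>0. \<forall>w e. (\<forall>s. 0 \<le> s \<and> s < t \<longrightarrow> \<gamma> (- s) - \<gamma> (- t) - e \<le> w (- s) - w (- t)) \<longrightarrow>
      leval \<gamma> ps - B * e \<le> leval w ps"
  using assms
proof induction
  case Nil
  then show ?case
    by (intro exI[of _ 0]) simp
next
  case (Cons m s ps)
  then obtain B where B: "0 \<le> B" "\<And>w e. (\<forall>s. 0 \<le> s \<and> s < t \<longrightarrow> \<gamma> (- s) - \<gamma> (- t) - e \<le> w (- s) - w (- t)) \<Longrightarrow>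
      leval \<gamma> ps - B * e \<le> leval w ps"
    by blast
  have "leval \<gamma> ((m, - s) # (- m, - t) # ps) - (m + B) * e \<le> leval w ((m, - s) # (- m, - t) # ps)"
    if we: "\<forall>s. 0 \<le> s \<and> s < t \<longrightarrow> \<gamma> (- s) - \<gamma> (- t) - e \<le> w (- s) - w (- t)" for w e
  proof -
    have "m * (\<gamma> (- s) - \<gamma> (- t) - e) \<le> m * (w (- s) - w (- t))"
      using Cons.hyps we by (intro mult_left_mono) auto
    then show ?thesis
      using B(2)[OF we] by (simp add: algebra_simps)
  qed
  then show ?case
    using B(1) Cons.hyps by (intro exI[of _ "m + B"]) auto
qed

text \<open>Rational times make the family countable. The strict bounds cut out an open set of
  pairs, in which rational pairs are dense, so nothing is lost for continuous paths.\<close>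

definition osc_family :: "real \<Rightarrow> nat \<Rightarrow> (real \<times> real) list set" where
  "osc_family R k = (\<lambda>(x, y). [(1, x), (- 1, y)]) `
     {(x, y). x \<in> \<rat> \<and> y \<in> \<rat> \<and> \<bar>x\<bar> < R \<and> \<bar>y\<bar> < R \<and> \<bar>x - y\<bar> < 1 / real (Suc k)}"

text \<open>The weight is that of the norm of the path space, under which paths vanish at
  infinity.\<close>

definition tail_family :: "nat \<Rightarrow> (real \<times> real) list set" where
  "tail_family k = (\<lambda>t. [(1 / (1 + t), - t)]) ` {t \<in> \<rat>. real k < t}"

lemma countable_osc_family: "countable (osc_family R k)"
  unfolding osc_family_def
  by (intro countable_image countable_subset[OF _ countable_SIGMA[OF countable_rat, of "\<lambda>_. \<rat>"]])
    (auto simp: countable_rat)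

lemma countable_tail_family: "countable (tail_family k)"
  unfolding tail_family_def
  by (intro countable_image countable_subset[OF _ countable_rat]) auto

lemma osc_family_bound:
  assumes w: "continuous_on UNIV w" and n: "\<not> exceeds (osc_family R k) r w"
    and x: "\<bar>x\<bar> < R" and y: "\<bar>y\<bar> < R" and xy: "\<bar>x - y\<bar> < 1 / real (Suc k)"
  shows "\<bar>w x - w y\<bar> \<le> r"
proof (rule ccontr)
  assume "\<not> \<bar>w x - w y\<bar> \<le> r"
  define S where "S = {p. \<bar>fst p\<bar> < R} \<inter> {p. \<bar>snd p\<bar> < R} \<inter> {p. \<bar>fst p - snd p\<bar> < 1 / real (Suc k)} \<inter>
    {p. r < \<bar>w (fst p) - w (snd p)\<bar>}"
  have "open S"
    unfolding S_def
    by (intro open_Int open_Collect_less continuous_intros continuous_on_compose2[OF w]) auto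
  moreover have "(x, y) \<in> S"
    using x y xy \<open>\<not> \<bar>w x - w y\<bar> \<le> r\<close> by (auto simp: S_def)
  ultimately obtain A B where AB: "open A" "open B" "x \<in> A" "y \<in> B" "A \<times> B \<subseteq> S"
    by (elim open_prod_elim) auto
  obtain p q where pq: "p \<in> \<rat>" "p \<in> A" "q \<in> \<rat>" "q \<in> B"
    using rat_in_open[OF AB(1,3)] rat_in_open[OF AB(2,4)] by blast
  then have "(p, q) \<in> S"
    using AB(5) by auto
  then have "exceeds (osc_family R k) r w"
    unfolding exceeds_def osc_family_def using pq
    by (intro bexI[of _ "[(1, p), (- 1, q)]"]) (auto simp: S_def)
  then show False
    using n by simp
qed

lemma tail_family_bound:
  assumes w: "continuous_on UNIV w" and n: "\<not> exceeds (tail_family k) r w" and t: "real k < t"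
  shows "\<bar>w (- t)\<bar> \<le> r * (1 + t)"
proof -
  have "0 \<le> r * (1 + t) - \<bar>w (- t)\<bar>"
  proof (rule continuous_ge_on_rat[where A = "{real k<..}" and G = "\<lambda>t. r * (1 + t) - \<bar>w (- t)\<bar>"])
    show "continuous_on UNIV (\<lambda>t. r * (1 + t) - \<bar>w (- t)\<bar>)"
      by (intro continuous_intros continuous_on_compose2[OF w]) auto
    fix q :: real assume q: "q \<in> \<rat>" "q \<in> {real k<..}"
    then have "\<bar>leval w [(1 / (1 + q), - q)]\<bar> \<le> r"
      using n unfolding exceeds_def tail_family_def by (auto simp: not_less)
    moreover have "0 < 1 + q"
      using q of_nat_0_le_iff[of k, where 'a = real] by simp
    ultimately show "0 \<le> r * (1 + q) - \<bar>w (- q)\<bar>"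
      by (simp add: abs_divide field_simps)
  qed (use t in auto)
  then show ?thesis
    by simp
qed

lemma osc_family_vanishes:
  assumes w: "continuous_on UNIV w" and r: "0 < r"
  shows "\<exists>k. \<not> exceeds (osc_family R k) r w"
proof -
  have "uniformly_continuous_on {- R..R} w"
    by (intro compact_uniformly_continuous continuous_on_subset[OF w]) auto
  then obtain d where d: "0 < d" "\<And>x y. x \<in> {- R..R} \<Longrightarrow> y \<in> {- R..R} \<Longrightarrow> dist x y < d \<Longrightarrow> dist (w x) (w y) < r"
    unfolding uniformly_continuous_on_def using r by metis
  obtain k :: nat where k: "1 / real (Suc k) < d"
    using nat_approx_posE[OF d(1)] by blast
  have "\<bar>w x - w y\<bar> \<le> r" if "\<bar>x\<bar> < R" "\<bar>y\<bar> < R" "\<bar>x - y\<bar> < 1 / real (Suc k)" for x y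
  proof -
    have "x \<in> {- R..R}" "y \<in> {- R..R}" "dist x y < d"
      using that k by (auto simp: dist_real_def)
    then show ?thesis
      using d(2)[of x y] by (simp add: dist_real_def)
  qed
  then have "\<bar>leval w ps\<bar> \<le> r" if "ps \<in> osc_family R k" for ps
    using that unfolding osc_family_def by (auto simp del: of_nat_Suc)
  then have "\<not> exceeds (osc_family R k) r w"
    by (auto simp: exceeds_def not_less)
  then show ?thesis
    by blast
qed

lemma tail_family_vanishes:
  assumes w: "w \<in> OmegaSet" and r: "0 < r"
  shows "\<exists>k. \<not> exceeds (tail_family k) r w"
proof -
  obtain T where T: "0 \<le> T" "\<And>t. T \<le> t \<Longrightarrow> \<bar>w (- t)\<bar> \<le> r * (1 + t)"
    using OmegaSet_past_small[OF w r] by blast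
  obtain k :: nat where k: "T < real k"
    using reals_Archimedean2 by blast
  have "\<bar>w (- t) / (1 + t)\<bar> \<le> r" if "real k < t" for t
  proof -
    have "0 < 1 + t"
      using that T(1) k by linarith
    then show ?thesis
      using T(2)[of t] that k by (simp add: abs_divide field_simps)
  qed
  then have "\<not> r < \<bar>leval w [(1 / (1 + t), - t)]\<bar>" if "real k < t" for t
    using that by (simp add: not_less)
  then have "\<not> exceeds (tail_family k) r w"
    unfolding exceeds_def tail_family_def by blast
  then show ?thesis
    by blast
qed

context gaussian_pair
begin

text \<open>A family that shrinks to nothing along each path is small in probability,
  and Fernique's inequality upgrades this to an arbitrary exponential rate.\<close>

lemma exponentially_small:
  assumes I: "\<And>k. countable (I k)" and dec: "\<And>k. I (Suc k) \<subseteq> I k"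
    and van: "\<And>r z. 0 < r \<Longrightarrow> z \<in> space M \<Longrightarrow> \<exists>k. \<not> exceeds (I k) r (\<lambda>t. X t z)"
    and \<delta>: "0 < \<delta>"
  shows "\<exists>k. \<forall>n\<ge>1. prob {z \<in> space M. exceeds (I k) (sqrt (real n) * \<delta>) (\<lambda>t. X t z)} \<le> exp (- (real n * L))"
proof -
  \<comment> \<open>With \<open>\<tau> = \<delta> / (4 * d)\<close> the exponent in Fernique's
    inequality becomes \<open>n * d\<^sup>2\<close>, which is at least \<open>n * L\<close>.\<close>
  define d where "d = 1 + \<bar>L\<bar>"
  have d: "1 \<le> d" "L \<le> d"
    by (auto simp: d_def)
  define \<tau> where "\<tau> = \<delta> / (4 * d)"
  have \<tau>: "0 < \<tau>" "4 * \<tau> \<le> \<delta>"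
    using \<delta> d by (auto simp: \<tau>_def field_simps)
  define B where "B k = {z \<in> space M. exceeds (I k) \<tau> (\<lambda>t. X t z)}" for k
  have B: "range B \<subseteq> events"
    unfolding B_def using I by (auto intro!: process_event exceeds_measurable)
  have "decseq B"
    using dec by (intro decseq_SucI) (auto simp: B_def exceeds_def)
  with B have "(\<lambda>k. prob (B k)) \<longlonglongrightarrow> prob (\<Inter>k. B k)"
    by (rule finite_Lim_measure_decseq)
  moreover have "(\<Inter>k. B k) = {}"
    using van[OF \<tau>(1)] unfolding B_def by blast
  ultimately have "(\<lambda>k. prob (B k)) \<longlonglongrightarrow> 0"
    by simp
  then have "\<forall>\<^sub>F k in sequentially. prob (B k) < 1 / 10"
    by (rule order_tendstoD) simp
  then obtain k where k: "prob (B k) \<le> 1 / 10"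
    by (auto simp: eventually_sequentially intro: less_imp_le)
  have "prob {z \<in> space M. exceeds (I k) (sqrt (real n) * \<delta>) (\<lambda>t. X t z)} \<le> exp (- (real n * L))" if n: "1 \<le> n" for n
  proof -
    have "1 * \<delta> \<le> sqrt (real n) * \<delta>"
      using n \<delta> by (intro mult_right_mono) auto
    then have "4 * \<tau> \<le> sqrt (real n) * \<delta>"
      using \<tau>(2) by linarith
    then have "prob {z \<in> space M. exceeds (I k) (sqrt (real n) * \<delta>) (\<lambda>t. X t z)}
        \<le> exp (- ((sqrt (real n) * \<delta>)\<^sup>2 / (16 * \<tau>\<^sup>2)))"
      using k by (intro fernique[OF I \<tau>(1)]) (simp_all add: B_def)
    also have "(sqrt (real n) * \<delta>)\<^sup>2 / (16 * \<tau>\<^sup>2) = real n * d\<^sup>2"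
      using \<delta> d by (simp add: \<tau>_def power_mult_distrib power_divide)
    also have "exp (- (real n * d\<^sup>2)) \<le> exp (- (real n * L))"
    proof -
      have "L \<le> d\<^sup>2"
        using self_le_power[of d 2] d by simp
      then show ?thesis
        by (simp add: mult_left_mono)
    qed
    finally show ?thesis .
  qed
  then show ?thesis
    by blast
qed

lemma chernoff:
  assumes n: "0 < n"
  shows "prob {z \<in> space M. sqrt (real n) * a \<le> leval (\<lambda>t. X t z) ps} \<le> exp (- (real n * (a - kgram (Gam v) ps / 2)))"
proof -
  define qs where "qs = scal (sqrt (real n)) ps"
  have law: "distr M borel (\<lambda>z. leval (\<lambda>t. X t z) qs) = centered_normal_law (kgram (Gam v) qs)"
    using X by (simp add: centered_gaussian_process_leval)
  have "{z \<in> space M. sqrt (real n) * a \<le> leval (\<lambda>t. X t z) ps}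
      = (\<lambda>z. leval (\<lambda>t. X t z) qs) -` {real n * a..} \<inter> space M"
  proof -
    have "sqrt (real n) * a \<le> x \<longleftrightarrow> real n * a \<le> sqrt (real n) * x" for x
    proof -
      have "real n * a = sqrt (real n) * (sqrt (real n) * a)"
        by simp
      then show ?thesis
        using n by (simp only: mult_le_cancel_left_pos of_nat_0_less_iff real_sqrt_gt_0_iff)
    qed
    then show ?thesis
      by (auto simp: qs_def)
  qed
  then have "prob {z \<in> space M. sqrt (real n) * a \<le> leval (\<lambda>t. X t z) ps}
      = measure (centered_normal_law (kgram (Gam v) qs)) {real n * a..}"
    unfolding law[symmetric] by (simp add: measure_distr)
  also have "\<dots> \<le> exp (kgram (Gam v) qs / 2 - real n * a)"
    by (rule centered_normal_law_upper_tail[OF kgram_nonneg])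
  also have "kgram (Gam v) qs / 2 - real n * a = - (real n * (a - kgram (Gam v) ps / 2))"
    by (simp add: qs_def kgram_scal algebra_simps)
  finally show ?thesis .
qed

end

locale gaussian_pair_paths = gaussian_pair +
  assumes X_paths: "\<And>z. z \<in> space M \<Longrightarrow> (\<lambda>t. X t z) \<in> OmegaSet"
    and Y_paths: "\<And>z. z \<in> space M \<Longrightarrow> (\<lambda>t. Y t z) \<in> OmegaSet"
begin

text \<open>The combination is chosen for \<open>t\<close>, but the path may exceed at a nearby
  \<open>t'\<close>. Outside an event of large oscillation this changes each constraint by a bounded
  amount, which the strict gain over \<open>L\<close> absorbs. The radius \<delta> does not depend
  on \<open>n\<close>, so a finite cover by such neighbourhoods serves all \<open>n\<close>.\<close>

lemma local_upper_bound:
  assumes c: "0 < c2" "c2 < c1" and t: "0 \<le> t" "b + c2 * t \<le> c1 * t"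
    and none: "\<And>f c. dominated f c \<Longrightarrow> c \<le> 2 * L \<Longrightarrow> \<not> weak_exceed b c1 c2 f"
  shows "\<exists>\<delta>>0. \<forall>n\<ge>1. \<exists>E\<in>events. prob E \<le> 2 * exp (- (real n * L)) \<and>
    (\<forall>z\<in>space M. (\<exists>t'>0. \<bar>t' - t\<bar> < \<delta> \<and>
        (\<forall>s\<in>{0..t'}. sqrt (real n) * (b + c2 * t' - c1 * s) \<le> X (- s) z - X (- t') z)) \<longrightarrow> z \<in> E)"
proof -
  \<comment> \<open>One function that meets every demand for \<open>s < t\<close> with equality. Its
    possible jump at \<open>- t\<close> is harmless, because it is only evaluated on finite
    combinations.\<close>
  define \<gamma> where "\<gamma> u = (if u = - t then - b - c2 * t else c1 * u)" for u
  have \<gamma>: "\<gamma> (- s) - \<gamma> (- t) = b + c2 * t - c1 * s" if "s < t" for s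
    using that by (simp add: \<gamma>_def)
  have "\<exists>ps\<in>past_cone t. L < leval \<gamma> ps - kgram (Gam v) ps / 2"
  proof (rule ccontr)
    assume "\<not> ?thesis"
    then have "leval \<gamma> ps - kgram (Gam v) ps / 2 \<le> L" if "ps \<in> past_cone t" for ps
      using that by (auto simp: not_less)
    from cone_maximizer[of "past_cone t" \<gamma> L, OF past_cone.Nil past_cone_append past_cone_scal this]
    obtain f where f: "f \<in> rkhs (Gam v)" "rkhs_norm2 (Gam v) f \<le> 2 * L" "\<And>qs. qs \<in> past_cone t \<Longrightarrow> leval \<gamma> qs \<le> leval f qs"
      by auto
    have "b + c2 * t - c1 * s \<le> f (- s) - f (- t)" if s: "0 \<le> s" "s \<le> t" for s
    proof (cases "s = t")
      case False
      then have "[(1, - s), (- 1, - t)] \<in> past_cone t"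
        using s by (intro past_cone.intros) auto
      from f(3)[OF this] show ?thesis
        using \<gamma>[of s] s False by simp
    qed (use t in simp)
    then have "weak_exceed b c1 c2 f"
      unfolding weak_exceed_def using t by auto
    then show False
      using none[OF rkhs_dominated[OF f(1)] f(2)] by simp
  qed
  then obtain ps where ps: "ps \<in> past_cone t" "L < leval \<gamma> ps - kgram (Gam v) ps / 2"
    by blast
  obtain B where B: "0 \<le> B" "\<And>w e. (\<forall>s. 0 \<le> s \<and> s < t \<longrightarrow> \<gamma> (- s) - \<gamma> (- t) - e \<le> w (- s) - w (- t)) \<Longrightarrow>
      leval \<gamma> ps - B * e \<le> leval w ps"
    using past_cone_mass[OF ps(1), of \<gamma>] by blast
  \<comment> \<open>Each constraint suffers three errors of size \<epsilon>: moving
    \<open>- s\<close> to \<open>- min s t'\<close>, moving \<open>- t'\<close> to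
    \<open>- t\<close>, and replacing \<open>c2 * t'\<close> by \<open>c2 * t\<close>. The total
    cost \<open>B * (3 * \<epsilon>)\<close> must fit into the gain over \<open>L\<close>;
    \<open>B + 1\<close> avoids a zero denominator.\<close>
  define \<epsilon> where "\<epsilon> = (leval \<gamma> ps - kgram (Gam v) ps / 2 - L) / (3 * (B + 1))"
  have \<epsilon>: "0 < \<epsilon>" "B * (3 * \<epsilon>) \<le> leval \<gamma> ps - kgram (Gam v) ps / 2 - L"
  proof -
    show "0 < \<epsilon>"
      using ps(2) B(1) by (simp add: \<epsilon>_def)
    then have "B * (3 * \<epsilon>) \<le> (B + 1) * (3 * \<epsilon>)"
      by simp
    also have "\<dots> = leval \<gamma> ps - kgram (Gam v) ps / 2 - L"
      using B(1) by (simp add: \<epsilon>_def field_simps)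
    finally show "B * (3 * \<epsilon>) \<le> leval \<gamma> ps - kgram (Gam v) ps / 2 - L" .
  qed
  have "\<exists>k. \<forall>n\<ge>1. prob {z \<in> space M. exceeds (osc_family (t + 2) k) (sqrt (real n) * \<epsilon>) (\<lambda>t. X t z)} \<le> exp (- (real n * L))"
  proof (rule exponentially_small[OF countable_osc_family])
    show "osc_family (t + 2) (Suc k) \<subseteq> osc_family (t + 2) k" for k
    proof -
      have "1 / real (Suc (Suc k)) \<le> 1 / real (Suc k)"
        by (simp add: field_simps)
      then show ?thesis
        unfolding osc_family_def by (intro image_mono) auto
    qed
    show "\<exists>k. \<not> exceeds (osc_family (t + 2) k) r (\<lambda>t. X t z)" if "0 < r" "z \<in> space M" for r z
      using osc_family_vanishes[OF OmegaSet_continuous[OF X_paths[OF that(2)]] that(1)] .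
  qed (rule \<epsilon>)
  then obtain k where k: "\<And>n. 1 \<le> n \<Longrightarrow>
      prob {z \<in> space M. exceeds (osc_family (t + 2) k) (sqrt (real n) * \<epsilon>) (\<lambda>t. X t z)} \<le> exp (- (real n * L))"
    by blast
  define \<delta> where "\<delta> = min (1 / real (Suc k)) (\<epsilon> / c2)"
  have \<delta>: "0 < \<delta>" "\<delta> \<le> 1 / real (Suc k)" "\<delta> \<le> 1" "c2 * \<delta> \<le> \<epsilon>"
  proof -
    show "0 < \<delta>" "\<delta> \<le> 1 / real (Suc k)"
      using \<epsilon> c by (auto simp: \<delta>_def)
    then show "\<delta> \<le> 1"
      using order_trans[of \<delta> "1 / real (Suc k)" 1] by simp
    have "\<delta> \<le> \<epsilon> / c2"
      by (simp add: \<delta>_def)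
    then show "c2 * \<delta> \<le> \<epsilon>"
      using c by (simp add: field_simps)
  qed
  have "\<exists>E\<in>events. prob E \<le> 2 * exp (- (real n * L)) \<and>
    (\<forall>z\<in>space M. (\<exists>t'>0. \<bar>t' - t\<bar> < \<delta> \<and>
        (\<forall>s\<in>{0..t'}. sqrt (real n) * (b + c2 * t' - c1 * s) \<le> X (- s) z - X (- t') z)) \<longrightarrow> z \<in> E)" if n: "1 \<le> n" for n
  proof -
    define q where "q = sqrt (real n)"
    have q: "0 < q"
      using n by (simp add: q_def)
    define a where "a = L + kgram (Gam v) ps / 2"
    define E1 where "E1 = {z \<in> space M. exceeds (osc_family (t + 2) k) (q * \<epsilon>) (\<lambda>t. X t z)}"
    define E2 where "E2 = {z \<in> space M. q * a \<le> leval (\<lambda>t. X t z) ps}"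
    have "E1 \<in> events"
      unfolding E1_def by (rule process_event[OF X_measurable exceeds_measurable[OF countable_osc_family]])
    moreover have "E2 \<in> events"
      unfolding E2_def by measurable
    ultimately have ev: "E1 \<in> events" "E2 \<in> events"
      by simp_all
    have "prob (E1 \<union> E2) \<le> prob E1 + prob E2"
      using ev by (intro measure_Un_le) auto
    also have "prob E1 \<le> exp (- (real n * L))"
      unfolding E1_def q_def using k n by simp
    also have "prob E2 \<le> exp (- (real n * L))"
      using chernoff[of n a ps] n by (simp add: E2_def a_def q_def)
    finally have prob: "prob (E1 \<union> E2) \<le> 2 * exp (- (real n * L))"
      by simp
    have "z \<in> E1 \<union> E2"
      if z: "z \<in> space M" and t': "0 < t'" "\<bar>t' - t\<bar> < \<delta>"
        and w: "\<And>s. s \<in> {0..t'} \<Longrightarrow> q * (b + c2 * t' - c1 * s) \<le> X (- s) z - X (- t') z" for z t'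
    proof (rule ccontr)
      assume notin: "z \<notin> E1 \<union> E2"
      have cont: "continuous_on UNIV (\<lambda>t. X t z)"
        by (rule OmegaSet_continuous[OF X_paths[OF z]])
      have osc: "\<bar>X x z - X y z\<bar> \<le> q * \<epsilon>" if "\<bar>x\<bar> < t + 2" "\<bar>y\<bar> < t + 2" "\<bar>x - y\<bar> < \<delta>" for x y
        using osc_family_bound[OF cont, of "t + 2" k "q * \<epsilon>" x y] that \<delta>(2) notin z by (simp add: E1_def)
      have "\<gamma> (- s) - \<gamma> (- t) - 3 * \<epsilon> \<le> X (- s) z / q - X (- t) z / q" if s: "0 \<le> s" "s < t" for s
      proof -
        have 1: "\<bar>X (- s) z - X (- min s t') z\<bar> \<le> q * \<epsilon>" "\<bar>X (- t') z - X (- t) z\<bar> \<le> q * \<epsilon>"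
          using s t' \<delta>(1,3) by (intro osc; auto)+
        have 2: "q * (b + c2 * t' - c1 * min s t') \<le> X (- min s t') z - X (- t') z"
          using s t' by (intro w) auto
        have "c2 * (t - t') \<le> c2 * \<delta>"
          using t' c by (intro mult_left_mono) auto
        moreover have "c1 * min s t' \<le> c1 * s"
          using c by (intro mult_left_mono) auto
        ultimately have "b + c2 * t - c1 * s - \<epsilon> \<le> b + c2 * t' - c1 * min s t'"
          using \<delta>(4) by (simp add: right_diff_distrib)
        then have "q * (b + c2 * t - c1 * s - \<epsilon>) \<le> q * (b + c2 * t' - c1 * min s t')"
          using q by simp
        then have "q * (b + c2 * t - c1 * s - \<epsilon>) - 2 * (q * \<epsilon>) \<le> X (- s) z - X (- t) z"
          using 1 2 by linarith
        then have "q * (b + c2 * t - c1 * s - 3 * \<epsilon>) \<le> X (- s) z - X (- t) z"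
          by (simp add: algebra_simps)
        then have "b + c2 * t - c1 * s - 3 * \<epsilon> \<le> (X (- s) z - X (- t) z) / q"
          using q by (simp add: pos_le_divide_eq mult.commute)
        then show ?thesis
          using \<gamma>[OF s(2)] by (simp add: diff_divide_distrib)
      qed
      then have "leval \<gamma> ps - B * (3 * \<epsilon>) \<le> leval (\<lambda>u. X u z / q) ps"
        by (intro B(2)) auto
      then have "a \<le> leval (\<lambda>u. X u z / q) ps"
        using \<epsilon>(2) by (simp add: a_def)
      then have "a \<le> leval (\<lambda>u. X u z) ps / q"
        by (simp add: divide_inverse leval_multc)
      then have "z \<in> E2"
        using q z by (simp add: E2_def pos_le_divide_eq mult.commute)
      then show False
        using notin by simp
    qed
    then have "\<forall>z\<in>space M. (\<exists>t'>0. \<bar>t' - t\<bar> < \<delta> \<and>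
        (\<forall>s\<in>{0..t'}. q * (b + c2 * t' - c1 * s) \<le> X (- s) z - X (- t') z)) \<longrightarrow> z \<in> E1 \<union> E2"
      by blast
    then show ?thesis
      using prob sets.Un[OF ev] unfolding q_def by blast
  qed
  then show ?thesis
    using \<delta>(1) by blast
qed

lemma upper_bound:
  assumes b: "0 < b" and c: "0 < c2" "c2 < c1"
    and none: "\<And>f c. dominated f c \<Longrightarrow> c \<le> 2 * L \<Longrightarrow> \<not> weak_exceed b c1 c2 f"
  shows "\<exists>N>0. \<forall>n\<ge>1. prob {z \<in> space M. strict_exceed (sqrt (real n) * b) (sqrt (real n) * c1) (sqrt (real n) * c2) (\<lambda>t. X t z)}
      \<le> N * exp (- (real n * L))"
proof -
  \<comment> \<open>The demand at time \<open>t\<close> is at least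
    \<open>\<kappa> * (1 + t)\<close>, twice what a path outside the tail event can reach.\<close>
  define \<kappa> where "\<kappa> = min b c2"
  have \<kappa>: "0 < \<kappa>" "\<kappa> \<le> b" "\<kappa> \<le> c2"
    using b c by (auto simp: \<kappa>_def)
  define t0 where "t0 = b / (c1 - c2)"
  have t0: "0 \<le> t0"
    using b c by (simp add: t0_def)
  have "\<exists>k. \<forall>n\<ge>1. prob {z \<in> space M. exceeds (tail_family k) (sqrt (real n) * (\<kappa> / 2)) (\<lambda>t. X t z)} \<le> exp (- (real n * L))"
  proof (rule exponentially_small[OF countable_tail_family])
    show "tail_family (Suc k) \<subseteq> tail_family k" for k
      unfolding tail_family_def by (intro image_mono) auto
    show "\<exists>k. \<not> exceeds (tail_family k) r (\<lambda>t. X t z)" if "0 < r" "z \<in> space M" for r z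
      using tail_family_vanishes[OF X_paths[OF that(2)] that(1)] .
  qed (use \<kappa> in simp)
  then obtain k where k: "\<And>n. 1 \<le> n \<Longrightarrow>
      prob {z \<in> space M. exceeds (tail_family k) (sqrt (real n) * (\<kappa> / 2)) (\<lambda>t. X t z)} \<le> exp (- (real n * L))"
    by blast
  define Good where "Good t \<delta> \<longleftrightarrow> (\<forall>n\<ge>1. \<exists>E\<in>events. prob E \<le> 2 * exp (- (real n * L)) \<and>
    (\<forall>z\<in>space M. (\<exists>t'>0. \<bar>t' - t\<bar> < \<delta> \<and>
        (\<forall>s\<in>{0..t'}. sqrt (real n) * (b + c2 * t' - c1 * s) \<le> X (- s) z - X (- t') z)) \<longrightarrow> z \<in> E))" for t \<delta>
  have "\<exists>\<delta>. 0 < \<delta> \<and> Good t \<delta>" if t: "t \<in> {t0..real k}" for t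
    unfolding Good_def
  proof (rule local_upper_bound[OF c _ _ none])
    show "0 \<le> t"
      using t t0 by simp
    show "b + c2 * t \<le> c1 * t"
      using t c by (simp add: t0_def field_simps)
  qed
  then have "\<forall>t\<in>{t0..real k}. \<exists>\<delta>. 0 < \<delta> \<and> Good t \<delta>"
    by blast
  from bchoice[OF this] obtain \<delta> where \<delta>: "\<And>t. t \<in> {t0..real k} \<Longrightarrow> 0 < \<delta> t"
    and Good: "\<And>t. t \<in> {t0..real k} \<Longrightarrow> Good t (\<delta> t)"
    by blast
  have "{t0..real k} \<subseteq> (\<Union>t\<in>{t0..real k}. ball t (\<delta> t))"
    using \<delta> by auto
  then obtain F where F: "F \<subseteq> {t0..real k}" "finite F" "{t0..real k} \<subseteq> (\<Union>t\<in>F. ball t (\<delta> t))"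
    by (rule compactE_image[OF compact_Icc, rotated]) auto
  have "prob {z \<in> space M. strict_exceed (sqrt (real n) * b) (sqrt (real n) * c1) (sqrt (real n) * c2) (\<lambda>t. X t z)}
      \<le> (1 + real (card F) * 2) * exp (- (real n * L))" if n: "1 \<le> n" for n
  proof -
    define q where "q = sqrt (real n)"
    have q: "0 < q"
      using n by (simp add: q_def)
    have "\<forall>t\<in>F. \<exists>E. E \<in> events \<and> prob E \<le> 2 * exp (- (real n * L)) \<and>
      (\<forall>z\<in>space M. (\<exists>t'>0. \<bar>t' - t\<bar> < \<delta> t \<and>
        (\<forall>s\<in>{0..t'}. q * (b + c2 * t' - c1 * s) \<le> X (- s) z - X (- t') z)) \<longrightarrow> z \<in> E)"
    proof
      fix t assume "t \<in> F"
      then have "Good t (\<delta> t)"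
        using F(1) Good by blast
      then show "\<exists>E. E \<in> events \<and> prob E \<le> 2 * exp (- (real n * L)) \<and>
        (\<forall>z\<in>space M. (\<exists>t'>0. \<bar>t' - t\<bar> < \<delta> t \<and>
          (\<forall>s\<in>{0..t'}. q * (b + c2 * t' - c1 * s) \<le> X (- s) z - X (- t') z)) \<longrightarrow> z \<in> E)"
        unfolding Good_def q_def using n by blast
    qed
    from bchoice[OF this] obtain E where E: "\<forall>t\<in>F. E t \<in> events \<and> prob (E t) \<le> 2 * exp (- (real n * L)) \<and>
      (\<forall>z\<in>space M. (\<exists>t'>0. \<bar>t' - t\<bar> < \<delta> t \<and>
        (\<forall>s\<in>{0..t'}. q * (b + c2 * t' - c1 * s) \<le> X (- s) z - X (- t') z)) \<longrightarrow> z \<in> E t)" ..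
    define D where "D = {z \<in> space M. exceeds (tail_family k) (q * (\<kappa> / 2)) (\<lambda>t. X t z)}"
    have D: "D \<in> events"
      unfolding D_def by (rule process_event[OF X_measurable exceeds_measurable[OF countable_tail_family]])
    have EF: "(\<Union>t\<in>F. E t) \<in> events"
      using F(2) E by (intro sets.finite_UN) auto
    have "{z \<in> space M. strict_exceed (q * b) (q * c1) (q * c2) (\<lambda>t. X t z)} \<subseteq> D \<union> (\<Union>t\<in>F. E t)"
    proof safe
      fix z assume z: "z \<in> space M" "strict_exceed (q * b) (q * c1) (q * c2) (\<lambda>t. X t z)"
        "z \<notin> (\<Union>t\<in>F. E t)"
      obtain t \<eta> where t: "0 < t" "0 < \<eta>"
        and tw: "\<And>s. s \<in> {0..t} \<Longrightarrow> q * b + q * c2 * t - q * c1 * s + \<eta> \<le> X (- s) z - X (- t) z"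
        using z(2) unfolding strict_exceed_def by auto
      have tw': "q * (b + c2 * t - c1 * s) \<le> X (- s) z - X (- t) z" if "s \<in> {0..t}" for s
        using tw[OF that] t(2) by (simp add: algebra_simps)
      \<comment> \<open>The constraint at \<open>s = t\<close> rules out times below
        \<open>t0\<close>, so apart from the tail only the compact interval up to \<open>k\<close>
        is left.\<close>
      have "q * (b + c2 * t - c1 * t) \<le> 0"
        using tw'[of t] t by simp
      then have "b + c2 * t - c1 * t \<le> 0"
        using q by (simp add: mult_le_0_iff)
      then have "t0 \<le> t"
        using c by (simp add: t0_def field_simps)
      show "z \<in> D"
      proof (cases "t \<le> real k")
        case True
        then obtain u where u: "u \<in> F" "\<bar>t - u\<bar> < \<delta> u"
          using F(3) \<open>t0 \<le> t\<close> by (force simp: dist_real_def)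
        then have "z \<in> E u"
          using E z(1) t(1) tw' by blast
        then show ?thesis
          using z(3) u(1) by blast
      next
        case False
        show ?thesis
        proof (rule ccontr)
          assume "z \<notin> D"
          then have "\<bar>X (- t) z\<bar> \<le> q * (\<kappa> / 2) * (1 + t)"
            using tail_family_bound[OF OmegaSet_continuous[OF X_paths[OF z(1)]], of k "q * (\<kappa> / 2)" t] False z(1)
            by (simp add: D_def)
          moreover have "q * (b + c2 * t) \<le> \<bar>X (- t) z\<bar>"
            using tw'[of 0] t OmegaSet_zero[OF X_paths[OF z(1)]] by simp
          moreover have "q * (\<kappa> * (1 + t)) \<le> q * (b + c2 * t)"
          proof -
            have "\<kappa> * t \<le> c2 * t"
              using \<kappa> t by (intro mult_right_mono) auto
            then show ?thesis
              using q \<kappa> by (intro mult_left_mono) (auto simp: distrib_left)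
          qed
          moreover have "q * (\<kappa> / 2) * (1 + t) = q * (\<kappa> * (1 + t)) / 2"
            by simp
          moreover have "0 < q * (\<kappa> * (1 + t))"
            using q \<kappa> t by simp
          ultimately show False
            by linarith
        qed
      qed
    qed
    then have "prob {z \<in> space M. strict_exceed (q * b) (q * c1) (q * c2) (\<lambda>t. X t z)} \<le> prob (D \<union> (\<Union>t\<in>F. E t))"
      using D EF by (intro finite_measure_mono) auto
    also have "\<dots> \<le> prob D + prob (\<Union>t\<in>F. E t)"
      using D EF by (intro measure_Un_le) auto
    also have "prob D \<le> exp (- (real n * L))"
      unfolding D_def q_def by (rule k[OF n])
    also have "prob (\<Union>t\<in>F. E t) \<le> (\<Sum>t\<in>F. prob (E t))"
      using F(2) E by (intro measure_UNION_le) auto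
    also have "\<dots> \<le> (\<Sum>t\<in>F. 2 * exp (- (real n * L)))"
      using E by (intro sum_mono) auto
    finally show ?thesis
      by (simp add: q_def algebra_simps)
  qed
  then show ?thesis
    by (intro exI[of _ "1 + real (card F) * 2"]) (auto simp: add_pos_nonneg)
qed

end

section \<open>Lower bound\<close>

context gaussian_pair_paths
begin

text \<open>Replacing the component of \<open>Y\<close> along \<open>kfun (Gam v) ps\<close> by an independent copy keeps the law.\<close>

lemma resampled_gaussian:
  fixes ps :: "(real \<times> real) list"
  defines "f \<equiv> kfun (Gam v) ps" and "\<sigma> \<equiv> kgram (Gam v) ps"
  assumes \<sigma>: "0 < \<sigma>"
  shows "centered_gaussian_process M v
    (\<lambda>u z. f u / \<sigma> * leval (\<lambda>t. X t z) ps + (Y u z - f u / \<sigma> * leval (\<lambda>t. Y t z) ps))"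
    (is "centered_gaussian_process M v ?W")
  unfolding centered_gaussian_process_leval
proof (intro conjI allI)
  show "?W u \<in> borel_measurable M" for u
    by measurable
  fix qs
  define \<kappa> where "\<kappa> = kin (Gam v) ps qs / \<sigma>"
  have f: "leval (\<lambda>u. f u / \<sigma> * a) qs = \<kappa> * a" for a
  proof -
    have "leval (\<lambda>u. f u / \<sigma> * a) qs = leval (\<lambda>u. f u * (a / \<sigma>)) qs"
      by simp
    also have "\<dots> = \<kappa> * a"
      unfolding leval_multc by (simp add: \<kappa>_def f_def leval_kfun)
    finally show ?thesis .
  qed
  have "leval (\<lambda>u. ?W u z) qs = leval (\<lambda>t. X t z) (scal \<kappa> ps) + leval (\<lambda>t. Y t z) (qs @ scal (- \<kappa>) ps)" for z
    unfolding leval_add leval_diff f by simp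
  then have "distr M borel (\<lambda>z. leval (\<lambda>u. ?W u z) qs)
      = centered_normal_law (kgram (Gam v) (scal \<kappa> ps) + kgram (Gam v) (qs @ scal (- \<kappa>) ps))"
    by (simp only: law_sum)
  also have "kgram (Gam v) (scal \<kappa> ps) + kgram (Gam v) (qs @ scal (- \<kappa>) ps) = kgram (Gam v) qs"
    using \<sigma> by (simp add: kgram_append kgram_scal kin_sym[of qs ps] \<kappa>_def \<sigma>_def[symmetric] field_simps power2_eq_square)
  finally show "distr M borel (\<lambda>z. leval (\<lambda>u. ?W u z) qs) = centered_normal_law (kgram (Gam v) qs)" .
qed

text \<open>Each path of the remainder is bounded on the interval, so the events increase to the
  whole space. A constant probability is enough here: the remainder is independent of the Gaussian
  variable that carries the exponential cost.\<close>

lemma eventually_small_on_compact: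
  fixes f :: "real \<Rightarrow> real"
  assumes f: "continuous_on UNIV f" and \<zeta>: "0 < \<zeta>"
  shows "\<exists>n0. \<forall>n\<ge>n0. 1 / 2 \<le> prob {z \<in> space M.
      \<forall>u\<in>\<rat> \<inter> {- t..0}. \<bar>Y u z - f u * leval (\<lambda>t. Y t z) ps\<bar> \<le> sqrt (real n) * \<zeta>}"
proof -
  define B where "B n = {z \<in> space M. \<forall>u\<in>\<rat> \<inter> {- t..0}. \<bar>Y u z - f u * leval (\<lambda>t. Y t z) ps\<bar> \<le> sqrt (real n) * \<zeta>}" for n :: nat
  have ct: "countable (\<rat> \<inter> {- t..0})"
    using countable_rat by (rule countable_subset[rotated]) auto
  have "B n \<in> events" for n
    unfolding B_def by (rule sets.sets_Collect_countable_All'[OF _ ct]) measurable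
  moreover have "incseq B"
  proof (intro incseq_SucI subsetI)
    fix n z assume "z \<in> B n"
    moreover have "sqrt (real n) * \<zeta> \<le> sqrt (real (Suc n)) * \<zeta>"
      using \<zeta> by (intro mult_right_mono) auto
    ultimately show "z \<in> B (Suc n)"
      unfolding B_def by (auto simp del: of_nat_Suc intro: order_trans)
  qed
  ultimately have "(\<lambda>n. prob (B n)) \<longlonglongrightarrow> prob (\<Union>n. B n)"
    by (intro finite_Lim_measure_incseq) auto
  moreover have "(\<Union>n. B n) = space M"
  proof (intro equalityI subsetI)
    fix z assume z: "z \<in> space M"
    have "continuous_on {- t..0} (\<lambda>u. Y u z - f u * leval (\<lambda>t. Y t z) ps)"
      by (intro continuous_intros continuous_on_subset[OF f]
          continuous_on_subset[OF OmegaSet_continuous[OF Y_paths[OF z]]]) auto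
    then have "bounded ((\<lambda>u. Y u z - f u * leval (\<lambda>t. Y t z) ps) ` {- t..0})"
      by (intro compact_imp_bounded compact_continuous_image) auto
    then obtain a where a: "\<forall>x\<in>(\<lambda>u. Y u z - f u * leval (\<lambda>t. Y t z) ps) ` {- t..0}. norm x \<le> a"
      unfolding bounded_iff by blast
    obtain n :: nat where n: "(a / \<zeta>)\<^sup>2 < real n"
      using reals_Archimedean2 by blast
    have "a / \<zeta> \<le> sqrt (real n)"
      using n by (intro real_le_rsqrt) simp
    then have "a \<le> sqrt (real n) * \<zeta>"
      using \<zeta> by (simp add: field_simps)
    then have "z \<in> B n"
      unfolding B_def using z a by (auto intro: order_trans)
    then show "z \<in> (\<Union>n. B n)"
      by blast
  qed (auto simp: B_def)
  ultimately have "(\<lambda>n. prob (B n)) \<longlonglongrightarrow> 1"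
    by (simp add: prob_space)
  then have "\<forall>\<^sub>F n in sequentially. 1 / 2 < prob (B n)"
    by (rule order_tendstoD) simp
  then show ?thesis
    unfolding B_def eventually_sequentially by (meson less_imp_le)
qed

lemma lower_bound:
  assumes b: "0 < b" and c: "0 < c2" "c2 < c1"
    and g: "dominated g d" "strict_exceed b c1 c2 g" and d: "d < 2 * x"
  shows "\<exists>C>0. \<exists>n0. \<forall>n\<ge>n0. C * exp (- (real n * x)) \<le>
    prob {z \<in> space M. rat_exceed (sqrt (real n) * b) (sqrt (real n) * c1) (sqrt (real n) * c2) (\<lambda>t. X t z)}"
proof -
  have "rat_exceed b c1 c2 g"
    using strict_exceed_iff_rat_exceed[OF dominated_continuous[OF g(1)]] g(2) c by simp
  then obtain t m where t: "t \<in> \<rat>" "0 < t"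
    and gt: "\<And>s. s \<in> \<rat> \<inter> {0<..<t} \<Longrightarrow> b + c2 * t - c1 * s + 1 / real (Suc m) \<le> g (- s) - g (- t)"
    unfolding rat_exceed_def by blast
  define \<eta> where "\<eta> = 1 / real (Suc m)"
  have \<eta>: "0 < \<eta>"
    by (simp add: \<eta>_def)
  have "continuous_on {- t..0} (\<lambda>u. v \<bar>u\<bar>)"
    using continuous_v_abs by (rule continuous_on_subset) simp
  then have "bounded ((\<lambda>u. v \<bar>u\<bar>) ` {- t..0})"
    by (intro compact_imp_bounded compact_continuous_image) auto
  then obtain V where Vn: "\<forall>x\<in>(\<lambda>u. v \<bar>u\<bar>) ` {- t..0}. norm x \<le> V"
    unfolding bounded_iff by blast
  have V: "v \<bar>u\<bar> \<le> V" if "u \<in> {- t..0}" for u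
    using bspec[OF Vn imageI[OF that]] unfolding real_norm_def by (rule abs_le_D1)
  have V0: "0 \<le> V"
    using V[of 0] t v_nonneg[of 0] by simp
  \<comment> \<open>Replacing \<open>g\<close> by a kernel combination costs
    \<open>\<eta> / 4\<close> at each of two times, so half the margin remains, and the energy stays
    below \<open>2 * x\<close>.\<close>
  define e where "e = min (\<eta> / (4 * (sqrt V + 1))) ((2 * x - d) / 2)"
  have sV: "0 < sqrt V + 1"
    using V0 by (simp add: add_nonneg_pos)
  have e: "0 < e" "d + e < 2 * x" and eV: "e * sqrt V \<le> \<eta> / 4"
  proof -
    show e: "0 < e"
      using \<eta> d sV by (simp add: e_def)
    have "e \<le> (2 * x - d) / 2"
      unfolding e_def by (rule min.cobounded2)
    then show "d + e < 2 * x"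
      using d by (simp add: field_simps)
    have "e * sqrt V \<le> e * (sqrt V + 1)"
      using e by simp
    also have "\<dots> \<le> \<eta> / (4 * (sqrt V + 1)) * (sqrt V + 1)"
      using sV by (intro mult_right_mono) (auto simp: e_def)
    also have "\<dots> = \<eta> / 4"
      using sV by (simp add: divide_simps)
    finally show "e * sqrt V \<le> \<eta> / 4" .
  qed
  obtain ps where ps: "kgram (Gam v) ps \<le> d + e" "\<And>u. \<bar>g u - kfun (Gam v) ps u\<bar> \<le> e * sqrt (Gam v u u)"
    using rkhs_kfun_approx[OF g(1) e(1)] by blast
  define f where "f = kfun (Gam v) ps"
  define \<sigma> where "\<sigma> = kgram (Gam v) ps"
  have fcont: "continuous_on UNIV f"
    unfolding f_def by (rule dominated_continuous[OF dominated_kfun])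
  have gf: "\<bar>g u - f u\<bar> \<le> \<eta> / 4" if "u \<in> {- t..0}" for u
  proof -
    have "\<bar>g u - f u\<bar> \<le> e * sqrt (v \<bar>u\<bar>)"
      using ps(2)[of u] by (simp add: f_def Gam_diag)
    also have "\<dots> \<le> e * sqrt V"
      using V[OF that] e by (intro mult_left_mono) auto
    finally show ?thesis
      using eV by simp
  qed
  have ft: "b + c2 * t - c1 * s + \<eta> / 2 \<le> f (- s) - f (- t)" if "s \<in> \<rat> \<inter> {0<..<t}" for s
  proof -
    have "\<bar>g (- s) - f (- s)\<bar> \<le> \<eta> / 4" "\<bar>g (- t) - f (- t)\<bar> \<le> \<eta> / 4"
      using that t by (intro gf; auto)+
    then show ?thesis
      using gt[OF that] unfolding \<eta>_def[symmetric] by linarith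
  qed
  \<comment> \<open>Zero energy would make \<open>f\<close> vanish, whereas the demand is positive
    for small \<open>s\<close>.\<close>
  have \<sigma>0: "0 < \<sigma>"
  proof (rule ccontr)
    assume "\<not> 0 < \<sigma>"
    then have "dominated f 0"
      using dominated_kfun[of ps] kgram_nonneg[of ps] by (simp add: f_def \<sigma>_def)
    then have f0: "f u = 0" for u
      using dominated_abs[of f 0 "[(1, u)]"] by simp
    obtain s where "s \<in> \<rat>" "0 < s" "s < min t (b / c1)"
      using Rats_dense_in_real[of 0 "min t (b / c1)"] t b c by auto
    moreover from this have "c1 * s < b"
      using c by (simp add: field_simps)
    moreover have "0 < c2 * t"
      using c t by simp
    ultimately show False
      using ft[of s] \<eta> by (auto simp: f0)
  qed
  have "bounded (f ` {- t..0})"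
    by (intro compact_imp_bounded compact_continuous_image continuous_on_subset[OF fcont]) auto
  then obtain F where F: "\<forall>x\<in>f ` {- t..0}. norm x \<le> F"
    unfolding bounded_iff by blast
  have F0: "0 \<le> F"
    using F t by force
  have "((\<lambda>\<rho>. (1 + \<rho>)\<^sup>2 * \<sigma>) \<longlongrightarrow> (1 + 0)\<^sup>2 * \<sigma>) (at_right 0)"
    by (intro tendsto_intros)
  moreover have "(1 + 0)\<^sup>2 * \<sigma> < 2 * x"
    using ps(1) e by (simp add: \<sigma>_def)
  ultimately have "\<forall>\<^sub>F \<rho> in at_right 0. (1 + \<rho>)\<^sup>2 * \<sigma> < 2 * x"
    by (rule order_tendstoD(2))
  then obtain \<rho>0 where \<rho>0: "0 < \<rho>0" "\<And>\<rho>. 0 < \<rho> \<Longrightarrow> \<rho> < \<rho>0 \<Longrightarrow> (1 + \<rho>)\<^sup>2 * \<sigma> < 2 * x"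
    unfolding eventually_at_right_field by auto
  \<comment> \<open>The coefficient of \<open>f\<close> is only confined to
    \<open>[q, q * (1 + \<rho>)]\<close>. The bound by \<open>\<rho>0\<close> keeps the Gaussian
    exponent at the far end of this window below \<open>n * x\<close>; the other bound keeps the
    overshoot's effect on increments of \<open>f\<close> below \<open>\<eta> / 8\<close>.\<close>
  define \<rho> where "\<rho> = min (\<rho>0 / 2) (\<eta> / (16 * (F + 1)))"
  have \<rho>: "0 < \<rho>" "(1 + \<rho>)\<^sup>2 * \<sigma> < 2 * x" and \<rho>F: "\<rho> * (2 * F) \<le> \<eta> / 8"
  proof -
    show \<rho>: "0 < \<rho>"
      using \<rho>0 \<eta> F0 by (simp add: \<rho>_def)
    show "(1 + \<rho>)\<^sup>2 * \<sigma> < 2 * x"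
      using \<rho>0 \<rho> by (intro \<rho>0(2)) (auto simp: \<rho>_def)
    have "\<rho> * (2 * F) \<le> \<rho> * (2 * (F + 1))"
      using \<rho> by simp
    also have "\<dots> \<le> \<eta> / (16 * (F + 1)) * (2 * (F + 1))"
      using F0 by (intro mult_right_mono) (auto simp: \<rho>_def)
    also have "\<dots> = \<eta> / 8"
      using F0 by (simp add: field_simps)
    finally show "\<rho> * (2 * F) \<le> \<eta> / 8" .
  qed
  define W where "W = (\<lambda>u z. f u / \<sigma> * leval (\<lambda>t. X t z) ps + (Y u z - f u / \<sigma> * leval (\<lambda>t. Y t z) ps))"
  have W: "centered_gaussian_process M v W"
    unfolding W_def f_def \<sigma>_def by (rule resampled_gaussian) (use \<sigma>0 in \<open>simp add: \<sigma>_def\<close>)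
  have Wm [measurable]: "W u \<in> borel_measurable M" for u
    using W by (simp add: centered_gaussian_process_def)
  have "continuous_on UNIV (\<lambda>u. f u / \<sigma>)"
    by (intro continuous_intros fcont) (use \<sigma>0 in auto)
  from eventually_small_on_compact[OF this, of "\<eta> / 16" t ps] \<eta>
  obtain n0 where n0: "\<And>n. n0 \<le> n \<Longrightarrow> 1 / 2 \<le> prob {z \<in> space M.
      \<forall>u\<in>\<rat> \<inter> {- t..0}. \<bar>Y u z - f u / \<sigma> * leval (\<lambda>t. Y t z) ps\<bar> \<le> sqrt (real n) * (\<eta> / 16)}"
    by auto
  define C where "C = \<rho> * \<sigma> / sqrt (2 * pi * \<sigma>) / 2"
  have C: "0 < C"
    using \<rho> \<sigma>0 by (simp add: C_def)
  have "C * exp (- (real n * x)) \<le>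
      prob {z \<in> space M. rat_exceed (sqrt (real n) * b) (sqrt (real n) * c1) (sqrt (real n) * c2) (\<lambda>t. X t z)}"
    if n: "max 1 n0 \<le> n" for n
  proof -
    define q where "q = sqrt (real n)"
    have q: "1 \<le> q" "0 < q" "q\<^sup>2 = real n"
      using n by (simp_all add: q_def)
    define P where "P w \<longleftrightarrow> leval w ps \<in> {q * \<sigma>..q * \<sigma> * (1 + \<rho>)}" for w
    define Q where "Q w \<longleftrightarrow> (\<forall>u\<in>\<rat> \<inter> {- t..0}. \<bar>w u - f u / \<sigma> * leval w ps\<bar> \<le> q * (\<eta> / 16))" for w
    have P: "{w. P w} \<in> sets product_borel"
    proof -
      have "(\<lambda>w. leval w ps) -` {q * \<sigma>..q * \<sigma> * (1 + \<rho>)} \<inter> space product_borel \<in> sets product_borel"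
        by (rule measurable_sets[OF PiM_UNIV_leval_measurable]) simp
      then show ?thesis
        by (simp add: P_def vimage_def space_PiM)
    qed
    have Q: "{w. Q w} \<in> sets product_borel"
    proof -
      have ct: "countable (\<rat> \<inter> {- t..0})"
        using countable_rat by (rule countable_subset[rotated]) auto
      have [measurable]: "(\<lambda>w. w u) \<in> borel_measurable product_borel" for u :: real
        by (rule measurable_component_singleton) simp
      have "{w \<in> space product_borel. Q w} \<in> sets product_borel"
        unfolding Q_def by (rule sets.sets_Collect_countable_All'[OF _ ct]) measurable
      then show ?thesis
        by (simp add: space_PiM)
    qed
    have law: "distr M borel (\<lambda>z. leval (\<lambda>t. X t z) ps) = centered_normal_law \<sigma>"
      using X by (simp add: centered_gaussian_process_leval \<sigma>_def)
    have "C * exp (- (real n * x)) = \<rho> * \<sigma> * (exp (- (real n * x)) / sqrt (2 * pi * \<sigma>)) / 2"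
      by (simp add: C_def)
    also have "\<dots> \<le> (q * \<sigma> * (1 + \<rho>) - q * \<sigma>) * (exp (- ((q * \<sigma> * (1 + \<rho>))\<^sup>2) / (2 * \<sigma>)) / sqrt (2 * pi * \<sigma>)) / 2"
    proof (intro divide_right_mono mult_mono)
      show "\<rho> * \<sigma> \<le> q * \<sigma> * (1 + \<rho>) - q * \<sigma>"
        using mult_right_mono[OF q(1), of "\<rho> * \<sigma>"] \<rho> \<sigma>0 by (simp add: algebra_simps)
      then show "0 \<le> q * \<sigma> * (1 + \<rho>) - q * \<sigma>"
        using mult_pos_pos[OF \<rho>(1) \<sigma>0] by linarith
      have "(q * \<sigma> * (1 + \<rho>))\<^sup>2 / (2 * \<sigma>) = real n * ((1 + \<rho>)\<^sup>2 * \<sigma>) / 2"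
        using \<sigma>0 q(3) by (simp add: power_mult_distrib power2_eq_square field_simps)
      also have "\<dots> \<le> real n * (2 * x) / 2"
        using \<rho> by (intro divide_right_mono mult_left_mono) auto
      finally show "exp (- (real n * x)) \<le> exp (- ((q * \<sigma> * (1 + \<rho>))\<^sup>2) / (2 * \<sigma>))"
        by simp
    qed (use \<sigma>0 in auto)
    also have "\<dots> \<le> measure (centered_normal_law \<sigma>) {q * \<sigma>..q * \<sigma> * (1 + \<rho>)} / 2"
      using \<sigma>0 q \<rho> by (intro divide_right_mono centered_normal_law_Icc_ge) auto
    also have "\<dots> = prob {z \<in> space M. P (\<lambda>t. X t z)} * (1 / 2)"
      unfolding law[symmetric] by (simp add: measure_distr P_def vimage_def Int_def conj_commute)
    also have "\<dots> \<le> prob {z \<in> space M. P (\<lambda>t. X t z)} * prob {z \<in> space M. Q (\<lambda>t. Y t z)}"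
      using n0[of n] n by (intro mult_left_mono) (auto simp: Q_def q_def)
    also have "\<dots> = prob {z \<in> space M. P (\<lambda>t. X t z) \<and> Q (\<lambda>t. Y t z)}"
      by (rule prob_indep[OF P Q, symmetric])
    also have "\<dots> \<le> prob {z \<in> space M. rat_exceed (q * b) (q * c1) (q * c2) (\<lambda>t. W t z)}"
    proof (rule finite_measure_mono)
      show "{z \<in> space M. rat_exceed (q * b) (q * c1) (q * c2) (\<lambda>t. W t z)} \<in> events"
        by (rule process_event[OF Wm rat_exceed_measurable])
      show "{z \<in> space M. P (\<lambda>t. X t z) \<and> Q (\<lambda>t. Y t z)}
        \<subseteq> {z \<in> space M. rat_exceed (q * b) (q * c1) (q * c2) (\<lambda>t. W t z)}"
      proof safe
        fix z assume Pz: "P (\<lambda>t. X t z)" and Qz: "Q (\<lambda>t. Y t z)"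
        define \<theta> where "\<theta> = leval (\<lambda>t. X t z) ps / (q * \<sigma>) - 1"
        have \<theta>: "0 \<le> \<theta>" "\<theta> \<le> \<rho>"
          using Pz q \<sigma>0 by (auto simp: \<theta>_def P_def field_simps)
        have W\<theta>: "W u z = q * (1 + \<theta>) * f u + (Y u z - f u / \<sigma> * leval (\<lambda>t. Y t z) ps)" for u
          using q \<sigma>0 by (simp add: W_def \<theta>_def field_simps)
        \<comment> \<open>Of the margin \<open>\<eta> / 2\<close>, the overshoot \<theta> takes
          \<open>\<eta> / 8\<close> and the remainder of \<open>Y\<close> takes
          \<open>\<eta> / 16\<close> at each of two times; \<open>\<eta> / 4\<close> is
          left.\<close>
        have "q * b + q * c2 * t - q * c1 * s + q * (\<eta> / 4) \<le> W (- s) z - W (- t) z" if s: "s \<in> \<rat> \<inter> {0<..<t}" for s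
        proof -
          have "- s \<in> \<rat> \<inter> {- t..0}" "- t \<in> \<rat> \<inter> {- t..0}"
            using s t by auto
          then have "\<bar>Y (- s) z - f (- s) / \<sigma> * leval (\<lambda>t. Y t z) ps\<bar> \<le> q * (\<eta> / 16)"
            "\<bar>Y (- t) z - f (- t) / \<sigma> * leval (\<lambda>t. Y t z) ps\<bar> \<le> q * (\<eta> / 16)"
            "\<bar>f (- s)\<bar> \<le> F" "\<bar>f (- t)\<bar> \<le> F"
            using Qz F unfolding Q_def by auto
          note bnd = this
          have "\<theta> * \<bar>f (- s) - f (- t)\<bar> \<le> \<rho> * (2 * F)"
            using \<theta> bnd(3,4) by (intro mult_mono) auto
          then have "\<bar>\<theta> * (f (- s) - f (- t))\<bar> \<le> \<eta> / 8"
            using \<rho>F \<theta> by (simp add: abs_mult)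
          then have "b + c2 * t - c1 * s + \<eta> / 2 - \<eta> / 8 \<le> f (- s) - f (- t) + \<theta> * (f (- s) - f (- t))"
            using ft[OF s] by linarith
          then have "q * (b + c2 * t - c1 * s + \<eta> / 2 - \<eta> / 8) \<le> q * (f (- s) - f (- t) + \<theta> * (f (- s) - f (- t)))"
            using q by (intro mult_left_mono) auto
          moreover have "q * (b + c2 * t - c1 * s + \<eta> / 2 - \<eta> / 8)
              = q * b + q * c2 * t - q * c1 * s + q * (\<eta> / 4) + q * (\<eta> / 16) + q * (\<eta> / 16)"
            by (simp add: algebra_simps)
          moreover have "W (- s) z - W (- t) z = q * (f (- s) - f (- t) + \<theta> * (f (- s) - f (- t)))
              + (Y (- s) z - f (- s) / \<sigma> * leval (\<lambda>t. Y t z) ps)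
              - (Y (- t) z - f (- t) / \<sigma> * leval (\<lambda>t. Y t z) ps)"
            unfolding W\<theta> by (simp add: algebra_simps)
          ultimately show ?thesis
            using bnd(1,2) by linarith
        qed
        moreover obtain k :: nat where "1 / real (Suc k) < q * (\<eta> / 4)"
          using nat_approx_posE[of "q * (\<eta> / 4)"] q \<eta> by auto
        ultimately have "q * b + q * c2 * t - q * c1 * s + 1 / real (Suc k) \<le> W (- s) z - W (- t) z" if s: "s \<in> \<rat> \<inter> {0<..<t}" for s
          using s by fastforce
        then show "rat_exceed (q * b) (q * c1) (q * c2) (\<lambda>t. W t z)"
          unfolding rat_exceed_def using t by (intro bexI[of _ t] exI[of _ k] ballI) auto
      qed
    qed
    also have "\<dots> = prob {z \<in> space M. rat_exceed (q * b) (q * c1) (q * c2) (\<lambda>t. X t z)}"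
      by (rule gaussian_transfer[OF prob_space_axioms prob_space_axioms W X rat_exceed_measurable])
    finally show ?thesis
      by (simp add: q_def)
  qed
  then show ?thesis
    using C by blast
qed

end

section \<open>The decay rate\<close>

lemma (in prob_space) indep_vars_imp_indep_var:
  assumes "indep_vars (\<lambda>_. N) X UNIV" "i \<noteq> j"
  shows "indep_var N (X i) N (X j)"
proof -
  have "indep_var N ((\<lambda>g. g i) \<circ> (\<lambda>z. restrict (\<lambda>i. X i z) {i})) N ((\<lambda>g. g j) \<circ> (\<lambda>z. restrict (\<lambda>i. X i z) {j}))"
    by (rule indep_var_compose[OF indep_var_restrict[OF assms(1), of "{i}" "{j}"]])
      (use assms(2) in \<open>auto intro!: measurable_component_singleton\<close>)
  then show ?thesis
    by (simp add: comp_def)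
qed

lemma (in prob_space) normalized_sum_gaussian:
  assumes A: "\<And>i. centered_gaussian_process M v (A i)"
    and ind: "indep_vars (\<lambda>_. PiM UNIV (\<lambda>_. borel)) (\<lambda>i z t. A i t z) UNIV"
    and psd: "\<And>ps. 0 \<le> kgram (Gam v) ps" and n: "0 < n"
  shows "centered_gaussian_process M v (\<lambda>t z. 1 / sqrt (real n) * (\<Sum>i<n. A i t z))"
  unfolding centered_gaussian_process_leval
proof (intro conjI allI)
  have [measurable]: "A i t \<in> borel_measurable M" for i t
    using A by (simp add: centered_gaussian_process_def)
  show "(\<lambda>z. 1 / sqrt (real n) * (\<Sum>i<n. A i t z)) \<in> borel_measurable M" for t
    by measurable
  fix ps :: "(real \<times> real) list"
  have "indep_vars (\<lambda>_. borel) (\<lambda>i z. leval (\<lambda>t. A i t z) ps) {..<n}"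
    using indep_vars_compose2[OF indep_vars_subset[OF ind, of "{..<n}"], of "\<lambda>_ w. leval w ps" "\<lambda>_. borel"] by simp
  then have "distr M borel (\<lambda>z. \<Sum>i<n. leval (\<lambda>t. A i t z) ps) = centered_normal_law (real n * kgram (Gam v) ps)"
    using A psd by (intro centered_normal_law_sum) (auto simp: centered_gaussian_process_leval)
  then have "distr M borel (\<lambda>z. 1 / sqrt (real n) * (\<Sum>i<n. leval (\<lambda>t. A i t z) ps))
      = centered_normal_law ((1 / sqrt (real n))\<^sup>2 * (real n * kgram (Gam v) ps))"
    using psd by (intro centered_normal_law_cmult) auto
  also have "(1 / sqrt (real n))\<^sup>2 * (real n * kgram (Gam v) ps) = kgram (Gam v) ps"
    using n by (simp add: power_divide)
  finally show "distr M borel (\<lambda>z. leval (\<lambda>t. 1 / sqrt (real n) * (\<Sum>i<n. A i t z)) ps) = centered_normal_law (kgram (Gam v) ps)"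
    unfolding leval_cmult leval_sum .
qed

lemma Q2_iff_rat_exceed:
  assumes paths: "\<And>i. (\<lambda>t. A i t z) \<in> OmegaSet" and c: "0 < c2" "c2 < c1" and n: "0 < n"
  shows "real n * b < Q2 A c1 c2 n z \<longleftrightarrow>
    rat_exceed (sqrt (real n) * b) (sqrt (real n) * c1) (sqrt (real n) * c2) (\<lambda>t. 1 / sqrt (real n) * (\<Sum>i<n. A i t z))"
proof -
  define q where "q = sqrt (real n)"
  have q: "0 < q" "real n = q * q"
    using n by (simp_all add: q_def)
  define w where "w = (\<lambda>t. \<Sum>i<n. A i t z)"
  have w: "w \<in> OmegaSet"
    unfolding w_def by (intro OmegaSet_sum paths)
  have "real n * b < Q2 A c1 c2 n z \<longleftrightarrow> strict_exceed (real n * b) (real n * c1) (real n * c2) w"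
    unfolding Q2_def sum_subtractf using sup_diff_iff_strict_exceed[OF w, of "real n * c2" "real n * c1" "real n * b"] c n
    by (simp add: w_def)
  also have "w = (\<lambda>t. q * (1 / q * w t))"
    using q by simp
  also have "strict_exceed (real n * b) (real n * c1) (real n * c2) (\<lambda>t. q * (1 / q * w t))
      \<longleftrightarrow> strict_exceed (q * b) (q * c1) (q * c2) (\<lambda>t. 1 / q * w t)"
    unfolding q(2) mult.assoc[of q q] by (rule strict_exceed_scale[OF q(1)])
  also have "\<dots> \<longleftrightarrow> rat_exceed (q * b) (q * c1) (q * c2) (\<lambda>t. 1 / q * w t)"
    using c q by (intro strict_exceed_iff_rat_exceed OmegaSet_continuous OmegaSet_cmult w) auto
  finally show ?thesis
    by (simp only: q_def w_def)
qed

lemma neglog_ge: "p \<le> exp (- u) \<Longrightarrow> ereal u \<le> neglog p"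
  unfolding neglog_def by (auto simp: ln_le_cancel_iff[symmetric] simp del: ln_le_cancel_iff)

lemma neglog_le: "exp (- u) \<le> p \<Longrightarrow> neglog p \<le> ereal u"
proof -
  assume p: "exp (- u) \<le> p"
  then have "0 < p"
    using exp_gt_zero less_le_trans by blast
  moreover from this p have "- u \<le> ln p"
    using ln_le_cancel_iff[of "exp (- u)" p] by simp
  ultimately show ?thesis
    by (simp add: neglog_def)
qed

lemma tendsto_minus_over_n: "(\<lambda>n. L - a / real n) \<longlonglongrightarrow> L"
  using tendsto_diff[OF tendsto_const lim_const_over_n[of a], of L] by simp

theorem theorem3p1:
  fixes M :: "'a measure" and v :: "real \<Rightarrow> real" and A :: "nat \<Rightarrow> real \<Rightarrow> 'a \<Rightarrow> real"
    and b c1 c2 :: real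
  assumes "prob_space M"
    and "continuous_on {0..} v" and "\<forall>t\<ge>0. v t \<ge> 0" and "v 0 = 0"
    and "\<exists>\<alpha><2. ((\<lambda>t. v t / t powr \<alpha>) \<longlongrightarrow> 0) at_top"
    and "\<forall>i. centered_gaussian_process M v (A i)"
    and "\<forall>i. \<forall>\<omega>\<in>space M. (\<lambda>t. A i t \<omega>) \<in> OmegaSet"
    and "prob_space.indep_vars M (\<lambda>_. PiM UNIV (\<lambda>_. borel)) (\<lambda>i \<omega>. (\<lambda>t. A i t \<omega>)) UNIV"
    and "b > 0" and "c1 > c2" and "c2 > 0"
  shows "\<exists>J. ((\<lambda>n. ereal (1 / real n) *
                   neglog (measure M {\<omega> \<in> space M. Q2 A c1 c2 n \<omega> > real n * b})) \<longlongrightarrow> J) sequentially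
           \<and> J = (INF f\<in>omega_closure (Sset b c1 c2). rate_fn (Gam v) f)
           \<and> J = (INF f\<in>Sset b c1 c2. rate_fn (Gam v) f)"
proof -
  interpret M: prob_space M by fact
  have A: "centered_gaussian_process M v (A i)" for i
    using assms(6) by simp
  have paths: "(\<lambda>t. A i t z) \<in> OmegaSet" if "z \<in> space M" for i z
    using assms(7) that by simp
  have psd: "0 \<le> kgram (Gam v) ps" for ps
    using assms(3,4) by (intro centered_gaussian_process_psd[OF assms(1) A]) auto
  interpret gaussian_pair_paths M v "A 0" "A 1"
  proof (intro gaussian_pair_paths.intro gaussian_pair.intro gaussian_pair_axioms.intro gaussian_pair_paths_axioms.intro
      variance_function.intro)
    show "M.indep_var product_borel (\<lambda>z t. A 0 t z) product_borel (\<lambda>z t. A 1 t z)"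
      using M.indep_vars_imp_indep_var[OF assms(8), of 0 1] by simp
  qed (use assms A paths psd in auto)
  define p where "p n = measure M {z \<in> space M. Q2 A c1 c2 n z > real n * b}" for n
  have p: "p n = measure M {z \<in> space M. rat_exceed (sqrt (real n) * b) (sqrt (real n) * c1) (sqrt (real n) * c2) (\<lambda>t. A 0 t z)}"
    if n: "0 < n" for n
  proof -
    have "{z \<in> space M. Q2 A c1 c2 n z > real n * b} = {z \<in> space M. rat_exceed (sqrt (real n) * b) (sqrt (real n) * c1)
        (sqrt (real n) * c2) (\<lambda>t. 1 / sqrt (real n) * (\<Sum>i<n. A i t z))}"
      using Q2_iff_rat_exceed[of A _ c2 c1 n b] paths assms(10,11) n by (intro Collect_cong conj_cong) auto
    then show ?thesis
      unfolding p_def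
      using gaussian_transfer[OF assms(1,1) M.normalized_sum_gaussian[OF A assms(8) psd n] A[of 0] rat_exceed_measurable]
      by simp
  qed
  have p_strict: "p n = measure M {z \<in> space M. strict_exceed (sqrt (real n) * b) (sqrt (real n) * c1) (sqrt (real n) * c2) (\<lambda>t. A 0 t z)}"
    if n: "0 < n" for n
  proof -
    have "strict_exceed (sqrt (real n) * b) (sqrt (real n) * c1) (sqrt (real n) * c2) (\<lambda>t. A 0 t z) \<longleftrightarrow>
        rat_exceed (sqrt (real n) * b) (sqrt (real n) * c1) (sqrt (real n) * c2) (\<lambda>t. A 0 t z)" if "z \<in> space M" for z
      using assms(10,11) n by (intro strict_exceed_iff_rat_exceed OmegaSet_continuous[OF paths[OF that]]) auto
    then show ?thesis
      unfolding p[OF n] by (intro arg_cong[of _ _ "measure M"]) blast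
  qed
  define J where "J = (INF f\<in>Sset b c1 c2. rate_fn (Gam v) f)"
  \<comment> \<open>Every comparison of \<open>J\<close> from above passes through weak exceedances:
    they are what the closure and the contrapositive of the upper bound supply.\<close>
  have J_le: "J \<le> ereal x" if f: "dominated f c" "weak_exceed b c1 c2 f" "c \<le> 2 * x" for f c x
  proof (rule ereal_le_epsilon2)
    fix e :: real assume e: "0 < e"
    obtain g d where g: "dominated g d" "d < 2 * (x + e)" "strict_exceed b c1 c2 g"
      using weak_imp_strict_exceed[OF f(1,2) assms(9,10,11), of "2 * (x + e)"] f(3) e by auto
    have "g \<in> Sset b c1 c2"
      by (rule strict_exceed_imp_Sset[OF dominated_OmegaSet[OF g(1)] g(3) assms(10)])
    then have "J \<le> rate_fn (Gam v) g"
      unfolding J_def by (rule INF_lower)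
    also have "\<dots> \<le> ereal (x + e)"
      using g by (subst rate_fn_le_iff) (auto intro: less_imp_le)
    finally show "J \<le> ereal x + ereal e"
      by simp
  qed
  have "J = (INF f\<in>omega_closure (Sset b c1 c2). rate_fn (Gam v) f)"
  proof (rule antisym)
    show "(INF f\<in>omega_closure (Sset b c1 c2). rate_fn (Gam v) f) \<le> J"
      unfolding J_def by (rule INF_superset_mono[OF Sset_subset_omega_closure]) simp
    show "J \<le> (INF f\<in>omega_closure (Sset b c1 c2). rate_fn (Gam v) f)"
    proof (rule INF_greatest)
      fix f assume "f \<in> omega_closure (Sset b c1 c2)"
      then have weak: "weak_exceed b c1 c2 f"
        using assms(9-11) by (intro omega_closure_Sset_weak_exceed) auto
      show "J \<le> rate_fn (Gam v) f"
      proof (cases "f \<in> rkhs (Gam v)")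
        case True
        then show ?thesis
          using J_le[OF rkhs_dominated[OF True] weak, of "rkhs_norm2 (Gam v) f / 2"] by (simp add: rate_fn_def)
      qed (simp add: rate_fn_def)
    qed
  qed
  moreover have "((\<lambda>n. ereal (1 / real n) * neglog (p n)) \<longlongrightarrow> J) sequentially"
  proof (rule order_tendstoI)
    fix a assume "a < J"
    \<comment> \<open>\<open>L\<close> is finite although \<open>J\<close> may be infinite. The gap
      between \<open>y\<close> and \<open>L\<close> absorbs the constant \<open>N\<close>.\<close>
    then obtain L where L: "a < ereal L" "ereal L < J"
      using ereal_dense2 by blast
    obtain y where y: "a < ereal y" "y < L"
      using ereal_dense2[OF L(1)] by auto
    have none: "\<not> weak_exceed b c1 c2 f" if "dominated f c" "c \<le> 2 * L" for f c
      using J_le[OF that(1) _ that(2)] L(2) by (auto simp: not_le[symmetric])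
    have "\<exists>N>0. \<forall>n\<ge>1. measure M {z \<in> space M. strict_exceed (sqrt (real n) * b) (sqrt (real n) * c1) (sqrt (real n) * c2) (\<lambda>t. A 0 t z)}
        \<le> N * exp (- (real n * L))"
      using assms(9,11,10) none by (rule upper_bound)
    then obtain N where N: "0 < N"
      and "\<And>n. 1 \<le> n \<Longrightarrow> measure M {z \<in> space M. strict_exceed (sqrt (real n) * b) (sqrt (real n) * c1) (sqrt (real n) * c2) (\<lambda>t. A 0 t z)}
        \<le> N * exp (- (real n * L))"
      by blast
    then have pN: "p n \<le> N * exp (- (real n * L))" if "1 \<le> n" for n
      using p_strict[of n] that by simp
    have "\<forall>\<^sub>F n in sequentially. y < L - ln N / real n"
      using tendsto_minus_over_n y(2) by (rule order_tendstoD)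
    then show "\<forall>\<^sub>F n in sequentially. a < ereal (1 / real n) * neglog (p n)"
      using eventually_ge_at_top[of 1]
    proof eventually_elim
      case (elim n)
      have "N * exp (- (real n * L)) = exp (- (real n * L - ln N))"
        using N by (simp add: exp_diff exp_minus field_simps)
      then have "ereal (real n * L - ln N) \<le> neglog (p n)"
        using pN[OF elim(2)] by (intro neglog_ge) simp
      then have "ereal (1 / real n) * ereal (real n * L - ln N) \<le> ereal (1 / real n) * neglog (p n)"
        by (intro ereal_mult_left_mono) auto
      moreover have "1 / real n * (real n * L - ln N) = L - ln N / real n"
        using elim by (simp add: field_simps)
      ultimately have "ereal (L - ln N / real n) \<le> ereal (1 / real n) * neglog (p n)"
        by simp
      moreover have "a < ereal (L - ln N / real n)"
        using y(1) elim(1) less_trans by fastforce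
      ultimately show ?case
        by (rule less_le_trans[rotated])
    qed
  next
    fix a assume "J < a"
    then obtain f where f: "f \<in> Sset b c1 c2" "rate_fn (Gam v) f < a"
      unfolding J_def by (auto simp: INF_less_iff)
    obtain x where x: "rate_fn (Gam v) f < ereal x" "ereal x < a"
      using ereal_dense2[OF f(2)] by blast
    \<comment> \<open>The gap from \<open>x\<close> to \<open>y\<close> pays for making the
      exceedance strict, and the gap from \<open>y\<close> to \<open>u\<close> for the constant
      \<open>C\<close>.\<close>
    obtain y where y: "x < y" "ereal y < a"
      using ereal_dense2[OF x(2)] by auto
    obtain u where u: "y < u" "ereal u < a"
      using ereal_dense2[OF y(2)] by auto
    obtain c where c: "dominated f c" "c \<le> 2 * x"
      using rate_fn_le_iff[of f x] x(1) by auto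
    have "weak_exceed b c1 c2 f"
      using f(1) Sset_subset_omega_closure assms(9-11) by (intro omega_closure_Sset_weak_exceed) auto
    then obtain g d where g: "dominated g d" "d < 2 * y" "strict_exceed b c1 c2 g"
      using weak_imp_strict_exceed[OF c(1) _ assms(9,10,11), of "2 * y"] c(2) y(1) by auto
    obtain C n0 where C: "0 < C" "\<And>n. n0 \<le> n \<Longrightarrow> C * exp (- (real n * y)) \<le>
        measure M {z \<in> space M. rat_exceed (sqrt (real n) * b) (sqrt (real n) * c1) (sqrt (real n) * c2) (\<lambda>t. A 0 t z)}"
      using lower_bound[OF assms(9,11,10) g(1,3,2)] by blast
    have "\<forall>\<^sub>F n in sequentially. y - ln C / real n < u"
      using tendsto_minus_over_n u(1) by (rule order_tendstoD)
    then show "\<forall>\<^sub>F n in sequentially. ereal (1 / real n) * neglog (p n) < a"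
      using eventually_ge_at_top[of "max 1 n0"]
    proof eventually_elim
      case (elim n)
      have "exp (- (real n * y - ln C)) = C * exp (- (real n * y))"
        using C(1) by (simp add: exp_diff exp_minus field_simps)
      also have "\<dots> \<le> p n"
        using C(2)[of n] p[of n] elim(2) by simp
      finally have "neglog (p n) \<le> ereal (real n * y - ln C)"
        by (rule neglog_le)
      then have "ereal (1 / real n) * neglog (p n) \<le> ereal (1 / real n) * ereal (real n * y - ln C)"
        by (intro ereal_mult_left_mono) auto
      also have "\<dots> = ereal (y - ln C / real n)"
        using elim(2) by (simp add: field_simps)
      also have "\<dots> < ereal u"
        using elim(1) by simp
      finally show ?case
        using u(2) by (rule less_trans)
    qed
  qed
  ultimately show ?thesis
    unfolding p_def by (intro exI[of _ J]) (simp add: J_def)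
qed

end
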